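(* Let $R$ be a 2-Henselian valuation ring with finite residue field $\mathbb{F}$ of odd characteristic. Then every isomorphism class of $R$-lattices contains a unique representative of the form $\bigoplus_{v}\sigma_{v}^{\varepsilon_{v}n_{v}}$, where the (orthogonal) direct sum is finite. In other words, every $R$-lattice is isomorphic to such a finite direct sum over distinct $v\geq0$ in $\Gamma$, with $n_{v}\geq1$ and $\varepsilon_{v}\in\{\pm1\}$ for the values $v$ which occur, and the finite set of values $v$ together with the ranks $n_{v}$ and the signs $\varepsilon_{v}$ are uniquely determined by the isomorphism class.
   Context: A valuation ring $R$ is an integral domain with fraction field $\mathbb{K}$, together with a totally ordered abelian group $\Gamma$ (additive, arbitrary rank) and a surjective homomorphism $v:\mathbb{K}^{*}\to\Gamma$ satisfying $v(x+y)\geq\min\{v(x),v(y)\}$, extended by $v(0)=\infty$, such that $R=\{x\in\mathbb{K}: v(x)\geq0\}$. $I_{0}=\{x: v(x)>0\}$ is its maximal ideal, and $\mathbb{F}=R/I_{0}$. $R$ is 2-Henselian if $2\neq0$ in $R$ and for every monic $f\in R[x]$ of degree 2 and every $a\in R$ with $v(f(a))>0$ and $v(f'(a))=0$ there is a root $b\in R$ of $f$ with $b-a\in I_{0}$. An $R$-lattice is a free $R$-module $M$ of finite rank with a symmetric bilinear form $M\times M\to R$ which is non-degenerate, i.e. the induced map $M\to \mathrm{Hom}_{R}(M,R)$ is injective; it is unimodular if this map is bijective. Isomorphisms preserve the bilinear forms. $L(a)$ denotes $L$ with the bilinear form multiplied by $0\neq a\in R$. For every $v\in\Gamma$ with $v\geq0$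 fix an element $\sigma_{v}\in R$ with valuation $v$, with $\sigma_{0}=1$. For $n\geq1$ and $\varepsilon\in\mathbb{F}^{*}/(\mathbb{F}^{*})^{2}\cong\{\pm1\}$, $1^{\varepsilon n}$ denotes the unimodular $R$-lattice (unique up to isomorphism) whose reduction modulo $I_{0}$ is an $\mathbb{F}$-lattice of rank $n$ whose sign, i.e. the image in $\mathbb{F}^{*}/(\mathbb{F}^{*})^{2}$ of the determinant of a Gram matrix, is $\varepsilon$. Put $\sigma_{v}^{\varepsilon n}=1^{\varepsilon n}(\sigma_{v})$. *)

theory Defs
  imports
    "HOL-Algebra.Module"
    "HOL-Algebra.QuotRing"
    "HOL-Algebra.Multiplicative_Group"
    "HOL-Combinatorics.Permutations"
    "HOL-Computational_Algebra.Polynomial"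
begin

hide_const (open) Multiset.mult Polynomial.smult

section \<open>Valuation rings\<close>

text \<open>The fraction field is the type \<open>'k\<close> and the value group is the type \<open>'g\<close>. The convention
  \<open>v 0 = \<infinity>\<close> is implemented by treating \<open>0\<close> separately; the actual value \<open>v 0\<close> is never used.\<close>

locale field_valuation =
  fixes v :: "'k::field \<Rightarrow> 'g::linordered_ab_group_add"
  assumes val_mult: "x \<noteq> 0 \<Longrightarrow> y \<noteq> 0 \<Longrightarrow> v (x * y) = v x + v y"
    and val_add: "x \<noteq> 0 \<Longrightarrow> y \<noteq> 0 \<Longrightarrow> x + y \<noteq> 0 \<Longrightarrow> min (v x) (v y) \<le> v (x + y)"
    and val_surj: "v ` (UNIV - {0}) = UNIV"

definition val_ring :: "('k::field \<Rightarrow> 'g::linordered_ab_group_add) \<Rightarrow> 'k ring" where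
  "val_ring v = \<lparr>carrier = {x. x = 0 \<or> 0 \<le> v x}, mult = (*), one = 1, zero = 0, add = (+)\<rparr>"

definition val_ideal :: "('k::field \<Rightarrow> 'g::linordered_ab_group_add) \<Rightarrow> 'k set" where
  "val_ideal v = {x. x = 0 \<or> 0 < v x}"

definition residue_field :: "('k::field \<Rightarrow> 'g::linordered_ab_group_add) \<Rightarrow> 'k set ring" where
  "residue_field v = val_ring v Quot val_ideal v"

definition two_henselian :: "('k::field \<Rightarrow> 'g::linordered_ab_group_add) \<Rightarrow> bool" where
  "two_henselian v \<longleftrightarrow> (2 :: 'k) \<noteq> 0 \<and>
    (\<forall>f a. (\<forall>i. coeff f i \<in> carrier (val_ring v)) \<and> degree f = 2 \<and> lead_coeff f = 1 \<and>
       a \<in> carrier (val_ring v) \<and> poly f a \<in> val_ideal v \<and>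
       poly (pderiv f) a \<noteq> 0 \<and> v (poly (pderiv f) a) = 0 \<longrightarrow>
       (\<exists>b \<in> carrier (val_ring v). poly f b = 0 \<and> b - a \<in> val_ideal v))"

text \<open>The additive order of \<open>1\<close>; it is \<open>0\<close> if that order is infinite.\<close>

definition ring_char :: "('a, 'x) ring_scheme \<Rightarrow> nat" where
  "ring_char A = group.ord (add_monoid A) \<one>\<^bsub>A\<^esub>"


section \<open>Lattices over a commutative ring\<close>

text \<open>As in \<^theory>\<open>HOL-Algebra.Module\<close>, the record fields \<open>mult\<close> and \<open>one\<close> inherited from rings
  carry no meaning for a module.\<close>

record ('a, 'b) form_module = "('a, 'b) module" +
  form :: "'b \<Rightarrow> 'b \<Rightarrow> 'a"

definition module_basis ::
    "('a, 'x) ring_scheme \<Rightarrow> ('a, 'b, 'y) module_scheme \<Rightarrow> nat \<Rightarrow> (nat \<Rightarrow> 'b) \<Rightarrow> bool" where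
  "module_basis A M n b \<longleftrightarrow> b \<in> {..<n} \<rightarrow> carrier M \<and>
    (\<forall>x \<in> carrier M. \<exists>!c. c \<in> {..<n} \<rightarrow>\<^sub>E carrier A \<and>
       x = (\<Oplus>\<^bsub>M\<^esub>i\<in>{..<n}. c i \<odot>\<^bsub>M\<^esub> b i))"

definition module_dual ::
    "('a, 'x) ring_scheme \<Rightarrow> ('a, 'b, 'y) module_scheme \<Rightarrow> ('b \<Rightarrow> 'a) set" where
  "module_dual A M = {f \<in> carrier M \<rightarrow>\<^sub>E carrier A.
    (\<forall>x \<in> carrier M. \<forall>y \<in> carrier M. f (x \<oplus>\<^bsub>M\<^esub> y) = f x \<oplus>\<^bsub>A\<^esub> f y) \<and>
    (\<forall>a \<in> carrier A. \<forall>x \<in> carrier M. f (a \<odot>\<^bsub>M\<^esub> x) = a \<otimes>\<^bsub>A\<^esub> f x)}"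

definition form_map :: "('a, 'b, 'y) form_module_scheme \<Rightarrow> 'b \<Rightarrow> 'b \<Rightarrow> 'a" where
  "form_map M x = (\<lambda>y\<in>carrier M. form M x y)"

locale form_lattice = module A M for A (structure) and M :: "('a, 'b, 'y) form_module_scheme" (structure) +
  assumes free_of_finite_rank: "\<exists>n b. module_basis A M n b"
    and form_closed: "x \<in> carrier M \<Longrightarrow> y \<in> carrier M \<Longrightarrow> form M x y \<in> carrier A"
    and form_sym: "x \<in> carrier M \<Longrightarrow> y \<in> carrier M \<Longrightarrow> form M x y = form M y x"
    and form_add: "x \<in> carrier M \<Longrightarrow> y \<in> carrier M \<Longrightarrow> z \<in> carrier M \<Longrightarrow>
      form M (x \<oplus>\<^bsub>M\<^esub> y) z = form M x z \<oplus>\<^bsub>A\<^esub> form M y z"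
    and form_smult: "a \<in> carrier A \<Longrightarrow> x \<in> carrier M \<Longrightarrow> y \<in> carrier M \<Longrightarrow>
      form M (a \<odot>\<^bsub>M\<^esub> x) y = a \<otimes>\<^bsub>A\<^esub> form M x y"
    and nondegenerate: "inj_on (form_map M) (carrier M)"

definition unimodular :: "('a, 'x) ring_scheme \<Rightarrow> ('a, 'b, 'y) form_module_scheme \<Rightarrow> bool" where
  "unimodular A M \<longleftrightarrow> bij_betw (form_map M) (carrier M) (module_dual A M)"

definition isometric :: "('a, 'x) ring_scheme \<Rightarrow> ('a, 'b, 'y) form_module_scheme \<Rightarrow>
    ('a, 'c, 'z) form_module_scheme \<Rightarrow> bool" where
  "isometric A M N \<longleftrightarrow> (\<exists>f. bij_betw f (carrier M) (carrier N) \<and>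
    (\<forall>x \<in> carrier M. \<forall>y \<in> carrier M. f (x \<oplus>\<^bsub>M\<^esub> y) = f x \<oplus>\<^bsub>N\<^esub> f y) \<and>
    (\<forall>a \<in> carrier A. \<forall>x \<in> carrier M. f (a \<odot>\<^bsub>M\<^esub> x) = a \<odot>\<^bsub>N\<^esub> f x) \<and>
    (\<forall>x \<in> carrier M. \<forall>y \<in> carrier M. form N (f x) (f y) = form M x y))"

definition scale_form :: "('a, 'x) ring_scheme \<Rightarrow> 'a \<Rightarrow>
    ('a, 'b, 'y) form_module_scheme \<Rightarrow> ('a, 'b, 'y) form_module_scheme" where
  "scale_form A a M = M\<lparr>form := \<lambda>x y. a \<otimes>\<^bsub>A\<^esub> form M x y\<rparr>"

definition orthogonal_sum :: "('a, 'x) ring_scheme \<Rightarrow> 'i set \<Rightarrow>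
    ('i \<Rightarrow> ('a, 'b, 'y) form_module_scheme) \<Rightarrow> ('a, 'i \<Rightarrow> 'b) form_module" where
  "orthogonal_sum A S L =
    \<lparr>carrier = \<Pi>\<^sub>E i\<in>S. carrier (L i),
     mult = \<lambda>_ _. undefined, one = undefined,
     zero = \<lambda>i\<in>S. \<zero>\<^bsub>L i\<^esub>,
     add = \<lambda>x y. \<lambda>i\<in>S. x i \<oplus>\<^bsub>L i\<^esub> y i,
     smult = \<lambda>a x. \<lambda>i\<in>S. a \<odot>\<^bsub>L i\<^esub> x i,
     form = \<lambda>x y. \<Oplus>\<^bsub>A\<^esub>i\<in>S. form (L i) (x i) (y i)\<rparr>"


section \<open>Reduction modulo an ideal\<close>

definition ideal_smult :: "'a set \<Rightarrow> ('a, 'b, 'y) module_scheme \<Rightarrow> 'b set" where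
  "ideal_smult I M = {\<Oplus>\<^bsub>M\<^esub>i\<in>{..<n::nat}. a i \<odot>\<^bsub>M\<^esub> x i | n a x.
     a \<in> {..<n} \<rightarrow> I \<and> x \<in> {..<n} \<rightarrow> carrier M}"

text \<open>The \<open>A Quot I\<close>-module \<open>M / I M\<close> with the induced form. As for \<^const>\<open>rcoset_mult\<close> in the
  definition of \<open>A Quot I\<close>, operations on cosets are written as unions of cosets over all
  representatives; all cosets occurring in such a union coincide.\<close>

definition reduction :: "('a, 'x) ring_scheme \<Rightarrow> 'a set \<Rightarrow>
    ('a, 'b, 'y) form_module_scheme \<Rightarrow> ('a set, 'b set) form_module" where
  "reduction A I M =
    \<lparr>carrier = a_rcosets\<^bsub>M\<^esub> (ideal_smult I M),
     mult = \<lambda>_ _. undefined, one = undefined,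
     zero = ideal_smult I M,
     add = set_add M,
     smult = \<lambda>C X. \<Union>a\<in>C. \<Union>x\<in>X. ideal_smult I M +>\<^bsub>M\<^esub> (a \<odot>\<^bsub>M\<^esub> x),
     form = \<lambda>X Y. \<Union>x\<in>X. \<Union>y\<in>Y. I +>\<^bsub>A\<^esub> form M x y\<rparr>"


section \<open>The sign of a lattice over a field\<close>

definition det_of :: "('a, 'x) ring_scheme \<Rightarrow> nat \<Rightarrow> (nat \<Rightarrow> nat \<Rightarrow> 'a) \<Rightarrow> 'a" where
  "det_of A n G = (\<Oplus>\<^bsub>A\<^esub>p\<in>{p. p permutes {..<n}}.
     (if evenperm p then (\<Otimes>\<^bsub>A\<^esub>i\<in>{..<n}. G i (p i))
      else \<ominus>\<^bsub>A\<^esub> (\<Otimes>\<^bsub>A\<^esub>i\<in>{..<n}. G i (p i))))"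

text \<open>The class of a unit \<open>d\<close> of a finite field of odd characteristic modulo squares, where the group
  of square classes (of order two) is identified with \<open>{1, -1}\<close>.\<close>

definition square_class :: "('a, 'x) ring_scheme \<Rightarrow> 'a \<Rightarrow> int" where
  "square_class F d = (if \<exists>y \<in> Units F. d = y \<otimes>\<^bsub>F\<^esub> y then 1 else - 1)"

definition has_rank_sign :: "('a, 'x) ring_scheme \<Rightarrow> ('a, 'b, 'y) form_module_scheme \<Rightarrow>
    nat \<Rightarrow> int \<Rightarrow> bool" where
  "has_rank_sign F L n \<epsilon> \<longleftrightarrow> (\<exists>b. module_basis F L n b \<and>
     square_class F (det_of F n (\<lambda>i j. form L (b i) (b j))) = \<epsilon>)"


section \<open>Jordan decompositions\<close>

definition is_unit_lattice :: "('k::field \<Rightarrow> 'g::linordered_ab_group_add) \<Rightarrow> nat \<Rightarrow> int \<Rightarrow>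
    ('k, 'b, 'y) form_module_scheme \<Rightarrow> bool" where
  "is_unit_lattice v n \<epsilon> L \<longleftrightarrow>
     form_lattice (val_ring v) L \<and> unimodular (val_ring v) L \<and>
     form_lattice (residue_field v) (reduction (val_ring v) (val_ideal v) L) \<and>
     has_rank_sign (residue_field v) (reduction (val_ring v) (val_ideal v) L) n \<epsilon>"

text \<open>The lattice \<open>1\<^sup>\<epsilon>\<^sup>n\<close>, which is determined only up to isomorphism: an arbitrary lattice with the
  required properties is chosen. Every free module of finite rank is isomorphic to one whose elements
  are functions from \<open>nat\<close> to the fraction field, so this type of elements is no restriction.\<close>

definition unit_lattice :: "('k::field \<Rightarrow> 'g::linordered_ab_group_add) \<Rightarrow> nat \<Rightarrow> int \<Rightarrow>
    ('k, nat \<Rightarrow> 'k) form_module" where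
  "unit_lattice v n \<epsilon> = (SOME L. is_unit_lattice v n \<epsilon> L)"

text \<open>A symbol is a finite partial map; its domain is the set of values which occur, and it sends
  such a value to the corresponding rank and sign.\<close>

definition jordan_symbol :: "('g::linordered_ab_group_add \<rightharpoonup> nat \<times> int) \<Rightarrow> bool" where
  "jordan_symbol s \<longleftrightarrow> finite (dom s) \<and>
     (\<forall>\<gamma> n \<epsilon>. s \<gamma> = Some (n, \<epsilon>) \<longrightarrow> 0 \<le> \<gamma> \<and> 1 \<le> n \<and> \<epsilon> \<in> {1, - 1})"

definition jordan_lattice :: "('k::field \<Rightarrow> 'g::linordered_ab_group_add) \<Rightarrow> ('g \<Rightarrow> 'k) \<Rightarrow>
    ('g \<rightharpoonup> nat \<times> int) \<Rightarrow> ('k, 'g \<Rightarrow> nat \<Rightarrow> 'k) form_module" where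
  "jordan_lattice v \<sigma> s = orthogonal_sum (val_ring v) (dom s)
     (\<lambda>\<gamma>. case the (s \<gamma>) of (n, \<epsilon>) \<Rightarrow> scale_form (val_ring v) (\<sigma> \<gamma>) (unit_lattice v n \<epsilon>))"

end

theory Submission
  imports Defs "Jordan_Normal_Form.Determinant"
begin

text \<open>
  Existence. Gram-Schmidt orthogonalisation works over the valuation ring if one always pivots on an
  entry of the Gram matrix of least value, because such an entry divides all the others. If no entry
  of least value lies on the diagonal, then \<open>b\<^sub>i + b\<^sub>j\<close> has a norm of that value, because
  \<open>2\<close> is a unit. Thus every lattice has an orthogonal basis (\<open>lattice_isometric_diag\<close>). Now collect the
  norms of this basis by value: those of value \<open>\<gamma>\<close> are \<open>\<sigma> \<gamma>\<close> times units. For units \<open>a\<close> and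
  \<open>b\<close> the form \<open>a x\<^sup>2 + b y\<^sup>2\<close> represents \<open>1\<close>, modulo the maximal ideal by counting and
  then exactly by Hensel's lemma, so that the forms with diagonals \<open>(a, b)\<close> and \<open>(1, a b)\<close> are
  isometric. Since the squares have index two among the units, every unimodular diagonal form has a
  diagonal \<open>(d, 1, \<dots>, 1)\<close> where \<open>d\<close> is \<open>1\<close> or one fixed nonsquare (\<open>isometric_unit_diag\<close>), and
  these are models of the lattices \<open>1\<^sup>\<epsilon>\<^sup>n\<close> (\<open>is_unit_lattice_diag\<close>, \<open>is_unit_lattice_isometric\<close>).

  Uniqueness. For \<open>\<gamma> \<ge> 0\<close> look at vectors \<open>x\<close> of \<open>M\<close> whose products with all of \<open>M\<close> are
  divisible by \<open>\<sigma> \<gamma>\<close>, and divide the products of two such vectors by \<open>\<sigma> \<gamma>\<close>. In an orthogonal basis,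
  the basis vectors with norms of a value other than \<open>\<gamma>\<close> contribute to the quotient only an element of
  the maximal ideal (\<open>off_value_product\<close>). Hence modulo the maximal ideal the matrix of these quotients,
  for \<open>k\<close> such vectors, is \<open>A E A\<^sup>T\<close> where \<open>E\<close> is the unimodular block of value \<open>\<gamma>\<close>. Its
  determinant can be a unit only if \<open>k\<close> is at most the rank of the block, and if \<open>k\<close> is this rank,
  then its square class is the sign of the block (\<open>gram_class_diag\<close>). So the rank and the sign of the
  block of value \<open>\<gamma>\<close> are described without reference to a decomposition.
\<close>

hide_const (open) Multiset.mult Polynomial.smult

section \<open>The valuation ring and its residue field\<close>

context field_valuation
begin

abbreviation ints where "ints \<equiv> carrier (val_ring v)"
abbreviation max_ideal where "max_ideal \<equiv> val_ideal v"

lemma val_ring_sel [simp]: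
  "x \<otimes>\<^bsub>val_ring v\<^esub> y = x * y" "\<one>\<^bsub>val_ring v\<^esub> = 1" "\<zero>\<^bsub>val_ring v\<^esub> = 0" "x \<oplus>\<^bsub>val_ring v\<^esub> y = x + y"
  by (simp_all add: val_ring_def)

lemma ints_iff: "x \<in> ints \<longleftrightarrow> x = 0 \<or> 0 \<le> v x"
  by (simp add: val_ring_def)

lemma max_ideal_iff: "x \<in> max_ideal \<longleftrightarrow> x = 0 \<or> 0 < v x"
  by (simp add: val_ideal_def)

lemma val_one: "v 1 = 0"
  using val_mult[of 1 1] by simp

lemma val_minus_one: "v (- 1) = 0"
proof -
  have "v (- 1) + v (- 1) = 0"
    using val_mult[of "- 1" "- 1"] val_one by simp
  then show ?thesis
    using double_zero by blast
qed

lemma val_minus: "x \<noteq> 0 \<Longrightarrow> v (- x) = v x"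
  using val_mult[of "- 1" x] val_minus_one by simp

lemma val_inverse: "x \<noteq> 0 \<Longrightarrow> v (inverse x) = - v x"
  using val_mult[of x "inverse x"] val_one by (simp add: eq_neg_iff_add_eq_0 add.commute)

lemma val_divide: "x \<noteq> 0 \<Longrightarrow> y \<noteq> 0 \<Longrightarrow> v (x / y) = v x - v y"
  by (simp add: divide_inverse val_mult val_inverse)

lemma ints_add: "x \<in> ints \<Longrightarrow> y \<in> ints \<Longrightarrow> x + y \<in> ints"
  using val_add[of x y] by (cases "x = 0"; cases "y = 0"; force simp: ints_iff min_def split: if_splits)

lemma ints_mult: "x \<in> ints \<Longrightarrow> y \<in> ints \<Longrightarrow> x * y \<in> ints"
  using val_mult[of x y] by (cases "x = 0"; cases "y = 0"; simp add: ints_iff)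

lemma ints_minus: "x \<in> ints \<Longrightarrow> - x \<in> ints"
  using val_minus[of x] by (cases "x = 0"; simp add: ints_iff)

lemma ints_0_1: "0 \<in> ints" "1 \<in> ints"
  by (simp_all add: ints_iff val_one)

lemmas ints_closed [simp, intro] = ints_0_1 ints_add ints_minus ints_mult

lemma ints_diff [simp, intro]: "x \<in> ints \<Longrightarrow> y \<in> ints \<Longrightarrow> x - y \<in> ints"
  using ints_closed(3)[of x "- y"] by simp

lemma ints_sum [intro]: "(\<And>i. i \<in> S \<Longrightarrow> f i \<in> ints) \<Longrightarrow> sum f S \<in> ints"
  by (induction S rule: infinite_finite_induct) auto

lemma ints_prod [intro]: "(\<And>i. i \<in> S \<Longrightarrow> f i \<in> ints) \<Longrightarrow> prod f S \<in> ints"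
  by (induction S rule: infinite_finite_induct) auto

lemma max_ideal_add: "x \<in> max_ideal \<Longrightarrow> y \<in> max_ideal \<Longrightarrow> x + y \<in> max_ideal"
  using val_add[of x y] by (cases "x = 0"; cases "y = 0"; force simp: max_ideal_iff min_def split: if_splits)

lemma max_ideal_mult: "x \<in> ints \<Longrightarrow> y \<in> max_ideal \<Longrightarrow> x * y \<in> max_ideal"
  using val_mult[of x y] by (cases "x = 0"; cases "y = 0"; simp add: ints_iff max_ideal_iff add_nonneg_pos)

lemma max_ideal_mult': "x \<in> max_ideal \<Longrightarrow> y \<in> ints \<Longrightarrow> x * y \<in> max_ideal"
  using max_ideal_mult[of y x] by (simp add: mult.commute)

lemma max_ideal_minus: "x \<in> max_ideal \<Longrightarrow> - x \<in> max_ideal"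
  using val_minus[of x] by (cases "x = 0"; simp add: max_ideal_iff)

lemma max_ideal_0: "0 \<in> max_ideal"
  by (simp add: max_ideal_iff)

lemmas max_ideal_closed [simp, intro] = max_ideal_0 max_ideal_add max_ideal_minus max_ideal_mult max_ideal_mult'

lemma max_ideal_diff [simp, intro]: "x \<in> max_ideal \<Longrightarrow> y \<in> max_ideal \<Longrightarrow> x - y \<in> max_ideal"
  using max_ideal_closed(2)[of x "- y"] by simp

lemma max_ideal_sum [intro]: "(\<And>i. i \<in> S \<Longrightarrow> f i \<in> max_ideal) \<Longrightarrow> sum f S \<in> max_ideal"
  by (induction S rule: infinite_finite_induct) auto

lemma max_ideal_ints [simp]: "x \<in> max_ideal \<Longrightarrow> x \<in> ints"
  by (auto simp: max_ideal_iff ints_iff)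

lemma one_notin_max_ideal [simp]: "1 \<notin> max_ideal"
  by (simp add: max_ideal_iff val_one)

lemma max_ideal_prime: "x \<in> ints \<Longrightarrow> y \<in> ints \<Longrightarrow> x * y \<in> max_ideal \<Longrightarrow> x \<in> max_ideal \<or> y \<in> max_ideal"
  using val_mult[of x y] by (cases "x = 0"; cases "y = 0"; auto simp: ints_iff max_ideal_iff)

definition val_unit :: "'k \<Rightarrow> bool" where "val_unit x \<longleftrightarrow> x \<noteq> 0 \<and> v x = 0"

lemma val_unit_iff: "val_unit x \<longleftrightarrow> x \<in> ints \<and> x \<notin> max_ideal"
  by (auto simp: val_unit_def ints_iff max_ideal_iff)

lemma val_unit_ints [simp]: "val_unit x \<Longrightarrow> x \<in> ints"
  by (simp add: val_unit_iff)

lemma val_unit_nonzero: "val_unit x \<Longrightarrow> x \<noteq> 0"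
  by (simp add: val_unit_def)

lemma val_unit_simps [simp]:
  shows "val_unit 1" and "val_unit x \<Longrightarrow> val_unit y \<Longrightarrow> val_unit (x * y)"
    and "val_unit x \<Longrightarrow> val_unit (inverse x)" and "val_unit x \<Longrightarrow> val_unit y \<Longrightarrow> val_unit (x / y)"
    and "val_unit x \<Longrightarrow> val_unit (- x)"
  by (auto simp: val_unit_def val_mult val_inverse val_one val_divide val_minus)

lemma val_unit_prod [intro]: "(\<And>i. i \<in> S \<Longrightarrow> val_unit (f i)) \<Longrightarrow> val_unit (prod f S)"
  by (induction S rule: infinite_finite_induct) auto

lemma val_unit_multD: "x \<in> ints \<Longrightarrow> y \<in> ints \<Longrightarrow> val_unit (x * y) \<Longrightarrow> val_unit x \<and> val_unit y"
  by (auto simp: val_unit_iff)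

lemma val_unit_cong: "val_unit x \<Longrightarrow> x - y \<in> max_ideal \<Longrightarrow> val_unit y"
proof -
  assume a: "val_unit x" "x - y \<in> max_ideal"
  have y: "y = x - (x - y)" by simp
  have "y \<in> ints"
    using a ints_diff[of x "x - y"] by simp
  moreover have "y \<notin> max_ideal"
    using a max_ideal_closed(2)[of "x - y" y] by (auto simp: val_unit_iff)
  ultimately show "val_unit y" by (simp add: val_unit_iff)
qed

lemma mult_cong_max_ideal:
  assumes "x - x' \<in> max_ideal" "y - y' \<in> max_ideal" "x \<in> ints" "y' \<in> ints"
  shows "x * y - x' * y' \<in> max_ideal"
proof -
  have "x * y - x' * y' = x * (y - y') + (x - x') * y'"
    by (simp add: algebra_simps)
  with assms show ?thesis by (metis max_ideal_closed(2,4,5))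
qed

lemma cong_ints: "x - y \<in> max_ideal \<Longrightarrow> x \<in> ints \<longleftrightarrow> y \<in> ints"
proof -
  assume a: "x - y \<in> max_ideal"
  have "y = x - (x - y)" "x = y + (x - y)" by simp_all
  with a max_ideal_ints[OF a] show ?thesis by (metis ints_closed(3) ints_diff)
qed

lemma prod_cong_max_ideal:
  assumes "\<And>i. i \<in> S \<Longrightarrow> f i \<in> ints" "\<And>i. i \<in> S \<Longrightarrow> f i - g i \<in> max_ideal"
  shows "prod f S - prod g S \<in> max_ideal"
  using assms
proof (induction S rule: infinite_finite_induct)
  case (insert a S)
  have "prod g S \<in> ints"
    using insert.prems by (meson cong_ints insertI2 ints_prod)
  with insert show ?case by (auto intro: mult_cong_max_ideal)
qed auto

lemma sum_cong_max_ideal: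
  assumes "\<And>i. i \<in> S \<Longrightarrow> f i - g i \<in> max_ideal"
  shows "sum f S - sum g S \<in> max_ideal"
  using assms by (auto simp: sum_subtractf[symmetric])

lemma cring_val_ring: "cring (val_ring v)"
proof (rule cringI)
  show "abelian_group (val_ring v)"
    by (rule abelian_groupI) (auto simp: algebra_simps intro!: bexI[of _ "- x" for x])
  show "Group.comm_monoid (val_ring v)"
    by (rule comm_monoidI) (auto simp: algebra_simps)
qed (simp add: algebra_simps)

lemma a_inv_val_ring [simp]: "x \<in> ints \<Longrightarrow> \<ominus>\<^bsub>val_ring v\<^esub> x = - x"
proof -
  interpret cring "val_ring v" by (rule cring_val_ring)
  assume "x \<in> ints"
  then show ?thesis using minus_equality[of "- x" x] by simp
qed

lemma finsum_val_ring [simp]: "f \<in> S \<rightarrow> ints \<Longrightarrow> finsum (val_ring v) f S = sum f S"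
proof -
  interpret cring "val_ring v" by (rule cring_val_ring)
  show "f \<in> S \<rightarrow> ints \<Longrightarrow> finsum (val_ring v) f S = sum f S"
    by (induction S rule: infinite_finite_induct) (auto simp: finsum_infinite finsum_insert)
qed

lemma ideal_max_ideal: "ideal max_ideal (val_ring v)"
proof -
  interpret cring "val_ring v" by (rule cring_val_ring)
  have "subgroup max_ideal (add_monoid (val_ring v))"
    by (rule add.subgroupI) (auto simp: a_inv_def[symmetric] intro: max_ideal_closed)
  then show ?thesis
    by (intro idealI) (auto simp: ring_axioms)
qed

text \<open>The natural map from the valuation ring onto its residue field. On all of the field it sends two
  elements to the same set if and only if they are congruent modulo the maximal ideal.\<close>

definition residue :: "'k \<Rightarrow> 'k set" where "residue x = max_ideal +>\<^bsub>val_ring v\<^esub> x"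

lemma residue_altdef: "residue x = {y. y - x \<in> max_ideal}"
proof -
  have "y = (y - x) + x" for y by simp
  then show ?thesis
    unfolding residue_def a_r_coset_def r_coset_def by (auto simp: ) 
qed

lemma residue_eq_iff: "residue x = residue y \<longleftrightarrow> x - y \<in> max_ideal"
proof
  assume "residue x = residue y"
  then have "x \<in> residue y" unfolding residue_altdef by force
  then show "x - y \<in> max_ideal" unfolding residue_altdef by simp
next
  assume a: "x - y \<in> max_ideal"
  have "z - x \<in> max_ideal \<longleftrightarrow> z - y \<in> max_ideal" for z
    using max_ideal_closed(2)[OF _ a, of "z - x"] max_ideal_diff[OF _ a, of "z - y"] by auto
  then show "residue x = residue y" unfolding residue_altdef by simp
qed

abbreviation RF where "RF \<equiv> residue_field v"

lemma cring_RF: "cring RF"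
  unfolding residue_field_def by (rule ideal.quotient_is_cring[OF ideal_max_ideal cring_val_ring])

lemma RF_carrier: "carrier RF = residue ` ints"
  by (auto simp: residue_field_def FactRing_def A_RCOSETS_def RCOSETS_def residue_def a_r_coset_def)

lemma RF_sel [simp]:
  shows "x \<in> ints \<Longrightarrow> residue x \<in> carrier RF"
    and "x \<in> ints \<Longrightarrow> y \<in> ints \<Longrightarrow> residue x \<oplus>\<^bsub>RF\<^esub> residue y = residue (x + y)"
    and "x \<in> ints \<Longrightarrow> y \<in> ints \<Longrightarrow> residue x \<otimes>\<^bsub>RF\<^esub> residue y = residue (x * y)"
    and "\<one>\<^bsub>RF\<^esub> = residue 1" and "\<zero>\<^bsub>RF\<^esub> = residue 0"
proof -
  interpret I: ideal max_ideal "val_ring v" by (rule ideal_max_ideal)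
  have hom: "(\<lambda>x. residue x) \<in> Ring.ring_hom (val_ring v) RF"
    using I.rcos_ring_hom by (simp add: residue_field_def residue_def[abs_def])
  show "x \<in> ints \<Longrightarrow> residue x \<in> carrier RF" "x \<in> ints \<Longrightarrow> y \<in> ints \<Longrightarrow> residue x \<oplus>\<^bsub>RF\<^esub> residue y = residue (x + y)"
    "x \<in> ints \<Longrightarrow> y \<in> ints \<Longrightarrow> residue x \<otimes>\<^bsub>RF\<^esub> residue y = residue (x * y)" "\<one>\<^bsub>RF\<^esub> = residue 1"
    using ring_hom_closed[OF hom] ring_hom_add[OF hom] ring_hom_mult[OF hom] ring_hom_one[OF hom]
    by simp_all
  show "\<zero>\<^bsub>RF\<^esub> = residue 0"
    unfolding residue_altdef by (simp add: residue_field_def FactRing_def)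
qed

lemma RF_minus [simp]: "x \<in> ints \<Longrightarrow> \<ominus>\<^bsub>RF\<^esub> residue x = residue (- x)"
proof -
  interpret cring RF by (rule cring_RF)
  assume "x \<in> ints"
  then show ?thesis using minus_equality[of "residue (- x)" "residue x"] by simp
qed

lemma RF_finsum: "f \<in> S \<rightarrow> ints \<Longrightarrow> finsum RF (\<lambda>i. residue (f i)) S = residue (sum f S)"
proof -
  interpret cring RF by (rule cring_RF)
  show "f \<in> S \<rightarrow> ints \<Longrightarrow> ?thesis"
    by (induction S rule: infinite_finite_induct) (simp_all add: finsum_infinite finsum_insert Pi_iff ints_sum)
qed

lemma RF_finprod: "f \<in> S \<rightarrow> ints \<Longrightarrow> finprod RF (\<lambda>i. residue (f i)) S = residue (prod f S)"
proof -
  interpret cring RF by (rule cring_RF)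
  show "f \<in> S \<rightarrow> ints \<Longrightarrow> ?thesis"
    by (induction S rule: infinite_finite_induct) (simp_all add: finprod_infinite finprod_insert Pi_iff ints_prod)
qed

lemma RF_det:
  assumes "\<And>i j. i < n \<Longrightarrow> j < n \<Longrightarrow> g i j \<in> ints"
  shows "det_of RF n (\<lambda>i j. residue (g i j)) = residue (det (mat n n (\<lambda>(i, j). g i j)))"
proof -
  have p: "p i < n" if "p permutes {..<n}" "i < n" for p i
    using permutes_in_image[OF that(1)] that(2) by simp
  have "det_of RF n (\<lambda>i j. residue (g i j)) =
    finsum RF (\<lambda>p. residue (signof p * (\<Prod>i<n. g i (p i)))) {p. p permutes {..<n}}"
    unfolding det_of_def
  proof (rule abelian_monoid.finsum_cong')
    show "abelian_monoid RF" using cring_RF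
      by (simp add: cring_def ring_def abelian_group_def)
    show "(\<lambda>p. residue (signof p * (\<Prod>i<n. g i (p i)))) \<in> {p. p permutes {..<n}} \<rightarrow> carrier RF"
      by (auto simp: sign_def p assms intro!: RF_sel(1) ints_closed ints_prod)
    fix q assume "q \<in> {p. p permutes {..<n}}"
    then have "(\<Otimes>\<^bsub>RF\<^esub>i\<in>{..<n}. residue (g i (q i))) = residue (\<Prod>i<n. g i (q i))" "(\<Prod>i<n. g i (q i)) \<in> ints"
      by (auto intro!: RF_finprod simp: p assms)
    then show "(if evenperm q then \<Otimes>\<^bsub>RF\<^esub>i\<in>{..<n}. residue (g i (q i)) else \<ominus>\<^bsub>RF\<^esub> (\<Otimes>\<^bsub>RF\<^esub>i\<in>{..<n}. residue (g i (q i))))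
       = residue (signof q * (\<Prod>i<n. g i (q i)))"
      by (simp add: sign_def)
  qed simp
  also have "\<dots> = residue (\<Sum>p | p permutes {..<n}. signof p * (\<Prod>i<n. g i (p i)))"
    by (rule RF_finsum) (auto simp: sign_def p assms intro!: ints_minus ints_prod)
  also have "(\<Sum>p | p permutes {..<n}. signof p * (\<Prod>i<n. g i (p i))) = det (mat n n (\<lambda>(i, j). g i j))"
  proof -
    have "(\<Prod>i = 0..<n. mat n n (\<lambda>(i, j). g i j) $$ (i, q i)) = (\<Prod>i<n. g i (q i))"
      if "q permutes {..<n}" for q
      using p[OF that] by (auto simp: atLeast0LessThan intro!: prod.cong)
    then show ?thesis
      by (simp add: det_def atLeast0LessThan)
  qed
  finally show ?thesis .
qed

lemma det_cong_max_ideal: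
  assumes "A \<in> carrier_mat n n" "B \<in> carrier_mat n n"
    and "\<And>i j. i < n \<Longrightarrow> j < n \<Longrightarrow> A $$ (i, j) \<in> ints"
    and "\<And>i j. i < n \<Longrightarrow> j < n \<Longrightarrow> A $$ (i, j) - B $$ (i, j) \<in> max_ideal"
  shows "det A - det B \<in> max_ideal"
  unfolding det_def'[OF assms(1)] det_def'[OF assms(2)]
proof (rule sum_cong_max_ideal)
  fix p assume p: "p \<in> {p. p permutes {0..<n}}"
  have p': "p i < n" if "i < n" for i
    using permutes_in_image[of p "{0..<n}" i] p that by simp
  have "(\<Prod>i = 0..<n. A $$ (i, p i)) - (\<Prod>i = 0..<n. B $$ (i, p i)) \<in> max_ideal"
    by (rule prod_cong_max_ideal) (use assms p' in auto)
  then show "signof p * (\<Prod>i = 0..<n. A $$ (i, p i)) - signof p * (\<Prod>i = 0..<n. B $$ (i, p i)) \<in> max_ideal"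
    using max_ideal_closed(3)[of "(\<Prod>i = 0..<n. A $$ (i, p i)) - (\<Prod>i = 0..<n. B $$ (i, p i))"]
    by (auto simp: sign_def)
qed

lemma det_ints:
  assumes "A \<in> carrier_mat n n" "\<And>i j. i < n \<Longrightarrow> j < n \<Longrightarrow> A $$ (i, j) \<in> ints"
  shows "det A \<in> ints"
  unfolding det_def'[OF assms(1)]
proof (rule ints_sum)
  fix p assume p: "p \<in> {p. p permutes {0..<n}}"
  have p': "p i < n" if "i < n" for i
    using permutes_in_image[of p "{0..<n}" i] p that by simp
  have "(\<Prod>i = 0..<n. A $$ (i, p i)) \<in> ints"
    by (rule ints_prod) (use assms p' in auto)
  then show "signof p * (\<Prod>i = 0..<n. A $$ (i, p i)) \<in> ints"
    by (simp add: sign_def)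
qed

end

section \<open>Squares in the residue field and their lifts\<close>

lemma card_le_twice_image:
  assumes "finite A" and "\<And>y. card {t \<in> A. h t = y} \<le> 2"
  shows "card A \<le> 2 * card (h ` A)"
proof -
  have "card A = card (\<Union>y\<in>h ` A. {t \<in> A. h t = y})"
    by (rule arg_cong[where f = card]) auto
  also have "\<dots> \<le> (\<Sum>y\<in>h ` A. card {t \<in> A. h t = y})"
    using assms(1) by (intro card_UN_le) simp
  also have "\<dots> \<le> (\<Sum>y\<in>h ` A. 2)"
    by (rule sum_mono) (rule assms(2))
  finally show ?thesis by simp
qed

locale odd_henselian = field_valuation v for v :: "'k::field \<Rightarrow> 'g::linordered_ab_group_add" +
  assumes henselian: "two_henselian v"
    and finite_RF: "finite (carrier RF)"
    and odd_RF: "odd (ring_char RF)"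
begin

text \<open>If \<open>2\<close> vanished in the residue field, the additive order of \<open>1\<close> would divide \<open>2\<close>. This order is odd,
  so it would be \<open>1\<close>, that is, \<open>1 = 0\<close> in the residue field.\<close>

lemma val_unit_two: "val_unit 2"
proof -
  interpret F: cring RF by (rule cring_RF)
  have pow_iff: "residue 1 [^]\<^bsub>add_monoid RF\<^esub> n = \<one>\<^bsub>add_monoid RF\<^esub> \<longleftrightarrow> group.ord (add_monoid RF) (residue 1) dvd n"
    for n :: nat
    using group.pow_eq_id[OF F.a_group, of "residue 1" n] by simp
  have "2 \<notin> max_ideal"
  proof
    assume 2: "2 \<in> max_ideal"
    have "residue 1 \<oplus>\<^bsub>RF\<^esub> residue 1 = residue 0"
      using 2 by (simp add: residue_eq_iff)
    then have "residue 1 [^]\<^bsub>add_monoid RF\<^esub> (2::nat) = \<one>\<^bsub>add_monoid RF\<^esub>"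
      by (simp add: numeral_2_eq_2)
    then have "group.ord (add_monoid RF) (residue 1) dvd 2"
      using pow_iff[of 2] by simp
    moreover have "odd (group.ord (add_monoid RF) (residue 1))"
      using odd_RF by (simp add: ring_char_def)
    ultimately have "group.ord (add_monoid RF) (residue 1) = 1"
      by (metis dvd_triv_left prime_nat_iff two_is_prime_nat)
    then have "residue 1 [^]\<^bsub>add_monoid RF\<^esub> (1::nat) = \<one>\<^bsub>add_monoid RF\<^esub>"
      using pow_iff[of 1] by simp
    then have "residue 1 = residue 0" by simp
    then show False by (simp add: residue_eq_iff)
  qed
  moreover have "2 \<in> ints"
    using ints_add[of 1 1] by simp
  ultimately show ?thesis by (simp add: val_unit_iff)
qed

text \<open>The polynomial \<open>X\<^sup>2 - u\<close> has the derivative \<open>2 t\<close> at \<open>t\<close>, which is a unit because \<open>t\<^sup>2\<close> is congruent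
  to the unit \<open>u\<close>. So Hensel's lemma applies at \<open>t\<close>.\<close>

lemma hensel_sqrt:
  assumes u: "val_unit u" and t: "t \<in> ints" and tu: "t * t - u \<in> max_ideal"
  obtains s where "val_unit s" "s * s = u"
proof -
  let ?f = "[:- u, 0, 1:]"
  have ut: "val_unit t"
    using val_unit_cong[OF u, of "t * t"] max_ideal_minus[OF tu] val_unit_multD[OF t t] by simp
  have pd: "poly (pderiv ?f) t = 2 * t"
    by (simp add: pderiv_pCons)
  have "\<exists>b \<in> ints. poly ?f b = 0 \<and> b - t \<in> max_ideal"
  proof (rule henselian[unfolded two_henselian_def, THEN conjunct2, rule_format])
    have "coeff ?f i \<in> ints" for i
      using u by (auto simp: coeff_pCons ints_minus split: nat.split)
    moreover have "poly ?f t \<in> max_ideal"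
      using tu by (simp add: algebra_simps)
    moreover have "val_unit (poly (pderiv ?f) t)"
      unfolding pd using val_unit_two ut by simp
    ultimately show "(\<forall>i. coeff ?f i \<in> ints) \<and> degree ?f = 2 \<and> lead_coeff ?f = 1 \<and> t \<in> ints \<and>
        poly ?f t \<in> max_ideal \<and> poly (pderiv ?f) t \<noteq> 0 \<and> v (poly (pderiv ?f) t) = 0"
      using t by (simp add: val_unit_def)
  qed
  then obtain b where b: "b \<in> ints" "b * b = u"
    by (auto simp: algebra_simps)
  with u val_unit_multD[of b b] that show thesis by auto
qed

text \<open>Both sides of \<open>a x\<^sup>2 = 1 - b y\<^sup>2\<close> and both classes of squares \<open>x\<^sup>2\<close> and \<open>d y\<^sup>2\<close> have this shape,
  so that one count serves all of them.\<close>

definition quad_values :: "'k \<Rightarrow> 'k \<Rightarrow> 'k set set" where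
  "quad_values a c = (\<lambda>t. residue (a * (t * t) + c)) ` ints"

lemma quad_values_RF: "a \<in> ints \<Longrightarrow> c \<in> ints \<Longrightarrow> quad_values a c \<subseteq> carrier RF"
  by (auto simp: quad_values_def)

lemma quad_values_reps:
  assumes "a \<in> ints" "T \<subseteq> ints" "residue ` T = carrier RF"
  shows "quad_values a c = (\<lambda>t. residue (a * (t * t) + c)) ` T"
proof
  show "quad_values a c \<subseteq> (\<lambda>t. residue (a * (t * t) + c)) ` T"
  proof
    fix X assume "X \<in> quad_values a c"
    then obtain t where t: "t \<in> ints" "X = residue (a * (t * t) + c)"
      by (auto simp: quad_values_def)
    then obtain s where s: "s \<in> T" "residue t = residue s"
      using RF_sel(1)[of t] assms(3) by (metis imageE)
    have "t - s \<in> max_ideal" using s by (simp add: residue_eq_iff)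
    then have "t * t - s * s \<in> max_ideal"
      using s t assms(2) by (intro mult_cong_max_ideal) auto
    then have "a * (t * t - s * s) \<in> max_ideal"
      using assms(1) by (rule max_ideal_mult[rotated])
    then have "X = residue (a * (s * s) + c)"
      by (simp add: t residue_eq_iff algebra_simps)
    with s show "X \<in> (\<lambda>t. residue (a * (t * t) + c)) ` T" by auto
  qed
qed (use assms in \<open>auto simp: quad_values_def\<close>)

lemma residue_reps:
  obtains T where "T \<subseteq> ints" "inj_on residue T" "residue ` T = carrier RF" "finite T" "card T = card (carrier RF)"
proof -
  obtain T where T: "T \<subseteq> ints" "inj_on residue T" "residue ` T = carrier RF"
    by (metis RF_carrier subset_image_inj subset_refl)
  then have "finite T" "card T = card (carrier RF)"
    using finite_RF by (metis finite_imageD, metis card_image)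
  with T that show thesis by blast
qed

text \<open>On the residue field, \<open>a s\<^sup>2 + c = a t\<^sup>2 + c\<close> only if \<open>s = t\<close> or \<open>s = - t\<close>. So every value is
  attained at most twice and the value at \<open>0\<close> only once: more than half of the residue classes are values.\<close>

lemma card_quad_values:
  assumes a: "val_unit a" and c: "c \<in> ints"
  shows "card (carrier RF) + 1 \<le> 2 * card (quad_values a c)"
proof -
  obtain T where T: "T \<subseteq> ints" "inj_on residue T" "residue ` T = carrier RF" "finite T" "card T = card (carrier RF)"
    by (rule residue_reps)
  \<comment> \<open>The fibre over the value at \<open>0\<close> is the single class of \<open>t0\<close>; taking it out gains the summand \<open>1\<close>.\<close>
  obtain t0 where t0: "t0 \<in> T" "residue t0 = residue 0"
    using T(3) RF_sel(1)[of 0] by (metis imageE ints_closed(1))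
  define h where "h = (\<lambda>t. residue (a * (t * t) + c))"
  have h_eq: "residue s = residue t \<or> residue s = residue (- t)" if "s \<in> T" "t \<in> T" "h s = h t" for s t
  proof -
    have st: "s \<in> ints" "t \<in> ints" using that T by auto
    have "a * ((s - t) * (s + t)) \<in> max_ideal"
      using that(3) by (simp add: h_def residue_eq_iff algebra_simps)
    then have "(s - t) * (s + t) \<in> max_ideal"
      using a st max_ideal_prime[of a "(s - t) * (s + t)"] by (auto simp: val_unit_iff)
    then have "s - t \<in> max_ideal \<or> s + t \<in> max_ideal"
      using st by (intro max_ideal_prime) auto
    then show ?thesis by (simp add: residue_eq_iff)
  qed
  have fibre: "card {t \<in> T - {t0}. h t = y} \<le> 2" for y
  proof (cases "\<exists>t \<in> T. h t = y")
    case True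
    then obtain t where t: "t \<in> T" "h t = y" by auto
    obtain t' where t': "t' \<in> T" "residue t' = residue (- t)"
      using T(1,3) t(1) RF_sel(1)[of "- t"] by (metis imageE ints_closed(4) subsetD)
    have "{t \<in> T - {t0}. h t = y} \<subseteq> {t, t'}"
    proof
      fix x assume "x \<in> {t \<in> T - {t0}. h t = y}"
      then have x: "x \<in> T" "h x = h t" using t by auto
      then have "residue x = residue t \<or> residue x = residue t'"
        using h_eq[OF x(1) t(1) x(2)] t' by simp
      then show "x \<in> {t, t'}"
        using inj_onD[OF T(2)] x(1) t(1) t'(1) by blast
    qed
    then have "card {t \<in> T - {t0}. h t = y} \<le> card {t, t'}"
      by (intro card_mono) auto
    also have "\<dots> \<le> 2" by (simp add: card_insert_if)
    finally show ?thesis .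
  next
    case False
    then have "{t \<in> T - {t0}. h t = y} = {}" by auto
    then show ?thesis by (simp only: card.empty)
  qed
  have "card (T - {t0}) \<le> 2 * card (h ` (T - {t0}))"
    using T(4) fibre by (intro card_le_twice_image) auto
  moreover have "h t0 \<notin> h ` (T - {t0})"
  proof
    assume "h t0 \<in> h ` (T - {t0})"
    then obtain t where t: "t \<in> T" "t \<noteq> t0" "h t = h t0" by auto
    from h_eq[OF t(1) t0(1) t(3)] have "residue t = residue t0"
    proof
      assume "residue t = residue (- t0)"
      then have "t + t0 \<in> max_ideal" "t0 \<in> max_ideal" using t0(2) by (simp_all add: residue_eq_iff)
      then have "t + t0 - t0 - t0 \<in> max_ideal" by (intro max_ideal_diff)
      then show ?thesis by (simp add: residue_eq_iff)
    qed
    with t t0 T(2) show False by (metis inj_onD)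
  qed
  moreover have "quad_values a c = insert (h t0) (h ` (T - {t0}))"
    using quad_values_reps[of a T c] a T t0 by (auto simp: h_def)
  ultimately have "card T - 1 \<le> 2 * (card (quad_values a c) - 1)" "card (quad_values a c) \<ge> 1"
    using T(4) t0(1) by (simp_all)
  moreover have "card T \<ge> 1"
    using T(4) t0(1) by (metis Suc_leI card_gt_0_iff empty_iff One_nat_def)
  ultimately show ?thesis using T(5) by linarith
qed

lemma finite_quad_values: "a \<in> ints \<Longrightarrow> c \<in> ints \<Longrightarrow> finite (quad_values a c)"
  using quad_values_RF finite_RF finite_subset by metis

text \<open>The values of \<open>a x\<^sup>2\<close> and those of \<open>1 - b y\<^sup>2\<close> each fill more than half of the residue field, so they
  meet. In such a congruence \<open>x\<close> or \<open>y\<close> is a unit, and this one can be corrected to give an equality.\<close>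

lemma binary_form_represents_one:
  assumes a: "val_unit a" and b: "val_unit b"
  obtains x y where "x \<in> ints" "y \<in> ints" "a * (x * x) + b * (y * y) = 1"
proof -
  have "quad_values a 0 \<inter> quad_values (- b) 1 \<noteq> {}"
  proof
    assume "quad_values a 0 \<inter> quad_values (- b) 1 = {}"
    then have "card (quad_values a 0 \<union> quad_values (- b) 1) = card (quad_values a 0) + card (quad_values (- b) 1)"
      using a b by (intro card_Un_disjoint finite_quad_values) auto
    moreover have "card (quad_values a 0 \<union> quad_values (- b) 1) \<le> card (carrier RF)"
      using a b finite_RF quad_values_RF[of a 0] quad_values_RF[of "- b" 1] by (intro card_mono) auto
    ultimately show False
      using card_quad_values[of a 0] card_quad_values[of "- b" 1] a b by simp
  qed
  then obtain x y where xy: "x \<in> ints" "y \<in> ints" "residue (a * (x * x)) = residue (1 - b * (y * y))"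
    by (auto simp: quad_values_def)
  then have eq: "a * (x * x) + b * (y * y) - 1 \<in> max_ideal"
    by (simp add: residue_eq_iff algebra_simps)
  have main: "\<exists>x' \<in> ints. a * (x' * x') + b * (y * y) = 1"
    if a: "val_unit a" and b: "val_unit b" and x: "val_unit x" and y: "y \<in> ints"
      and eq: "a * (x * x) + b * (y * y) - 1 \<in> max_ideal" for a b x y
  proof -
    let ?u = "(1 - b * (y * y)) / a"
    have ai: "inverse a \<in> ints" using a by simp
    have "x * x - ?u = inverse a * (a * (x * x) + b * (y * y) - 1)"
      using val_unit_nonzero[OF a] by (simp add: field_simps)
    then have xu: "x * x - ?u \<in> max_ideal"
      using ai eq by (metis max_ideal_mult)
    moreover have "val_unit ?u"
      using val_unit_cong[OF _ xu] x by simp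
    ultimately obtain s where "val_unit s" "s * s = ?u"
      using x by (metis hensel_sqrt val_unit_ints)
    then show ?thesis
      using val_unit_nonzero[OF a] by (intro bexI[of _ s]) (auto simp: field_simps)
  qed
  consider "val_unit x" | "val_unit y"
  proof -
    have "\<not> (x \<in> max_ideal \<and> y \<in> max_ideal)"
    proof
      assume m: "x \<in> max_ideal \<and> y \<in> max_ideal"
      then have "a * (x * x) + b * (y * y) \<in> max_ideal"
        using a b by (meson max_ideal_add max_ideal_ints max_ideal_mult val_unit_ints)
      from max_ideal_diff[OF this eq] show False by simp
    qed
    then show thesis using that xy by (auto simp: val_unit_iff)
  qed
  then show thesis
  proof cases
    case 1
    with main[OF a b 1 xy(2) eq] that xy show thesis by blast
  next
    case 2
    with main[OF b a 2 xy(1)] eq that xy show thesis by (metis add.commute)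
  qed
qed

lemma val_unit_sqrt: "val_unit (y * y) \<Longrightarrow> val_unit y"
  using val_mult[of y y] by (cases "y = 0") (simp_all add: val_unit_def double_zero)

text \<open>A square class in the field itself rather than in the residue field. For units the two agree, by
  Hensel's lemma (\<open>square_class_RF\<close>), so that signs can be computed without passing to residues.\<close>

definition sq_class :: "'k \<Rightarrow> int" where
  "sq_class x = (if \<exists>y. x = y * y then 1 else - 1)"

lemma sq_class_cong:
  assumes "val_unit x" "x - y \<in> max_ideal"
  shows "sq_class x = sq_class y"
proof -
  have *: "\<exists>t. y = t * t" if "val_unit (s * s)" "s * s - y \<in> max_ideal" for s y
  proof -
    have "s \<in> ints"
      using val_unit_sqrt[OF that(1)] by simp
    moreover have "val_unit y" using val_unit_cong that by blast
    ultimately show ?thesis using that hensel_sqrt by metis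
  qed
  have "val_unit y" "y - x \<in> max_ideal" using assms val_unit_cong max_ideal_minus[of "x - y"] by auto
  then show ?thesis
    using *[of _ y] *[of _ x] assms by (auto simp: sq_class_def)
qed

lemma sq_class_mult_square: "y \<noteq> 0 \<Longrightarrow> sq_class (x * (y * y)) = sq_class x"
proof -
  assume y: "y \<noteq> 0"
  have "(\<exists>z. x * (y * y) = z * z) \<longleftrightarrow> (\<exists>z. x = z * z)"
  proof
    assume "\<exists>z. x * (y * y) = z * z"
    then obtain z where "x * (y * y) = z * z" by blast
    then have "x = (z / y) * (z / y)" using y by (simp add: field_simps)
    then show "\<exists>z. x = z * z" by blast
  next
    assume "\<exists>z. x = z * z"
    then obtain z where "x = z * z" by blast
    then have "x * (y * y) = (z * y) * (z * y)" by (simp add: algebra_simps)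
    then show "\<exists>z. x * (y * y) = z * z" by blast
  qed
  then show ?thesis by (simp add: sq_class_def)
qed

lemma square_class_RF:
  assumes x: "val_unit x"
  shows "square_class RF (residue x) = sq_class x"
proof -
  have "(\<exists>Y \<in> Units RF. residue x = Y \<otimes>\<^bsub>RF\<^esub> Y) \<longleftrightarrow> (\<exists>y. x = y * y)"
  proof
    assume "\<exists>Y \<in> Units RF. residue x = Y \<otimes>\<^bsub>RF\<^esub> Y"
    then obtain Y where "Y \<in> carrier RF" "residue x = Y \<otimes>\<^bsub>RF\<^esub> Y"
      by (auto simp: Units_def)
    then obtain y where "y \<in> ints" "residue x = residue (y * y)"
      by (auto simp: RF_carrier)
    then have "y * y - x \<in> max_ideal" by (metis residue_eq_iff)
    then show "\<exists>y. x = y * y" using x \<open>y \<in> ints\<close> hensel_sqrt by metis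
  next
    assume "\<exists>y. x = y * y"
    then obtain y where y: "x = y * y" by blast
    then have uy: "val_unit y"
      using x val_unit_sqrt by metis
    have "residue y \<in> Units RF"
      unfolding Units_def using uy val_unit_nonzero[OF uy]
      by (auto intro!: bexI[of _ "residue (inverse y)"])
    then show "\<exists>Y \<in> Units RF. residue x = Y \<otimes>\<^bsub>RF\<^esub> Y"
      using uy y by (intro bexI[of _ "residue y"]) auto
  qed
  then show ?thesis by (simp add: square_class_def sq_class_def)
qed

text \<open>Squaring takes the same value at the distinct classes of \<open>1\<close> and \<open>- 1\<close>. So it is not injective on the
  residue field, and, this field being finite, it is not surjective either.\<close>

lemma ex_nonsquare: "\<exists>d. val_unit d \<and> sq_class d = - 1"
proof -
  obtain T where T: "T \<subseteq> ints" "inj_on residue T" "residue ` T = carrier RF" "finite T" "card T = card (carrier RF)"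
    by (rule residue_reps)
  obtain s where s: "s \<in> T" "residue s = residue 1"
    using T(3) RF_sel(1)[of 1] by (metis imageE ints_closed(2))
  obtain t where t: "t \<in> T" "residue t = residue (- 1)"
    using T(3) RF_sel(1)[of "- 1"] by (metis imageE ints_closed(2,4))
  define h where "h = (\<lambda>t. residue (1 * (t * t) + 0))"
  have "s - 1 \<in> max_ideal" "t - (- 1) \<in> max_ideal" using s t by (metis residue_eq_iff)+
  then have "s * s - 1 * 1 \<in> max_ideal" "t * t - (- 1) * (- 1) \<in> max_ideal"
    using s t T(1) by (intro mult_cong_max_ideal; auto)+
  then have "h s = residue 1" "h t = residue 1"
    by (simp_all add: h_def residue_eq_iff)
  moreover have "s \<noteq> t"
  proof
    assume "s = t"
    then have "residue 1 = residue (- 1)" using s t by simp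
    then have "2 \<in> max_ideal" by (simp add: residue_eq_iff)
    then show False using val_unit_two by (simp add: val_unit_iff)
  qed
  ultimately have "\<not> inj_on h T" using s t unfolding inj_on_def by metis
  then have "card (h ` T) < card T"
    using T(4) by (metis card_image_le eq_card_imp_inj_on le_neq_implies_less)
  then have "card (quad_values 1 0) < card (carrier RF)"
    using quad_values_reps[of 1 T 0] T by (simp add: h_def)
  then have "quad_values 1 0 \<noteq> carrier RF" by auto
  then obtain z where z: "z \<in> ints" "residue z \<notin> quad_values 1 0"
    using quad_values_RF[of 1 0] by (auto simp: RF_carrier)
  have nz: "\<not> y * y - z \<in> max_ideal" if "y \<in> ints" for y
  proof
    assume "y * y - z \<in> max_ideal"
    then have "residue z = residue (1 * (y * y) + 0)" by (metis residue_eq_iff mult_1 add_0_right)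
    then show False using z(2) that by (auto simp: quad_values_def)
  qed
  have "val_unit z"
    using nz[of 0] z max_ideal_minus[of z] by (auto simp: val_unit_iff)
  moreover have "z \<noteq> y * y" for y
  proof
    assume y: "z = y * y"
    then have "val_unit y"
      using \<open>val_unit z\<close> val_unit_sqrt by metis
    with y nz[of y] show False by simp
  qed
  ultimately show ?thesis by (auto simp: sq_class_def)
qed

text \<open>The representative of a sign among the units; the one of the trivial sign is \<open>1\<close>.\<close>

definition sign_unit :: "int \<Rightarrow> 'k" where
  "sign_unit \<epsilon> = (if \<epsilon> = 1 then 1 else (SOME d. val_unit d \<and> sq_class d = - 1))"

lemma sign_unit: "val_unit (sign_unit \<epsilon>)" "\<epsilon> \<in> {1, - 1} \<Longrightarrow> sq_class (sign_unit \<epsilon>) = \<epsilon>"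
proof -
  have "sq_class 1 = 1" by (auto simp: sq_class_def intro: exI[of _ 1])
  then show "val_unit (sign_unit \<epsilon>)" "\<epsilon> \<in> {1, - 1} \<Longrightarrow> sq_class (sign_unit \<epsilon>) = \<epsilon>"
    using someI_ex[OF ex_nonsquare] by (auto simp: sign_unit_def)
qed

lemma sq_class_eq_1_iff: "sq_class x = 1 \<longleftrightarrow> (\<exists>y. x = y * y)"
  by (simp add: sq_class_def)

lemma sq_class_range: "sq_class x \<in> {1, - 1}"
  by (simp add: sq_class_def)

text \<open>Squares have index two among the units: if \<open>d\<close> is a nonsquare unit, then the residues of the squares
  and those of \<open>d\<close> times the squares have only \<open>0\<close> in common, and each set contains more than half of the
  residue field. So together they exhaust it, and Hensel's lemma lifts the resulting congruence.\<close>

lemma unit_eq_sign_unit_mult_square: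
  assumes w: "val_unit w"
  obtains s where "val_unit s" "w = sign_unit (sq_class w) * (s * s)"
proof (cases "sq_class w = 1")
  case True
  then obtain y where y: "w = y * y" unfolding sq_class_eq_1_iff by blast
  then have "val_unit y"
    using w val_unit_sqrt by metis
  moreover have "sign_unit (sq_class w) = 1"
    using True by (simp add: sign_unit_def)
  ultimately show thesis using that[of y] y by simp
next
  case False
  then have sw: "sq_class w = - 1" using sq_class_range[of w] by simp
  define d where "d = sign_unit (- 1)"
  have d: "val_unit d" "sq_class d = - 1" unfolding d_def by (simp_all add: sign_unit)
  have sq: "\<exists>s. val_unit s \<and> x = d * (s * s)" if x: "val_unit x" "residue x \<in> quad_values d 0" for x
  proof -
    obtain y where y: "y \<in> ints" "x - d * (y * y) \<in> max_ideal"
      using x(2) by (auto simp: quad_values_def residue_eq_iff)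
    have "y * y - x / d = - (inverse d * (x - d * (y * y)))"
      using val_unit_nonzero[OF d(1)] by (simp add: field_simps)
    moreover have "- (inverse d * (x - d * (y * y))) \<in> max_ideal"
      using d(1) y by (intro max_ideal_minus max_ideal_mult) auto
    ultimately have "y * y - x / d \<in> max_ideal" by simp
    then obtain s where "val_unit s" "s * s = x / d"
      using hensel_sqrt[of "x / d" y] y d x by auto
    then show ?thesis
      using val_unit_nonzero[OF d(1)] by (intro exI[of _ s]) (auto simp: field_simps)
  qed
  have "quad_values 1 0 \<inter> quad_values d 0 \<subseteq> {residue 0}"
  proof
    fix X assume "X \<in> quad_values 1 0 \<inter> quad_values d 0"
    then obtain x where x: "x \<in> ints" "X = residue (x * x)" "X \<in> quad_values d 0"
      by (auto simp: quad_values_def)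
    have "\<not> val_unit x"
    proof
      assume u: "val_unit x"
      then obtain s where s: "val_unit s" "x * x = d * (s * s)" using sq[of "x * x"] x by auto
      then have "d = (x / s) * (x / s)" using val_unit_nonzero[OF s(1)] by (simp add: field_simps)
      then have "sq_class d = 1" unfolding sq_class_eq_1_iff by blast
      then show False using d(2) by simp
    qed
    then show "X \<in> {residue 0}" using x by (auto simp: val_unit_iff residue_eq_iff)
  qed
  then have "card (quad_values 1 0 \<inter> quad_values d 0) \<le> card {residue 0}"
    by (intro card_mono) auto
  moreover have "card (quad_values 1 0) + card (quad_values d 0) =
      card (quad_values 1 0 \<union> quad_values d 0) + card (quad_values 1 0 \<inter> quad_values d 0)"
    using d by (intro card_Un_Int finite_quad_values) auto
  ultimately have "card (carrier RF) \<le> card (quad_values 1 0 \<union> quad_values d 0)"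
    using card_quad_values[of 1 0] card_quad_values[of d 0] d by simp
  then have "quad_values 1 0 \<union> quad_values d 0 = carrier RF"
    using d finite_RF quad_values_RF[of 1 0] quad_values_RF[of d 0] by (intro card_seteq) auto
  then have "residue w \<in> quad_values 1 0 \<or> residue w \<in> quad_values d 0"
    using w by (metis RF_sel(1) UnE val_unit_ints)
  then show thesis
  proof
    assume "residue w \<in> quad_values 1 0"
    then obtain y where "y \<in> ints" "w - y * y \<in> max_ideal"
      by (auto simp: quad_values_def residue_eq_iff)
    then have "y \<in> ints" "y * y - w \<in> max_ideal"
      using max_ideal_minus[of "w - y * y"] by simp_all
    then obtain s where "s * s = w" using w hensel_sqrt by metis
    then have "sq_class w = 1" unfolding sq_class_eq_1_iff by metis
    then show thesis using False by simp
  next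
    assume "residue w \<in> quad_values d 0"
    then show thesis using sq[OF w] that sw by (auto simp: d_def)
  qed
qed

end

section \<open>Isometries\<close>

definition isometry where
  "isometry A M N f \<longleftrightarrow> bij_betw f (carrier M) (carrier N) \<and>
    (\<forall>x \<in> carrier M. \<forall>y \<in> carrier M. f (x \<oplus>\<^bsub>M\<^esub> y) = f x \<oplus>\<^bsub>N\<^esub> f y) \<and>
    (\<forall>a \<in> carrier A. \<forall>x \<in> carrier M. f (a \<odot>\<^bsub>M\<^esub> x) = a \<odot>\<^bsub>N\<^esub> f x) \<and>
    (\<forall>x \<in> carrier M. \<forall>y \<in> carrier M. form N (f x) (f y) = form M x y)"

lemma isometric_iff: "isometric A M N \<longleftrightarrow> (\<exists>f. isometry A M N f)"
  by (simp add: isometric_def isometry_def)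

lemma isometryD:
  assumes "isometry A M N f"
  shows "bij_betw f (carrier M) (carrier N)"
    and "x \<in> carrier M \<Longrightarrow> f x \<in> carrier N"
    and "x \<in> carrier M \<Longrightarrow> y \<in> carrier M \<Longrightarrow> f (x \<oplus>\<^bsub>M\<^esub> y) = f x \<oplus>\<^bsub>N\<^esub> f y"
    and "a \<in> carrier A \<Longrightarrow> x \<in> carrier M \<Longrightarrow> f (a \<odot>\<^bsub>M\<^esub> x) = a \<odot>\<^bsub>N\<^esub> f x"
    and "x \<in> carrier M \<Longrightarrow> y \<in> carrier M \<Longrightarrow> form N (f x) (f y) = form M x y"
  using assms by (auto simp: isometry_def bij_betw_def)

lemma isometricI:
  assumes "\<And>x. x \<in> carrier M \<Longrightarrow> f x \<in> carrier N" "\<And>y. y \<in> carrier N \<Longrightarrow> g y \<in> carrier M"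
    and "\<And>x. x \<in> carrier M \<Longrightarrow> g (f x) = x" "\<And>y. y \<in> carrier N \<Longrightarrow> f (g y) = y"
    and "\<And>x y. x \<in> carrier M \<Longrightarrow> y \<in> carrier M \<Longrightarrow> f (x \<oplus>\<^bsub>M\<^esub> y) = f x \<oplus>\<^bsub>N\<^esub> f y"
    and "\<And>a x. a \<in> carrier A \<Longrightarrow> x \<in> carrier M \<Longrightarrow> f (a \<odot>\<^bsub>M\<^esub> x) = a \<odot>\<^bsub>N\<^esub> f x"
    and "\<And>x y. x \<in> carrier M \<Longrightarrow> y \<in> carrier M \<Longrightarrow> form N (f x) (f y) = form M x y"
  shows "isometric A M N"
  unfolding isometric_def
proof (intro exI[of _ f] conjI ballI)
  show "bij_betw f (carrier M) (carrier N)"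
    by (rule bij_betw_byWitness[of _ g]) (use assms in auto)
qed (use assms in auto)

lemma isometric_refl: "isometric A M M"
  by (rule isometricI[of _ "\<lambda>x. x" _ "\<lambda>x. x"]) auto

lemma isometric_trans:
  assumes "isometric A M N" "isometric A N L"
  shows "isometric A M L"
proof -
  from assms(1) obtain f where f: "isometry A M N f" by (auto simp: isometric_iff)
  from assms(2) obtain g where g: "isometry A N L g" by (auto simp: isometric_iff)
  show ?thesis
    unfolding isometric_def
    by (intro exI[of _ "g \<circ> f"] conjI ballI bij_betw_trans[OF isometryD(1)[OF f] isometryD(1)[OF g]])
      (simp_all add: isometryD[OF f] isometryD[OF g])
qed

lemma isometric_sym:
  assumes "module A M" "isometric A M N"
  shows "isometric A N M"
proof -
  interpret module A M by fact
  from assms(2) obtain f where f': "isometry A M N f" by (auto simp: isometric_iff)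
  note f = isometryD(1,3,4,5)[OF f']
  define g where "g = inv_into (carrier M) f"
  have g: "g y \<in> carrier M" "f (g y) = y" if "y \<in> carrier N" for y
    using f(1) that unfolding g_def bij_betw_def by (auto simp: inv_into_into f_inv_into_f)
  have gf: "g (f x) = x" if "x \<in> carrier M" for x
    using f(1) that unfolding g_def bij_betw_def by auto
  show ?thesis
  proof (rule isometricI[of _ g _ f])
    fix x y assume xy: "x \<in> carrier N" "y \<in> carrier N"
    have "g x \<oplus>\<^bsub>M\<^esub> g y = g (f (g x \<oplus>\<^bsub>M\<^esub> g y))"
      using g xy by (simp add: gf)
    then show "g (x \<oplus>\<^bsub>N\<^esub> y) = g x \<oplus>\<^bsub>M\<^esub> g y"
      using xy by (simp add: f g)
    show "form M (g x) (g y) = form N x y"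
      using f(4)[of "g x" "g y"] g xy by simp
  next
    fix a x assume ax: "a \<in> carrier A" "x \<in> carrier N"
    have "a \<odot>\<^bsub>M\<^esub> g x = g (f (a \<odot>\<^bsub>M\<^esub> g x))"
      using g ax by (simp add: gf)
    then show "g (a \<odot>\<^bsub>N\<^esub> x) = a \<odot>\<^bsub>M\<^esub> g x"
      using ax by (simp add: f g)
  qed (use f g gf in \<open>auto simp: bij_betw_def\<close>)
qed

lemma isometric_scale_form:
  assumes "isometric A M N"
  shows "isometric A (scale_form A s M) (scale_form A s N)"
  using assms by (fastforce simp: isometric_def scale_form_def)

text \<open>Finite sums over a carrier can be compared termwise only for summands in the carrier, hence the condition
  on the values of the forms.\<close>

lemma isometric_orthogonal_sum:
  fixes L :: "'i \<Rightarrow> ('a, 'b, 'y) form_module_scheme" and L' :: "'i \<Rightarrow> ('a, 'c, 'z) form_module_scheme"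
  assumes A: "cring A"
    and iso: "\<And>i. i \<in> S \<Longrightarrow> isometric A (L i) (L' i)"
    and closed: "\<And>i x y. i \<in> S \<Longrightarrow> x \<in> carrier (L i) \<Longrightarrow> y \<in> carrier (L i) \<Longrightarrow> form (L i) x y \<in> carrier A"
  shows "isometric A (orthogonal_sum A S L) (orthogonal_sum A S L')"
proof -
  interpret A: cring A by (rule A)
  obtain F where F': "\<And>i. i \<in> S \<Longrightarrow> isometry A (L i) (L' i) (F i)"
    using iso unfolding isometric_iff by metis
  note F = isometryD(1,3,4,5)[OF F']
  define G where "G i = inv_into (carrier (L i)) (F i)" for i
  have FC: "F i x \<in> carrier (L' i)" "G i (F i x) = x" if "i \<in> S" "x \<in> carrier (L i)" for i x
    using F(1)[OF that(1)] that(2) unfolding bij_betw_def G_def by auto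
  have GC: "G i y \<in> carrier (L i)" "F i (G i y) = y" if "i \<in> S" "y \<in> carrier (L' i)" for i y
    using F(1)[OF that(1)] that(2) unfolding bij_betw_def G_def
    by (auto simp: inv_into_into f_inv_into_f)
  show ?thesis
  proof (rule isometricI[of _ "\<lambda>x. \<lambda>i\<in>S. F i (x i)" _ "\<lambda>y. \<lambda>i\<in>S. G i (y i)"])
    fix x y
    assume xy: "x \<in> carrier (orthogonal_sum A S L)" "y \<in> carrier (orthogonal_sum A S L)"
    then have *: "x i \<in> carrier (L i)" "y i \<in> carrier (L i)" if "i \<in> S" for i
      using that by (auto simp: orthogonal_sum_def)
    have "finsum A (\<lambda>i. form (L' i) ((\<lambda>i\<in>S. F i (x i)) i) ((\<lambda>i\<in>S. F i (y i)) i)) S =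
        finsum A (\<lambda>i. form (L i) (x i) (y i)) S"
      by (rule A.finsum_cong') (auto simp: F * closed)
    then show "form (orthogonal_sum A S L') (\<lambda>i\<in>S. F i (x i)) (\<lambda>i\<in>S. F i (y i)) =
      form (orthogonal_sum A S L) x y"
      by (simp add: orthogonal_sum_def)
  qed (auto simp: orthogonal_sum_def F FC GC fun_eq_iff PiE_def extensional_def Pi_iff)
qed

section \<open>Lattices given by a form on coordinate vectors\<close>

context field_valuation
begin

text \<open>All models of lattices below have this underlying module and differ only in the form.\<close>

definition free_lattice :: "'i set \<Rightarrow> (('i \<Rightarrow> 'k) \<Rightarrow> ('i \<Rightarrow> 'k) \<Rightarrow> 'k) \<Rightarrow> ('k, 'i \<Rightarrow> 'k) form_module" where
  "free_lattice I \<beta> =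
    \<lparr>carrier = I \<rightarrow>\<^sub>E ints, mult = \<lambda>_ _. undefined, one = undefined,
     zero = \<lambda>i\<in>I. 0, add = \<lambda>x y. \<lambda>i\<in>I. x i + y i, smult = \<lambda>a x. \<lambda>i\<in>I. a * x i, form = \<beta>\<rparr>"

lemma free_lattice_sel [simp]:
  "carrier (free_lattice I \<beta>) = I \<rightarrow>\<^sub>E ints"
  "\<zero>\<^bsub>free_lattice I \<beta>\<^esub> = (\<lambda>i\<in>I. 0)"
  "x \<oplus>\<^bsub>free_lattice I \<beta>\<^esub> y = (\<lambda>i\<in>I. x i + y i)"
  "a \<odot>\<^bsub>free_lattice I \<beta>\<^esub> x = (\<lambda>i\<in>I. a * x i)"
  "form (free_lattice I \<beta>) = \<beta>"
  by (simp_all add: free_lattice_def)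

lemma PiE_eqI: "x \<in> I \<rightarrow>\<^sub>E A \<Longrightarrow> y \<in> I \<rightarrow>\<^sub>E B \<Longrightarrow> (\<And>i. i \<in> I \<Longrightarrow> x i = y i) \<Longrightarrow> x = y"
  by (auto intro: extensionalityI simp: PiE_def)

lemma abelian_group_free_lattice: "abelian_group (free_lattice I \<beta>)"
proof (rule abelian_groupI)
  fix x assume x: "x \<in> carrier (free_lattice I \<beta>)"
  then show "\<exists>y\<in>carrier (free_lattice I \<beta>). y \<oplus>\<^bsub>free_lattice I \<beta>\<^esub> x = \<zero>\<^bsub>free_lattice I \<beta>\<^esub>"
    by (intro bexI[of _ "\<lambda>i\<in>I. - x i"]) (auto intro!: restrict_ext)
  show "\<zero>\<^bsub>free_lattice I \<beta>\<^esub> \<oplus>\<^bsub>free_lattice I \<beta>\<^esub> x = x"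
    using x by (intro PiE_eqI[of _ I ints _ ints]) auto
qed (auto simp: algebra_simps intro!: restrict_ext)

lemma module_free_lattice: "module (val_ring v) (free_lattice I \<beta>)"
proof (rule moduleI)
  fix x assume x: "x \<in> carrier (free_lattice I \<beta>)"
  show "\<one>\<^bsub>val_ring v\<^esub> \<odot>\<^bsub>free_lattice I \<beta>\<^esub> x = x"
    using x by (intro PiE_eqI[of _ I ints _ ints]) auto
qed (auto simp: cring_val_ring abelian_group_free_lattice algebra_simps intro!: restrict_ext)

lemma finsum_free_lattice:
  assumes "f \<in> S \<rightarrow> I \<rightarrow>\<^sub>E ints"
  shows "finsum (free_lattice I \<beta>) f S = (\<lambda>i\<in>I. \<Sum>s\<in>S. f s i)"
proof -
  interpret module "val_ring v" "free_lattice I \<beta>" by (rule module_free_lattice)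
  show ?thesis
    using assms
  proof (induction S rule: infinite_finite_induct)
    case (insert s S)
    then show ?case by (simp add: M.finsum_insert Pi_iff) (auto intro!: restrict_ext)
  qed (simp_all add: M.finsum_infinite)
qed

definition unit_vec :: "'i set \<Rightarrow> 'i \<Rightarrow> 'i \<Rightarrow> 'k" where
  "unit_vec I j = (\<lambda>i\<in>I. if i = j then 1 else 0)"

lemma unit_vec_closed [simp]: "unit_vec I j \<in> I \<rightarrow>\<^sub>E ints"
  by (auto simp: unit_vec_def)

lemma unit_vec_app: "i \<in> I \<Longrightarrow> unit_vec I j i = (if i = j then 1 else 0)"
  by (simp add: unit_vec_def)

lemma unit_vec_expansion:
  assumes I: "finite I" and c: "c \<in> I \<rightarrow>\<^sub>E ints"
  shows "finsum (free_lattice I \<beta>) (\<lambda>i. c i \<odot>\<^bsub>free_lattice I \<beta>\<^esub> unit_vec I i) I = c"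
proof -
  have *: "(\<lambda>i. c i \<odot>\<^bsub>free_lattice I \<beta>\<^esub> unit_vec I i) \<in> I \<rightarrow> I \<rightarrow>\<^sub>E ints"
    using c by (auto simp: unit_vec_def)
  show ?thesis
    unfolding finsum_free_lattice[OF *]
  proof (rule PiE_eqI[OF _ c, of _ UNIV])
    fix i assume i: "i \<in> I"
    then have "(\<Sum>s\<in>I. (c s \<odot>\<^bsub>free_lattice I \<beta>\<^esub> unit_vec I s) i) = (\<Sum>s\<in>I. if i = s then c s else 0)"
      by (intro sum.cong) (simp_all add: unit_vec_def)
    then show "(\<lambda>i\<in>I. \<Sum>s\<in>I. (c s \<odot>\<^bsub>free_lattice I \<beta>\<^esub> unit_vec I s) i) i = c i"
      using i I by simp
  qed auto
qed

lemma module_basis_free_lattice: "module_basis (val_ring v) (free_lattice {..<n} \<beta>) n (unit_vec {..<n})"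
  unfolding module_basis_def
proof (intro conjI ballI)
  show "unit_vec {..<n} \<in> {..<n} \<rightarrow> carrier (free_lattice {..<n} \<beta>)"
    by auto
  fix x assume "x \<in> carrier (free_lattice {..<n} \<beta>)"
  then show "\<exists>!c. c \<in> {..<n} \<rightarrow>\<^sub>E ints \<and>
    x = (\<Oplus>\<^bsub>free_lattice {..<n} \<beta>\<^esub>i\<in>{..<n}. c i \<odot>\<^bsub>free_lattice {..<n} \<beta>\<^esub> unit_vec {..<n} i)"
    by (intro ex1I[of _ x]) (metis free_lattice_sel(1) unit_vec_expansion finite_lessThan)+
qed

definition gram_lattice :: "'i set \<Rightarrow> ('i \<Rightarrow> 'i \<Rightarrow> 'k) \<Rightarrow> ('k, 'i \<Rightarrow> 'k) form_module" where
  "gram_lattice I g = free_lattice I (\<lambda>x y. \<Sum>i\<in>I. \<Sum>j\<in>I. x i * g i j * y j)"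

definition diag_lattice :: "'i set \<Rightarrow> ('i \<Rightarrow> 'k) \<Rightarrow> ('k, 'i \<Rightarrow> 'k) form_module" where
  "diag_lattice I a = free_lattice I (\<lambda>x y. \<Sum>i\<in>I. a i * (x i * y i))"

lemma gram_lattice_sel [simp]:
  "carrier (gram_lattice I g) = I \<rightarrow>\<^sub>E ints"
  "\<zero>\<^bsub>gram_lattice I g\<^esub> = (\<lambda>i\<in>I. 0)"
  "x \<oplus>\<^bsub>gram_lattice I g\<^esub> y = (\<lambda>i\<in>I. x i + y i)"
  "a \<odot>\<^bsub>gram_lattice I g\<^esub> x = (\<lambda>i\<in>I. a * x i)"
  "form (gram_lattice I g) x y = (\<Sum>i\<in>I. \<Sum>j\<in>I. x i * g i j * y j)"
  by (simp_all add: gram_lattice_def)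

lemma diag_lattice_sel [simp]:
  "carrier (diag_lattice I a) = I \<rightarrow>\<^sub>E ints"
  "\<zero>\<^bsub>diag_lattice I a\<^esub> = (\<lambda>i\<in>I. 0)"
  "x \<oplus>\<^bsub>diag_lattice I a\<^esub> y = (\<lambda>i\<in>I. x i + y i)"
  "c \<odot>\<^bsub>diag_lattice I a\<^esub> x = (\<lambda>i\<in>I. c * x i)"
  "form (diag_lattice I a) x y = (\<Sum>i\<in>I. a i * (x i * y i))"
  by (simp_all add: diag_lattice_def)

lemma diag_lattice_cong: "(\<And>i. i \<in> I \<Longrightarrow> a i = b i) \<Longrightarrow> diag_lattice I a = diag_lattice I b"
  unfolding diag_lattice_def by (auto intro!: arg_cong[where f = "free_lattice I"] ext sum.cong)

lemma module_gram_lattice: "module (val_ring v) (gram_lattice I g)"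
  and module_diag_lattice: "module (val_ring v) (diag_lattice I a)"
  by (simp_all add: gram_lattice_def diag_lattice_def module_free_lattice)

lemma form_finsum:
  assumes "form_lattice (val_ring v) M" "f \<in> S \<rightarrow> carrier M" "y \<in> carrier M"
  shows "form M (finsum M f S) y = (\<Sum>s\<in>S. form M (f s) y)"
    and "form M y (finsum M f S) = (\<Sum>s\<in>S. form M y (f s))"
proof -
  interpret form_lattice "val_ring v" M by fact
  have 0: "form M \<zero>\<^bsub>M\<^esub> y = 0"
    using form_smult[of 0 y y] assms(3) smult_l_null[of y] by simp
  show 1: "form M (finsum M f S) y = (\<Sum>s\<in>S. form M (f s) y)"
    using assms(2)
  proof (induction S rule: infinite_finite_induct)
    case (insert s S)
    then have "finsum M f S \<in> carrier M" by auto
    with insert show ?case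
      using form_add assms(3) by (simp add: M.finsum_insert Pi_iff)
  qed (simp_all add: 0 M.finsum_infinite)
  have "finsum M f S \<in> carrier M" using assms(2) by auto
  then have "form M y (finsum M f S) = form M (finsum M f S) y"
    using form_sym assms(3) by blast
  also have "\<dots> = (\<Sum>s\<in>S. form M y (f s))"
    unfolding 1 using form_sym assms(2,3) by (intro sum.cong) auto
  finally show "form M y (finsum M f S) = (\<Sum>s\<in>S. form M y (f s))" .
qed

lemma form_smult_right:
  assumes "form_lattice (val_ring v) M" "a \<in> ints" "x \<in> carrier M" "y \<in> carrier M"
  shows "form M x (a \<odot>\<^bsub>M\<^esub> y) = a * form M x y"
proof -
  interpret form_lattice "val_ring v" M by fact
  show ?thesis using form_smult[of a y x] form_sym[of x y] form_sym[of x "a \<odot>\<^bsub>M\<^esub> y"] assms by simp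
qed

text \<open>Pass to coordinates with respect to some basis.\<close>

lemma lattice_isometric_gram:
  assumes M: "form_lattice (val_ring v) M"
  obtains n :: nat and g where "isometric (val_ring v) M (gram_lattice {..<n} g)"
    and "\<And>i j. i < n \<Longrightarrow> j < n \<Longrightarrow> g i j \<in> ints"
    and "\<And>i j. i < n \<Longrightarrow> j < n \<Longrightarrow> g i j = g j i"
proof -
  interpret form_lattice "val_ring v" M by fact
  obtain n b where b: "module_basis (val_ring v) M n b"
    using free_of_finite_rank by auto
  have bc: "b i \<in> carrier M" if "i < n" for i
    using b that by (auto simp: module_basis_def)
  have ex1: "\<exists>!c. c \<in> {..<n} \<rightarrow>\<^sub>E ints \<and> x = (\<Oplus>\<^bsub>M\<^esub>i\<in>{..<n}. c i \<odot>\<^bsub>M\<^esub> b i)" if "x \<in> carrier M" for x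
    using b that by (auto simp: module_basis_def)
  define g where "g i j = form M (b i) (b j)" for i j
  define \<phi> where "\<phi> c = (\<Oplus>\<^bsub>M\<^esub>i\<in>{..<n}. c i \<odot>\<^bsub>M\<^esub> b i)" for c
  define \<psi> where "\<psi> x = (THE c. c \<in> {..<n} \<rightarrow>\<^sub>E ints \<and> x = \<phi> c)" for x
  have \<psi>: "\<psi> x \<in> {..<n} \<rightarrow>\<^sub>E ints" "\<phi> (\<psi> x) = x" if "x \<in> carrier M" for x
    using theI'[OF ex1[OF that]] unfolding \<psi>_def \<phi>_def by auto
  have cb: "c i \<odot>\<^bsub>M\<^esub> b i \<in> carrier M" if "c \<in> {..<n} \<rightarrow>\<^sub>E ints" "i < n" for c i
    using that bc[OF that(2)] by (auto simp: PiE_iff)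
  have \<phi>c: "\<phi> c \<in> carrier M" if "c \<in> {..<n} \<rightarrow>\<^sub>E ints" for c
    unfolding \<phi>_def using cb[OF that] by (intro M.finsum_closed) auto
  have \<psi>\<phi>: "\<psi> (\<phi> c) = c" if "c \<in> {..<n} \<rightarrow>\<^sub>E ints" for c
    using ex1[OF \<phi>c[OF that]] \<psi>[OF \<phi>c[OF that]] that unfolding \<phi>_def by metis
  have "isometric (val_ring v) (gram_lattice {..<n} g) M"
  proof (rule isometricI[of _ \<phi> _ \<psi>])
    fix x y assume "x \<in> carrier (gram_lattice {..<n} g)" "y \<in> carrier (gram_lattice {..<n} g)"
    then have x: "x \<in> {..<n} \<rightarrow>\<^sub>E ints" and y: "y \<in> {..<n} \<rightarrow>\<^sub>E ints" by auto
    have xi: "x i \<in> ints" "y i \<in> ints" if "i < n" for i using x y that by auto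
    have "\<phi> (x \<oplus>\<^bsub>gram_lattice {..<n} g\<^esub> y) = (\<Oplus>\<^bsub>M\<^esub>i\<in>{..<n}. x i \<odot>\<^bsub>M\<^esub> b i \<oplus>\<^bsub>M\<^esub> y i \<odot>\<^bsub>M\<^esub> b i)"
      unfolding \<phi>_def using cb[OF x] cb[OF y] xi bc smult_l_distr
      by (intro M.finsum_cong') auto
    also have "\<dots> = \<phi> x \<oplus>\<^bsub>M\<^esub> \<phi> y"
      unfolding \<phi>_def using cb[OF x] cb[OF y] by (intro M.finsum_addf) auto
    finally show "\<phi> (x \<oplus>\<^bsub>gram_lattice {..<n} g\<^esub> y) = \<phi> x \<oplus>\<^bsub>M\<^esub> \<phi> y" .
    have "form M (\<phi> x) (\<phi> y) = (\<Sum>i<n. form M (x i \<odot>\<^bsub>M\<^esub> b i) (\<phi> y))"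
      unfolding \<phi>_def[of x] by (rule form_finsum) (use M cb[OF x] \<phi>c[OF y] in auto)
    also have "\<dots> = (\<Sum>i<n. \<Sum>j<n. x i * g i j * y j)"
    proof (rule sum.cong[OF refl])
      fix i assume i: "i \<in> {..<n}"
      then have "form M (x i \<odot>\<^bsub>M\<^esub> b i) (\<phi> y) = (\<Sum>j<n. form M (x i \<odot>\<^bsub>M\<^esub> b i) (y j \<odot>\<^bsub>M\<^esub> b j))"
        unfolding \<phi>_def by (intro form_finsum) (use M cb[OF x] cb[OF y] in auto)
      also have "\<dots> = (\<Sum>j<n. x i * g i j * y j)"
        using i bc xi by (intro sum.cong) (simp_all add: form_smult form_smult_right[OF M] g_def algebra_simps)
      finally show "form M (x i \<odot>\<^bsub>M\<^esub> b i) (\<phi> y) = (\<Sum>j<n. x i * g i j * y j)" .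
    qed
    finally show "form M (\<phi> x) (\<phi> y) = form (gram_lattice {..<n} g) x y" by simp
  next
    fix a x assume a: "a \<in> ints" and "x \<in> carrier (gram_lattice {..<n} g)"
    then have x: "x \<in> {..<n} \<rightarrow>\<^sub>E ints" by auto
    have xi: "x i \<in> ints" if "i < n" for i using x that by auto
    have "a \<odot>\<^bsub>M\<^esub> \<phi> x = (\<Oplus>\<^bsub>M\<^esub>i\<in>{..<n}. a \<odot>\<^bsub>M\<^esub> (x i \<odot>\<^bsub>M\<^esub> b i))"
      unfolding \<phi>_def using cb[OF x] a by (intro finsum_smult_ldistr) auto
    also have "\<dots> = \<phi> (a \<odot>\<^bsub>gram_lattice {..<n} g\<^esub> x)"
      unfolding \<phi>_def using cb[OF x] a xi bc smult_assoc1
      by (intro M.finsum_cong') (auto simp: smult_assoc1[symmetric])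
    finally show "\<phi> (a \<odot>\<^bsub>gram_lattice {..<n} g\<^esub> x) = a \<odot>\<^bsub>M\<^esub> \<phi> x" by simp
  qed (use \<psi> \<phi>c \<psi>\<phi> in auto)
  then have "isometric (val_ring v) M (gram_lattice {..<n} g)"
    by (rule isometric_sym[OF module_gram_lattice])
  then show thesis
    by (rule that) (use bc form_closed form_sym in \<open>auto simp: g_def\<close>)
qed

section \<open>Orthogonal bases\<close>

text \<open>The Gram matrix of the basis that arises by replacing every \<open>b\<^sub>k\<close> by \<open>b\<^sub>k + c\<^sub>k b\<^sub>p\<close>. As \<open>c\<^sub>p = 0\<close>
  in all applications, replacing \<open>c\<close> by \<open>- c\<close> gives the inverse.\<close>

definition shear :: "('i \<Rightarrow> 'i \<Rightarrow> 'k) \<Rightarrow> 'i \<Rightarrow> ('i \<Rightarrow> 'k) \<Rightarrow> 'i \<Rightarrow> 'i \<Rightarrow> 'k" where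
  "shear g p c k l = g k l + c k * g p l + c l * g k p + c k * c l * g p p"

text \<open>In terms of coordinates, the change of basis adds \<open>\<Sum>k. c k * x k\<close> to the coordinate with index \<open>p\<close>.\<close>

lemma sum_sum_shear:
  fixes c :: "'i \<Rightarrow> 'k"
  assumes I: "finite I" and p: "p \<in> I"
  defines "s \<equiv> \<lambda>x. \<Sum>k\<in>I. c k * x k"
  shows "(\<Sum>k\<in>I. \<Sum>l\<in>I. (x k + (if k = p then s x else 0)) * g k l * (y l + (if l = p then s y else 0))) =
    (\<Sum>k\<in>I. \<Sum>l\<in>I. x k * shear g p c k l * y l)"
proof -
  have "(\<Sum>k\<in>I. \<Sum>l\<in>I. (x k + (if k = p then s x else 0)) * g k l * (y l + (if l = p then s y else 0))) =
    (\<Sum>k\<in>I. \<Sum>l\<in>I. x k * g k l * y l) + (\<Sum>k\<in>I. \<Sum>l\<in>I. if k = p then s x * g k l * y l else 0)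
    + (\<Sum>k\<in>I. \<Sum>l\<in>I. if l = p then x k * g k l * s y else 0)
    + (\<Sum>k\<in>I. \<Sum>l\<in>I. if k = p then if l = p then s x * g k l * s y else 0 else 0)"
    unfolding sum.distrib[symmetric] by (intro sum.cong refl) (simp add: algebra_simps)
  also have "(\<Sum>k\<in>I. \<Sum>l\<in>I. if k = p then s x * g k l * y l else 0) = (\<Sum>l\<in>I. s x * g p l * y l)"
  proof -
    have "(\<Sum>k\<in>I. \<Sum>l\<in>I. if k = p then s x * g k l * y l else 0) =
        (\<Sum>k\<in>I. if k = p then (\<Sum>l\<in>I. s x * g k l * y l) else 0)"
      by (intro sum.cong) auto
    then show ?thesis using I p by simp
  qed
  also have "(\<Sum>k\<in>I. \<Sum>l\<in>I. if l = p then x k * g k l * s y else 0) = (\<Sum>k\<in>I. x k * g k p * s y)"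
    using I p by simp
  also have "(\<Sum>k\<in>I. \<Sum>l\<in>I. if k = p then if l = p then s x * g k l * s y else 0 else 0) = s x * g p p * s y"
  proof -
    have "(\<Sum>k\<in>I. \<Sum>l\<in>I. if k = p then if l = p then s x * g k l * s y else 0 else 0) =
        (\<Sum>k\<in>I. if k = p then s x * g k p * s y else 0)"
      using I p by (intro sum.cong) auto
    then show ?thesis using I p by simp
  qed
  also have "(\<Sum>l\<in>I. s x * g p l * y l) = (\<Sum>k\<in>I. \<Sum>l\<in>I. x k * (c k * g p l) * y l)"
    unfolding s_def by (subst sum.swap) (simp add: sum_distrib_left sum_distrib_right algebra_simps)
  also have "(\<Sum>k\<in>I. x k * g k p * s y) = (\<Sum>k\<in>I. \<Sum>l\<in>I. x k * (c l * g k p) * y l)"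
    unfolding s_def by (simp add: sum_distrib_left sum_distrib_right algebra_simps)
  also have "s x * g p p * s y = (\<Sum>k\<in>I. \<Sum>l\<in>I. x k * (c k * c l * g p p) * y l)"
    unfolding s_def by (simp add: sum_distrib_left sum_distrib_right algebra_simps)
  finally show ?thesis
    by (simp add: shear_def sum.distrib[symmetric] algebra_simps)
qed

lemma isometric_shear:
  assumes I: "finite I" and p: "p \<in> I" and c: "\<And>i. i \<in> I \<Longrightarrow> c i \<in> ints" "c p = 0"
  shows "isometric (val_ring v) (gram_lattice I g) (gram_lattice I (shear g p c))"
proof (rule isometric_sym[OF module_gram_lattice])
  define s where "s x = (\<Sum>k\<in>I. c k * x k)" for x
  define f where "f x = (\<lambda>k\<in>I. x k + (if k = p then s x else 0))" for x
  define f' where "f' x = (\<lambda>k\<in>I. x k - (if k = p then s x else 0))" for x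
  have s_int: "s x \<in> ints" if "x \<in> I \<rightarrow>\<^sub>E ints" for x
    unfolding s_def using that c by (intro ints_sum ints_mult) auto
  have sf: "s (f x) = s x" for x
    unfolding s_def f_def using c(2) by (intro sum.cong) auto
  have sf': "s (f' x) = s x" for x
    unfolding s_def f'_def using c(2) by (intro sum.cong) auto
  show "isometric (val_ring v) (gram_lattice I (shear g p c)) (gram_lattice I g)"
  proof (rule isometricI[of _ f _ f'])
    fix x assume "x \<in> carrier (gram_lattice I (shear g p c))"
    then have x: "x \<in> I \<rightarrow>\<^sub>E ints" by simp
    show "f x \<in> carrier (gram_lattice I g)"
      using x s_int[OF x] by (auto simp: f_def)
    show "f' (f x) = x"
      by (rule PiE_eqI[OF _ x, of _ UNIV]) (auto simp: f'_def sf, auto simp: f_def)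
    fix y assume "y \<in> carrier (gram_lattice I (shear g p c))"
    have "s (\<lambda>i\<in>I. x i + y i) = s x + s y"
      by (simp add: s_def sum.distrib[symmetric] algebra_simps)
    then show "f (x \<oplus>\<^bsub>gram_lattice I (shear g p c)\<^esub> y) = f x \<oplus>\<^bsub>gram_lattice I g\<^esub> f y"
      by (auto simp: f_def intro!: restrict_ext)
    have "form (gram_lattice I g) (f x) (f y) =
      (\<Sum>k\<in>I. \<Sum>l\<in>I. (x k + (if k = p then s x else 0)) * g k l * (y l + (if l = p then s y else 0)))"
      by (simp add: f_def)
    also have "\<dots> = (\<Sum>k\<in>I. \<Sum>l\<in>I. x k * shear g p c k l * y l)"
      unfolding s_def by (rule sum_sum_shear[OF I p])
    finally show "form (gram_lattice I g) (f x) (f y) = form (gram_lattice I (shear g p c)) x y"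
      by simp
  next
    fix x assume "x \<in> carrier (gram_lattice I g)"
    then have x: "x \<in> I \<rightarrow>\<^sub>E ints" by simp
    show "f' x \<in> carrier (gram_lattice I (shear g p c))"
      using x s_int[OF x] by (auto simp: f'_def)
    show "f (f' x) = x"
      by (rule PiE_eqI[OF _ x, of _ UNIV]) (auto simp: f_def sf', auto simp: f'_def)
  next
    fix a x assume "a \<in> ints" "x \<in> carrier (gram_lattice I (shear g p c))"
    have "s (\<lambda>i\<in>I. a * x i) = a * s x"
      by (simp add: s_def sum_distrib_left algebra_simps)
    then show "f (a \<odot>\<^bsub>gram_lattice I (shear g p c)\<^esub> x) = a \<odot>\<^bsub>gram_lattice I g\<^esub> f x"
      by (auto simp: f_def algebra_simps intro!: restrict_ext)
  qed
qed

lemma gram_lattice_diagonal: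
  assumes I: "finite I" and g: "\<And>i j. i \<in> I \<Longrightarrow> j \<in> I \<Longrightarrow> i \<noteq> j \<Longrightarrow> g i j = 0"
  shows "gram_lattice I g = diag_lattice I (\<lambda>i. g i i)"
proof -
  have "(\<Sum>i\<in>I. \<Sum>j\<in>I. x i * g i j * y j) = (\<Sum>i\<in>I. g i i * (x i * y i))" for x y
  proof (rule sum.cong[OF refl])
    fix i assume i: "i \<in> I"
    have "(\<Sum>j\<in>I. x i * g i j * y j) = (\<Sum>j\<in>I. if i = j then x i * g i i * y i else 0)"
      using g i by (intro sum.cong) auto
    then show "(\<Sum>j\<in>I. x i * g i j * y j) = g i i * (x i * y i)"
      using i I by (simp add: algebra_simps)
  qed
  then show ?thesis by (simp add: gram_lattice_def diag_lattice_def)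
qed

lemma divides_if_val_le: "x \<noteq> 0 \<Longrightarrow> y = 0 \<or> v x \<le> v y \<Longrightarrow> y / x \<in> ints"
  by (cases "y = 0") (simp_all add: ints_iff val_divide)

lemma ex_min_val:
  assumes "finite S" "\<exists>s \<in> S. f s \<noteq> 0"
  obtains s where "s \<in> S" "f s \<noteq> 0" "\<And>t. t \<in> S \<Longrightarrow> f t / f s \<in> ints"
proof -
  have "finite {s \<in> S. f s \<noteq> 0}" "{s \<in> S. f s \<noteq> 0} \<noteq> {}" using assms by auto
  then obtain s where "s \<in> S" "f s \<noteq> 0" "\<And>t. t \<in> S \<Longrightarrow> f t \<noteq> 0 \<Longrightarrow> v (f s) \<le> v (f t)"
    using ex_is_arg_min_if_finite[of "{s \<in> S. f s \<noteq> 0}" "\<lambda>s. v (f s)"]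
    by (auto simp: is_arg_min_linorder)
  then show thesis using that divides_if_val_le by metis
qed

end

context odd_henselian
begin

text \<open>A stage of the orthogonalisation: the basis vectors with an index in \<open>D\<close> are finished.\<close>

definition partially_diagonal :: "'i set \<Rightarrow> 'i set \<Rightarrow> ('i \<Rightarrow> 'i \<Rightarrow> 'k) \<Rightarrow> bool" where
  "partially_diagonal I D g \<longleftrightarrow> D \<subseteq> I \<and> (\<forall>i\<in>I. \<forall>j\<in>I. g i j \<in> ints \<and> g i j = g j i) \<and>
    (\<forall>i\<in>D. \<forall>j\<in>I. i \<noteq> j \<longrightarrow> g i j = 0)"

lemma partially_diagonalD:
  assumes "partially_diagonal I D g"
  shows "D \<subseteq> I" and "i \<in> I \<Longrightarrow> j \<in> I \<Longrightarrow> g i j \<in> ints" and "i \<in> I \<Longrightarrow> j \<in> I \<Longrightarrow> g i j = g j i"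
    and "i \<in> D \<Longrightarrow> j \<in> I \<Longrightarrow> i \<noteq> j \<Longrightarrow> g i j = 0"
  using assms unfolding partially_diagonal_def by blast+

lemma partially_diagonal_shear:
  assumes g: "partially_diagonal I D g"
    and p: "p \<in> I - D" and c: "\<And>i. i \<in> I \<Longrightarrow> c i \<in> ints" "\<And>i. i \<in> D \<Longrightarrow> c i = 0"
  shows "partially_diagonal I D (shear g p c)"
  unfolding partially_diagonal_def
proof (intro conjI ballI impI)
  note g' = partially_diagonalD[OF g]
  show "D \<subseteq> I" by (rule g'(1))
  fix i j assume ij: "i \<in> I" "j \<in> I"
  have "p \<in> I" using p by simp
  then show "shear g p c i j \<in> ints"
    using ij g'(2) c(1) unfolding shear_def by (intro ints_add ints_mult) auto
  show "shear g p c i j = shear g p c j i"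
    using g'(3)[of i j] g'(3)[of p j] g'(3)[of i p] ij \<open>p \<in> I\<close> unfolding shear_def
    by (simp add: algebra_simps)
next
  fix i j assume "i \<in> D" "j \<in> I" "i \<noteq> j"
  moreover from this have "g i j = 0" "g i p = 0"
    using partially_diagonalD(4)[OF g, of i] p by auto
  ultimately show "shear g p c i j = 0"
    using c by (auto simp: shear_def)
qed

text \<open>Choose an entry \<open>m = g i j\<close> of least value among those that are left. If some diagonal entry has the
  same value, it can serve as pivot. Otherwise \<open>b\<^sub>i + b\<^sub>j\<close> has the norm \<open>g i i + 2 m + g j j\<close>, in which
  \<open>2 m\<close> dominates as \<open>2\<close> is a unit. Passing to this vector keeps the entries that are left divisible by \<open>m\<close>.\<close>

lemma ex_diagonal_pivot:
  assumes I: "finite I" and gD: "partially_diagonal I D g"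
    and nz: "\<exists>i \<in> I - D. \<exists>j \<in> I - D. g i j \<noteq> 0"
  shows "\<exists>h p. isometric (val_ring v) (gram_lattice I g) (gram_lattice I h) \<and> partially_diagonal I D h \<and>
    p \<in> I - D \<and> h p p \<noteq> 0 \<and> (\<forall>i \<in> I. i \<noteq> p \<longrightarrow> h i p / h p p \<in> ints)"
proof -
  note D = partially_diagonalD[OF gD]
  have "\<exists>s \<in> (I - D) \<times> (I - D). (\<lambda>(i, j). g i j) s \<noteq> 0" using nz by auto
  then obtain s where s: "s \<in> (I - D) \<times> (I - D)" "(\<lambda>(i, j). g i j) s \<noteq> 0"
    "\<And>t. t \<in> (I - D) \<times> (I - D) \<Longrightarrow> (\<lambda>(i, j). g i j) t / (\<lambda>(i, j). g i j) s \<in> ints"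
    using I ex_min_val[of "(I - D) \<times> (I - D)" "\<lambda>(i, j). g i j"] by auto
  obtain i j where [simp]: "s = (i, j)" by (cases s)
  define m where "m = g i j"
  have ij: "i \<in> I - D" "j \<in> I - D" and m: "m \<noteq> 0" using s by (auto simp: m_def)
  have div: "g k l / m \<in> ints" if "k \<in> I - D" "l \<in> I - D" for k l
    using s(3)[of "(k, l)"] that by (simp add: m_def)
  show ?thesis
  proof (cases "\<exists>p \<in> I - D. val_unit (g p p / m)")
    case True
    then obtain p where p: "p \<in> I - D" "val_unit (g p p / m)" by auto
    show ?thesis
    proof (intro exI[of _ g] exI[of _ p] conjI ballI impI isometric_refl gD p(1))
      show "g p p \<noteq> 0" using p(2) m by (auto simp: val_unit_def)
      fix k assume k: "k \<in> I" "k \<noteq> p"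
      show "g k p / g p p \<in> ints"
      proof (cases "k \<in> D")
        case False
        then have "(g k p / m) * inverse (g p p / m) \<in> ints"
          using ints_mult[OF div[of k p] val_unit_ints[OF val_unit_simps(3)[OF p(2)]]] p k by blast
        then show ?thesis using m by (simp add: field_simps)
      qed (use D(4)[of k p] k p in auto)
    qed
  next
    case False
    have "i \<noteq> j"
    proof
      assume "i = j"
      then have "g i i / m = 1" using m by (simp add: m_def)
      then have "val_unit (g i i / m)" by simp
      then show False using False ij by blast
    qed
    define c where "c = (\<lambda>k. if k = j then 1 else 0 :: 'k)"
    define h where "h = shear g i c"
    have c: "\<And>k. k \<in> I \<Longrightarrow> c k \<in> ints" "\<And>k. k \<in> D \<Longrightarrow> c k = 0" "c i = 0"
      using ij \<open>i \<noteq> j\<close> by (auto simp: c_def)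
    have sm: "g q q / m \<in> max_ideal" if "q \<in> I - D" for q
    proof -
      have "\<not> val_unit (g q q / m)" using False that by blast
      then show ?thesis using div[OF that that] by (simp add: val_unit_iff)
    qed
    have hj: "h j j / m = 2 + (g j j / m + g i i / m)"
    proof -
      have "g j i = m" using D(3)[of j i] ij by (simp add: m_def)
      then have "h j j = g j j + m + m + g i i"
        using \<open>i \<noteq> j\<close> by (simp add: h_def shear_def c_def m_def)
      then show ?thesis using m by (simp add: add_divide_distrib)
    qed
    have "2 - h j j / m = - (g j j / m + g i i / m)" unfolding hj by simp
    then have "2 - h j j / m \<in> max_ideal"
      using sm ij by (metis max_ideal_add max_ideal_minus)
    then have u: "val_unit (h j j / m)" using val_unit_cong[OF val_unit_two] by blast
    have hdiv: "h k l / m \<in> ints" if "k \<in> I - D" "l \<in> I - D" for k l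
    proof -
      have "h k l / m = g k l / m + c k * (g i l / m) + c l * (g k i / m) + c k * c l * (g i i / m)"
        by (simp add: h_def shear_def add_divide_distrib)
      moreover have "c k \<in> ints" "c l \<in> ints" using c(1) that by auto
      ultimately show ?thesis
        using div[OF that] div[OF ij(1) that(2)] div[OF that(1) ij(1)] div[OF ij(1) ij(1)]
        by (metis ints_add ints_mult)
    qed
    have hD: "partially_diagonal I D h"
      unfolding h_def by (rule partially_diagonal_shear[OF gD ij(1) c(1,2)])
    show ?thesis
    proof (intro exI[of _ h] exI[of _ j] conjI ballI impI hD ij(2))
      show "isometric (val_ring v) (gram_lattice I g) (gram_lattice I h)"
        unfolding h_def using I ij c by (intro isometric_shear) auto
      show "h j j \<noteq> 0" using u m by (auto simp: val_unit_def)
      fix k assume k: "k \<in> I" "k \<noteq> j"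
      show "h k j / h j j \<in> ints"
      proof (cases "k \<in> D")
        case False
        then have "(h k j / m) * inverse (h j j / m) \<in> ints"
          using ints_mult[OF hdiv[of k j] val_unit_ints[OF val_unit_simps(3)[OF u]]] ij k by blast
        then show ?thesis using m by (simp add: field_simps)
      qed (use partially_diagonalD(4)[OF hD, of k j] k ij in auto)
    qed
  qed
qed

text \<open>Subtracting from every unfinished basis vector its projection to the pivot finishes the pivot. The
  projection has a coefficient in the ring because the pivot divides the entries of its row.\<close>

lemma gram_isometric_diag:
  assumes I: "finite I" and g: "partially_diagonal I D g"
  shows "\<exists>a. (\<forall>i \<in> I. a i \<in> ints) \<and> isometric (val_ring v) (gram_lattice I g) (diag_lattice I a)"
  using g
proof (induction "card (I - D)" arbitrary: g D rule: less_induct)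
  case (less D g)
  note gD = partially_diagonalD[OF less.prems]
  show ?case
  proof (cases "\<exists>i \<in> I - D. \<exists>j \<in> I - D. g i j \<noteq> 0")
    case False
    have "g i j = 0" if "i \<in> I" "j \<in> I" "i \<noteq> j" for i j
      using False gD(3)[of i j] gD(4)[of i j] gD(4)[of j i] that by auto
    then have "gram_lattice I g = diag_lattice I (\<lambda>i. g i i)"
      by (rule gram_lattice_diagonal[OF I])
    then show ?thesis
      using gD(2) by (intro exI[of _ "\<lambda>i. g i i"]) (simp add: isometric_refl)
  next
    case True
    obtain h p where h: "isometric (val_ring v) (gram_lattice I g) (gram_lattice I h)"
      "partially_diagonal I D h" "p \<in> I - D" "h p p \<noteq> 0" "\<forall>i \<in> I. i \<noteq> p \<longrightarrow> h i p / h p p \<in> ints"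
      using ex_diagonal_pivot[OF I less.prems True] by blast
    define c where "c k = (if k = p then 0 else - (h k p / h p p))" for k
    define g' where "g' = shear h p c"
    have c: "\<And>k. k \<in> I \<Longrightarrow> c k \<in> ints" "\<And>k. k \<in> D \<Longrightarrow> c k = 0" "c p = 0"
      using partially_diagonalD(4)[OF h(2), of _ p] h(3,5) by (auto simp: c_def intro: ints_minus)
    have g'D: "partially_diagonal I D g'"
      unfolding g'_def by (rule partially_diagonal_shear[OF h(2,3) c(1,2)])
    have "g' p k = 0" if "k \<in> I" "k \<noteq> p" for k
    proof -
      have "g' k p = h k p + c k * h p p"
        by (simp add: g'_def shear_def c(3))
      also have "\<dots> = 0" using that h(4) by (simp add: c_def)
      finally show ?thesis using partially_diagonalD(3)[OF g'D, of k p] that h(3) by auto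
    qed
    then have "partially_diagonal I (insert p D) g'"
      using g'D h(3) by (auto simp: partially_diagonal_def)
    moreover have "card (I - insert p D) < card (I - D)"
      using h(3) I by (intro psubset_card_mono) auto
    ultimately obtain a where a: "\<forall>i \<in> I. a i \<in> ints" "isometric (val_ring v) (gram_lattice I g') (diag_lattice I a)"
      using less.hyps by blast
    have "isometric (val_ring v) (gram_lattice I h) (gram_lattice I g')"
      unfolding g'_def using I h(3) c by (intro isometric_shear) auto
    with h(1) a show ?thesis by (blast intro: isometric_trans)
  qed
qed

text \<open>A zero on the diagonal would mean that a basis vector lies in the radical of the form,
  which is trivial.\<close>

theorem lattice_isometric_diag:
  assumes M: "form_lattice (val_ring v) M"
  obtains n :: nat and a where "isometric (val_ring v) M (diag_lattice {..<n} a)"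
    and "\<And>i. i < n \<Longrightarrow> a i \<in> ints \<and> a i \<noteq> 0"
proof -
  obtain n :: nat and g where g: "isometric (val_ring v) M (gram_lattice {..<n} g)"
    "\<And>i j. i < n \<Longrightarrow> j < n \<Longrightarrow> g i j \<in> ints" "\<And>i j. i < n \<Longrightarrow> j < n \<Longrightarrow> g i j = g j i"
    using lattice_isometric_gram[OF M] by metis
  then obtain a where a: "\<forall>i \<in> {..<n}. a i \<in> ints"
    "isometric (val_ring v) (gram_lattice {..<n} g) (diag_lattice {..<n} a)"
    using gram_isometric_diag[of "{..<n}" "{}" g] by (auto simp: partially_diagonal_def)
  have iso: "isometric (val_ring v) M (diag_lattice {..<n} a)"
    using g(1) a(2) by (rule isometric_trans)
  then obtain f where f: "isometry (val_ring v) M (diag_lattice {..<n} a) f"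
    by (auto simp: isometric_iff)
  have "a i \<noteq> 0" if i: "i < n" for i
  proof
    assume a0: "a i = 0"
    interpret form_lattice "val_ring v" M by fact
    have onto: "\<exists>x \<in> carrier M. f x = y" if "y \<in> {..<n} \<rightarrow>\<^sub>E ints" for y
      using bij_betw_imp_surj_on[OF isometryD(1)[OF f]] that by (metis diag_lattice_sel(1) imageE)
    obtain x where x: "x \<in> carrier M" "f x = unit_vec {..<n} i"
      using onto[of "unit_vec {..<n} i"] by auto
    have "(\<lambda>j\<in>{..<n}. 0) \<in> {..<n} \<rightarrow>\<^sub>E ints" by auto
    then obtain z where z: "z \<in> carrier M" "f z = (\<lambda>j\<in>{..<n}. 0)"
      using onto by metis
    have "form M x y = form M z y" if y: "y \<in> carrier M" for y
    proof -
      have "form M x y = (\<Sum>j<n. a j * (unit_vec {..<n} i j * f y j))"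
        using isometryD(5)[OF f x(1) y] x by simp
      also have "\<dots> = 0"
        by (rule sum.neutral) (auto simp: unit_vec_def a0)
      also have "0 = form M z y"
        using isometryD(5)[OF f z(1) y] z by simp
      finally show ?thesis .
    qed
    then have "form_map M x = form_map M z"
      by (auto simp: form_map_def)
    then have "x = z"
      using nondegenerate x(1) z(1) by (auto dest: inj_onD)
    then have "unit_vec {..<n} i i = (\<lambda>j\<in>{..<n}. 0) i" using x z by simp
    then show False using i by (simp add: unit_vec_def)
  qed
  with iso a(1) that show thesis by auto
qed

end

section \<open>Isometries between diagonal lattices\<close>

lemma sum_split_two:
  assumes "finite I" "i \<in> I" "j \<in> I" "i \<noteq> j"
  shows "sum f I = f i + f j + sum f (I - {i, j})"
proof -
  have "sum f I = f i + sum f (I - {i})" using assms by (simp add: sum.remove)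
  also have "sum f (I - {i}) = f j + sum f (I - {i} - {j})" using assms by (intro sum.remove) auto
  also have "I - {i} - {j} = I - {i, j}" by auto
  finally show ?thesis by (simp add: add.assoc)
qed

context field_valuation
begin

lemma isometric_diag_reindex:
  assumes h: "bij_betw h J I"
  shows "isometric (val_ring v) (diag_lattice I a) (diag_lattice J (\<lambda>j. a (h j)))"
proof (rule isometricI[of _ "\<lambda>x. \<lambda>j\<in>J. x (h j)" _ "\<lambda>y. \<lambda>i\<in>I. y (inv_into J h i)"])
  have hI: "h j \<in> I" "inv_into J h (h j) = j" if "j \<in> J" for j
    using h that by (auto simp: bij_betw_def)
  have hJ: "inv_into J h i \<in> J" "h (inv_into J h i) = i" if "i \<in> I" for i
    using h that by (auto simp: bij_betw_def inv_into_into f_inv_into_f)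
  fix x assume "x \<in> carrier (diag_lattice I a)"
  then have x: "x \<in> I \<rightarrow>\<^sub>E ints" by simp
  show "(\<lambda>j\<in>J. x (h j)) \<in> carrier (diag_lattice J (\<lambda>j. a (h j)))"
    using x hI by auto
  show "(\<lambda>i\<in>I. (\<lambda>j\<in>J. x (h j)) (inv_into J h i)) = x"
    by (rule PiE_eqI[OF _ x, of _ UNIV]) (auto simp: hJ)
  fix y assume "y \<in> carrier (diag_lattice I a)"
  have "(\<Sum>j\<in>J. a (h j) * (x (h j) * y (h j))) = (\<Sum>i\<in>I. a i * (x i * y i))"
    by (rule sum.reindex_bij_betw[OF h])
  then show "form (diag_lattice J (\<lambda>j. a (h j))) (\<lambda>j\<in>J. x (h j)) (\<lambda>j\<in>J. y (h j)) = form (diag_lattice I a) x y"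
    by simp
next
  have hI: "h j \<in> I" "inv_into J h (h j) = j" if "j \<in> J" for j
    using h that by (auto simp: bij_betw_def)
  have hJ: "inv_into J h i \<in> J" if "i \<in> I" for i
    using h that by (auto simp: bij_betw_def inv_into_into)
  fix y assume "y \<in> carrier (diag_lattice J (\<lambda>j. a (h j)))"
  then have y: "y \<in> J \<rightarrow>\<^sub>E ints" by simp
  show "(\<lambda>i\<in>I. y (inv_into J h i)) \<in> carrier (diag_lattice I a)"
    using y hJ by auto
  show "(\<lambda>j\<in>J. (\<lambda>i\<in>I. y (inv_into J h i)) (h j)) = y"
    by (rule PiE_eqI[OF _ y, of _ UNIV]) (auto simp: hI)
qed (use bij_betwE[OF h] in \<open>auto intro!: restrict_ext\<close>)

lemma isometric_diag_squares:
  assumes s: "\<And>i. i \<in> I \<Longrightarrow> val_unit (s i)"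
  shows "isometric (val_ring v) (diag_lattice I a) (diag_lattice I (\<lambda>i. a i * (s i * s i)))"
proof (rule isometricI[of _ "\<lambda>x. \<lambda>i\<in>I. inverse (s i) * x i" _ "\<lambda>x. \<lambda>i\<in>I. s i * x i"])
  have si: "s i \<in> ints" "inverse (s i) \<in> ints" "s i \<noteq> 0" if "i \<in> I" for i
    using s[OF that] by (auto simp: val_unit_nonzero intro!: val_unit_ints val_unit_simps)
  fix x assume "x \<in> carrier (diag_lattice I a)"
  then have x: "x \<in> I \<rightarrow>\<^sub>E ints" by simp
  show "(\<lambda>i\<in>I. inverse (s i) * x i) \<in> carrier (diag_lattice I (\<lambda>i. a i * (s i * s i)))"
    using x si by auto
  show "(\<lambda>i\<in>I. s i * (\<lambda>i\<in>I. inverse (s i) * x i) i) = x"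
    by (rule PiE_eqI[OF _ x, of _ UNIV]) (auto simp: si)
  fix y assume "y \<in> carrier (diag_lattice I a)"
  show "form (diag_lattice I (\<lambda>i. a i * (s i * s i))) (\<lambda>i\<in>I. inverse (s i) * x i) (\<lambda>i\<in>I. inverse (s i) * y i) =
      form (diag_lattice I a) x y"
    using si by (auto intro!: sum.cong simp: field_simps)
next
  have si: "s i \<in> ints" "inverse (s i) \<in> ints" "s i \<noteq> 0" if "i \<in> I" for i
    using s[OF that] by (auto simp: val_unit_nonzero intro!: val_unit_ints val_unit_simps)
  fix x assume "x \<in> carrier (diag_lattice I (\<lambda>i. a i * (s i * s i)))"
  then have x: "x \<in> I \<rightarrow>\<^sub>E ints" by simp
  show "(\<lambda>i\<in>I. s i * x i) \<in> carrier (diag_lattice I a)"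
    using x si by auto
  show "(\<lambda>i\<in>I. inverse (s i) * (\<lambda>i\<in>I. s i * x i) i) = x"
    by (rule PiE_eqI[OF _ x, of _ UNIV]) (auto simp: si)
qed (auto intro!: restrict_ext simp: algebra_simps)

text \<open>The vectors \<open>p b\<^sub>i + q b\<^sub>j\<close> and \<open>- a\<^sub>j q b\<^sub>i + a\<^sub>i p b\<^sub>j\<close> are orthogonal, with norms
  \<open>1\<close> and \<open>a\<^sub>i a\<^sub>j\<close>, and the determinant of the change of basis is \<open>a\<^sub>i p\<^sup>2 + a\<^sub>j q\<^sup>2 = 1\<close>.\<close>

lemma isometric_diag_pair:
  assumes I: "finite I" and ij: "i \<in> I" "j \<in> I" "i \<noteq> j"
    and a: "a i \<in> ints" "a j \<in> ints" and pq: "p \<in> ints" "q \<in> ints" "a i * (p * p) + a j * (q * q) = 1"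
  shows "isometric (val_ring v) (diag_lattice I a) (diag_lattice I (a(i := 1, j := a i * a j)))"
proof (rule isometric_sym[OF module_diag_lattice])
  let ?a' = "a(i := 1, j := a i * a j)"
  define f where "f x = x(i := p * x i - a j * q * x j, j := q * x i + a i * p * x j)" for x :: "'a \<Rightarrow> 'k"
  define f' where "f' y = y(i := a i * p * y i + a j * q * y j, j := p * y j - q * y i)" for y :: "'a \<Rightarrow> 'k"
  have inv: "f' (f x) = x" "f (f' x) = x" for x
  proof -
    have "a i * p * (p * x i - a j * q * x j) + a j * q * (q * x i + a i * p * x j) =
        (a i * (p * p) + a j * (q * q)) * x i"
      and "p * (q * x i + a i * p * x j) - q * (p * x i - a j * q * x j) =
        (a i * (p * p) + a j * (q * q)) * x j"
      and "p * (a i * p * x i + a j * q * x j) - a j * q * (p * x j - q * x i) =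
        (a i * (p * p) + a j * (q * q)) * x i"
      and "q * (a i * p * x i + a j * q * x j) + a i * p * (p * x j - q * x i) =
        (a i * (p * p) + a j * (q * q)) * x j"
      by (simp_all add: algebra_simps)
    then show "f' (f x) = x" "f (f' x) = x"
      using ij(3) unfolding pq(3) f_def f'_def by (simp_all add: fun_eq_iff)
  qed
  have f: "f z i = p * z i - a j * q * z j" "f z j = q * z i + a i * p * z j" "k \<noteq> i \<Longrightarrow> k \<noteq> j \<Longrightarrow> f z k = z k" for z k
    using ij(3) by (simp_all add: f_def)
  have f': "f' z i = a i * p * z i + a j * q * z j" "f' z j = p * z j - q * z i" "k \<noteq> i \<Longrightarrow> k \<noteq> j \<Longrightarrow> f' z k = z k" for z k
    using ij(3) by (simp_all add: f'_def)
  show "isometric (val_ring v) (diag_lattice I ?a') (diag_lattice I a)"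
  proof (rule isometricI[of _ f _ f'])
    fix x assume "x \<in> carrier (diag_lattice I ?a')"
    then have x: "x \<in> I \<rightarrow>\<^sub>E ints" by simp
    then have xi: "x i \<in> ints" "x j \<in> ints" using ij by auto
    show "f x \<in> carrier (diag_lattice I a)"
    proof -
      have "f x k \<in> ints" if "k \<in> I" for k
      proof (cases "k = i \<or> k = j")
        case True
        then show ?thesis using xi a pq(1,2) by (elim disjE) (simp_all add: f)
      next
        case False
        then show ?thesis using x that by (simp add: f(3) PiE_iff)
      qed
      moreover have "f x k = undefined" if "k \<notin> I" for k
      proof -
        have "k \<noteq> i" "k \<noteq> j" using that ij by metis+
        then have "f x k = x k" by (rule f(3))
        also have "\<dots> = undefined" by (rule PiE_arb[OF x that])
        finally show ?thesis .
      qed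
      ultimately show ?thesis by (simp add: PiE_iff extensional_def)
    qed
    show "f' (f x) = x"
      by (rule inv)
    fix y assume "y \<in> carrier (diag_lattice I ?a')"
    show "f (x \<oplus>\<^bsub>diag_lattice I ?a'\<^esub> y) = f x \<oplus>\<^bsub>diag_lattice I a\<^esub> f y"
    proof
      fix k
      show "f (x \<oplus>\<^bsub>diag_lattice I ?a'\<^esub> y) k = (f x \<oplus>\<^bsub>diag_lattice I a\<^esub> f y) k"
        by (cases "k = i"; cases "k = j") (simp_all add: f ij algebra_simps)
    qed
    have two: "a i * ((p * x i - a j * q * x j) * (p * y i - a j * q * y j)) +
        a j * ((q * x i + a i * p * x j) * (q * y i + a i * p * y j)) =
        x i * y i + a i * a j * (x j * y j)"
    proof -
      have "a i * ((p * x i - a j * q * x j) * (p * y i - a j * q * y j)) +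
        a j * ((q * x i + a i * p * x j) * (q * y i + a i * p * y j)) =
        (a i * (p * p) + a j * (q * q)) * (x i * y i) +
        a i * a j * ((a i * (p * p) + a j * (q * q)) * (x j * y j))"
        by (simp add: algebra_simps)
      then show ?thesis unfolding pq(3) by simp
    qed
    have "(\<Sum>k\<in>I - {i, j}. a k * (f x k * f y k)) = (\<Sum>k\<in>I - {i, j}. ?a' k * (x k * y k))"
      by (rule sum.cong) (simp_all add: f)
    moreover have "a i * (f x i * f y i) + a j * (f x j * f y j) = ?a' i * (x i * y i) + ?a' j * (x j * y j)"
    proof -
      have "?a' i = 1" "?a' j = a i * a j"
        using ij(3) by simp_all
      then show ?thesis by (simp only: f two mult_1_left)
    qed
    ultimately show "form (diag_lattice I a) (f x) (f y) = form (diag_lattice I ?a') x y"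
      by (simp only: diag_lattice_sel sum_split_two[OF I ij])
  next
    fix y assume "y \<in> carrier (diag_lattice I a)"
    then have y: "y \<in> I \<rightarrow>\<^sub>E ints" by simp
    then have yi: "y i \<in> ints" "y j \<in> ints" using ij by auto
    show "f' y \<in> carrier (diag_lattice I ?a')"
    proof -
      have "f' y k \<in> ints" if "k \<in> I" for k
      proof (cases "k = i \<or> k = j")
        case True
        then show ?thesis using yi a pq(1,2) by (elim disjE) (simp_all add: f')
      next
        case False
        then show ?thesis using y that by (simp add: f'(3) PiE_iff)
      qed
      moreover have "f' y k = undefined" if "k \<notin> I" for k
      proof -
        have "k \<noteq> i" "k \<noteq> j" using that ij by metis+
        then have "f' y k = y k" by (rule f'(3))
        also have "\<dots> = undefined" by (rule PiE_arb[OF y that])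
        finally show ?thesis .
      qed
      ultimately show ?thesis by (simp add: PiE_iff extensional_def)
    qed
    show "f (f' y) = y"
      by (rule inv)
  next
    fix c x assume "x \<in> carrier (diag_lattice I ?a')"
    show "f (c \<odot>\<^bsub>diag_lattice I ?a'\<^esub> x) = c \<odot>\<^bsub>diag_lattice I a\<^esub> f x"
    proof
      fix k
      show "f (c \<odot>\<^bsub>diag_lattice I ?a'\<^esub> x) k = (c \<odot>\<^bsub>diag_lattice I a\<^esub> f x) k"
        by (cases "k = i"; cases "k = j") (simp_all add: f ij algebra_simps)
    qed
  qed
qed

lemma isometric_diag_Sigma:
  assumes S: "finite S" "\<And>\<gamma>. \<gamma> \<in> S \<Longrightarrow> finite (N \<gamma>)"
    and a: "\<And>\<gamma> i. \<gamma> \<in> S \<Longrightarrow> i \<in> N \<gamma> \<Longrightarrow> a (\<gamma>, i) \<in> ints"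
  shows "isometric (val_ring v) (diag_lattice (Sigma S N) a)
    (orthogonal_sum (val_ring v) S (\<lambda>\<gamma>. diag_lattice (N \<gamma>) (\<lambda>i. a (\<gamma>, i))))"
proof (rule isometricI[of _ "\<lambda>x. \<lambda>\<gamma>\<in>S. \<lambda>i\<in>N \<gamma>. x (\<gamma>, i)" _ "\<lambda>y. \<lambda>p\<in>Sigma S N. y (fst p) (snd p)"])
  let ?D = "diag_lattice (Sigma S N) a"
    and ?O = "orthogonal_sum (val_ring v) S (\<lambda>\<gamma>. diag_lattice (N \<gamma>) (\<lambda>i. a (\<gamma>, i)))"
  fix x assume "x \<in> carrier ?D"
  then have x: "x \<in> Sigma S N \<rightarrow>\<^sub>E ints" by simp
  then show "(\<lambda>\<gamma>\<in>S. \<lambda>i\<in>N \<gamma>. x (\<gamma>, i)) \<in> carrier ?O"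
    by (auto simp: orthogonal_sum_def)
  show "(\<lambda>p\<in>Sigma S N. (\<lambda>\<gamma>\<in>S. \<lambda>i\<in>N \<gamma>. x (\<gamma>, i)) (fst p) (snd p)) = x"
    by (rule PiE_eqI[OF _ x, of _ UNIV]) auto
  fix y assume "y \<in> carrier ?D"
  then have y: "y \<in> Sigma S N \<rightarrow>\<^sub>E ints" by simp
  show "(\<lambda>\<gamma>\<in>S. \<lambda>i\<in>N \<gamma>. (x \<oplus>\<^bsub>?D\<^esub> y) (\<gamma>, i)) = (\<lambda>\<gamma>\<in>S. \<lambda>i\<in>N \<gamma>. x (\<gamma>, i)) \<oplus>\<^bsub>?O\<^esub> (\<lambda>\<gamma>\<in>S. \<lambda>i\<in>N \<gamma>. y (\<gamma>, i))"
    by (auto simp: orthogonal_sum_def intro!: restrict_ext)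
  have "form ?O (\<lambda>\<gamma>\<in>S. \<lambda>i\<in>N \<gamma>. x (\<gamma>, i)) (\<lambda>\<gamma>\<in>S. \<lambda>i\<in>N \<gamma>. y (\<gamma>, i)) =
      (\<Sum>\<gamma>\<in>S. form (diag_lattice (N \<gamma>) (\<lambda>i. a (\<gamma>, i))) ((\<lambda>\<gamma>\<in>S. \<lambda>i\<in>N \<gamma>. x (\<gamma>, i)) \<gamma>) ((\<lambda>\<gamma>\<in>S. \<lambda>i\<in>N \<gamma>. y (\<gamma>, i)) \<gamma>))"
    unfolding orthogonal_sum_def using x y a
    by (simp del: restrict_apply) (intro finsum_val_ring, auto intro!: ints_sum ints_mult)
  also have "\<dots> = (\<Sum>\<gamma>\<in>S. \<Sum>i\<in>N \<gamma>. a (\<gamma>, i) * (x (\<gamma>, i) * y (\<gamma>, i)))"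
    by (intro sum.cong) auto
  also have "\<dots> = form ?D x y"
    using S by (simp add: sum.Sigma split_beta)
  finally show "form ?O (\<lambda>\<gamma>\<in>S. \<lambda>i\<in>N \<gamma>. x (\<gamma>, i)) (\<lambda>\<gamma>\<in>S. \<lambda>i\<in>N \<gamma>. y (\<gamma>, i)) = form ?D x y" .
next
  let ?D = "diag_lattice (Sigma S N) a"
    and ?O = "orthogonal_sum (val_ring v) S (\<lambda>\<gamma>. diag_lattice (N \<gamma>) (\<lambda>i. a (\<gamma>, i)))"
  fix y assume "y \<in> carrier ?O"
  then have y: "y \<in> (\<Pi>\<^sub>E \<gamma>\<in>S. N \<gamma> \<rightarrow>\<^sub>E ints)" by (simp add: orthogonal_sum_def)
  then show "(\<lambda>p\<in>Sigma S N. y (fst p) (snd p)) \<in> carrier ?D"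
    by (auto simp: PiE_iff)
  show "(\<lambda>\<gamma>\<in>S. \<lambda>i\<in>N \<gamma>. (\<lambda>p\<in>Sigma S N. y (fst p) (snd p)) (\<gamma>, i)) = y"
  proof (rule extensionalityI[of _ S])
    show "y \<in> extensional S" using y by (simp add: PiE_def)
    fix \<gamma> assume g: "\<gamma> \<in> S"
    then have "y \<gamma> \<in> N \<gamma> \<rightarrow>\<^sub>E ints" using y by auto
    then show "(\<lambda>\<gamma>\<in>S. \<lambda>i\<in>N \<gamma>. (\<lambda>p\<in>Sigma S N. y (fst p) (snd p)) (\<gamma>, i)) \<gamma> = y \<gamma>"
      using g by (intro PiE_eqI[of _ "N \<gamma>" UNIV _ ints]) auto
  qed auto
next
  fix c x
  show "(\<lambda>\<gamma>\<in>S. \<lambda>i\<in>N \<gamma>. (c \<odot>\<^bsub>diag_lattice (Sigma S N) a\<^esub> x) (\<gamma>, i)) =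
    c \<odot>\<^bsub>orthogonal_sum (val_ring v) S (\<lambda>\<gamma>. diag_lattice (N \<gamma>) (\<lambda>i. a (\<gamma>, i)))\<^esub> (\<lambda>\<gamma>\<in>S. \<lambda>i\<in>N \<gamma>. x (\<gamma>, i))"
    by (auto simp: orthogonal_sum_def intro!: restrict_ext)
qed

lemma scale_diag_lattice: "scale_form (val_ring v) s (diag_lattice I a) = diag_lattice I (\<lambda>i. s * a i)"
  by (simp add: scale_form_def diag_lattice_def free_lattice_def sum_distrib_left algebra_simps)

end

lemma det_diagonal:
  fixes e :: "nat \<Rightarrow> 'a::comm_ring_1"
  shows "det (mat k k (\<lambda>(i, j). if i = j then e i else 0)) = (\<Prod>i<k. e i)"
proof -
  let ?E = "mat k k (\<lambda>(i, j). if i = j then e i else 0)"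
  have "det ?E = prod_list (diag_mat ?E)"
    by (rule det_upper_triangular) (auto simp: upper_triangular_def)
  also have "\<dots> = (\<Prod>i<k. e i)"
    by (simp add: prod_list_diag_prod atLeast0LessThan)
  finally show ?thesis .
qed

text \<open>This is \<open>det (A E A\<^sup>T)\<close> for the diagonal matrix \<open>E\<close> with entries \<open>e\<close>.\<close>

lemma det_diagonal_congruence:
  fixes x :: "nat \<Rightarrow> nat \<Rightarrow> 'a::idom"
    and k :: nat
  defines "A \<equiv> mat k k (\<lambda>(l, t). x l t)"
  shows "det (mat k k (\<lambda>(l, m). \<Sum>t<k. x l t * e t * x m t)) = (\<Prod>t<k. e t) * (det A * det A)"
proof -
  define E where "E = mat k k (\<lambda>(i, j). if i = j then e i else 0)"
  have carr: "A \<in> carrier_mat k k" "E \<in> carrier_mat k k" "A\<^sup>T \<in> carrier_mat k k"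
    by (simp_all add: A_def E_def)
  have AE: "(A * E) $$ (l, t) = x l t * e t" if "l < k" "t < k" for l t
  proof -
    have "(A * E) $$ (l, t) = (\<Sum>u = 0..<k. A $$ (l, u) * E $$ (u, t))"
      using that carr by (simp add: scalar_prod_def)
    also have "\<dots> = (\<Sum>u = 0..<k. if u = t then x l t * e t else 0)"
      using that by (intro sum.cong) (auto simp: E_def A_def)
    finally show ?thesis using that by simp
  qed
  have "mat k k (\<lambda>(l, m). \<Sum>t<k. x l t * e t * x m t) = A * E * A\<^sup>T"
  proof (rule eq_matI)
    fix l m assume "l < dim_row (A * E * A\<^sup>T)" "m < dim_col (A * E * A\<^sup>T)"
    then have lm: "l < k" "m < k" using carr by auto
    then have "(A * E * A\<^sup>T) $$ (l, m) = (\<Sum>t = 0..<k. (A * E) $$ (l, t) * A\<^sup>T $$ (t, m))"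
      using carr by (simp add: scalar_prod_def del: assoc_mult_mat)
    also have "\<dots> = (\<Sum>t<k. x l t * e t * x m t)"
      using lm AE by (intro sum.cong) (auto simp: atLeast0LessThan A_def)
    finally show "mat k k (\<lambda>(l, m). \<Sum>t<k. x l t * e t * x m t) $$ (l, m) = (A * E * A\<^sup>T) $$ (l, m)"
      using lm by simp
  qed (use carr in auto)
  then show ?thesis
    using carr det_mult[of "A * E" k "A\<^sup>T"] det_mult[of A k E] det_transpose[of A k]
    by (simp add: E_def det_diagonal)
qed

context odd_henselian
begin

text \<open>Move the unit entries one by one into the entry at \<open>i0\<close>, leaving \<open>1\<close> behind.\<close>

lemma isometric_diag_product:
  assumes I: "finite I" and i0: "i0 \<in> I" and a: "\<And>i. i \<in> I \<Longrightarrow> val_unit (a i)" and J: "finite J" "J \<subseteq> I - {i0}"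
  shows "isometric (val_ring v) (diag_lattice I a)
    (diag_lattice I (\<lambda>i. if i \<in> J then 1 else if i = i0 then a i0 * prod a J else a i))"
  using J
proof (induction J rule: finite_induct)
  case empty
  have "diag_lattice I (\<lambda>i. if i \<in> {} then 1 else if i = i0 then a i0 * prod a {} else a i) = diag_lattice I a"
    by (rule diag_lattice_cong) auto
  then show ?case by (simp only: isometric_refl)
next
  case (insert j J)
  define b where "b = (\<lambda>i. if i \<in> J then 1 else if i = i0 then a i0 * prod a J else a i)"
  have ja: "j \<in> I" "j \<noteq> i0" "J \<subseteq> I - {i0}" using insert.prems by auto
  have bj: "b j = a j" "b i0 = a i0 * prod a J"
    using insert.hyps ja by (auto simp: b_def)
  have "val_unit (prod a J)" using a ja(3) by (intro val_unit_prod) auto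
  then have b: "val_unit (b j)" "val_unit (b i0)"
    unfolding bj using a ja(1) i0 by simp_all
  then obtain p q where pq: "p \<in> ints" "q \<in> ints" "b j * (p * p) + b i0 * (q * q) = 1"
    by (rule binary_form_represents_one)
  have "isometric (val_ring v) (diag_lattice I a) (diag_lattice I b)"
    unfolding b_def by (rule insert.IH[OF ja(3)])
  moreover have "isometric (val_ring v) (diag_lattice I b) (diag_lattice I (b(j := 1, i0 := b j * b i0)))"
    by (rule isometric_diag_pair[OF I ja(1) i0 ja(2) val_unit_ints[OF b(1)] val_unit_ints[OF b(2)] pq])
  moreover have "diag_lattice I (b(j := 1, i0 := b j * b i0)) =
    diag_lattice I (\<lambda>i. if i \<in> insert j J then 1 else if i = i0 then a i0 * prod a (insert j J) else a i)"
  proof (rule diag_lattice_cong)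
    fix i
    have "b j * b i0 = a i0 * prod a (insert j J)"
      unfolding bj using insert.hyps by (simp add: mult_ac)
    then show "(b(j := 1, i0 := b j * b i0)) i =
        (if i \<in> insert j J then 1 else if i = i0 then a i0 * prod a (insert j J) else a i)"
    proof (cases "i = i0")
      case True
      moreover have "i0 \<notin> insert j J" using ja by auto
      ultimately show ?thesis using \<open>b j * b i0 = a i0 * prod a (insert j J)\<close>
        by (simp only: fun_upd_same if_False if_True simp_thms)
    next
      case False
      then show ?thesis by (cases "i = j") (simp_all add: b_def)
    qed
  qed
  ultimately show ?case by (metis (no_types) isometric_trans)
qed

definition unit_diag :: "'i \<Rightarrow> int \<Rightarrow> 'i \<Rightarrow> 'k" where
  "unit_diag i0 \<epsilon> i = (if i = i0 then sign_unit \<epsilon> else 1)"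

lemma isometric_unit_diag:
  assumes I: "finite I" and i0: "i0 \<in> I" and a: "\<And>i. i \<in> I \<Longrightarrow> val_unit (a i)"
  shows "isometric (val_ring v) (diag_lattice I a) (diag_lattice I (unit_diag i0 (sq_class (prod a I))))"
proof -
  let ?w = "prod a I"
  let ?b = "\<lambda>i. if i \<in> I - {i0} then 1 else if i = i0 then a i0 * prod a (I - {i0}) else a i"
  have 1: "isometric (val_ring v) (diag_lattice I a) (diag_lattice I ?b)"
    using I i0 a by (intro isometric_diag_product) auto
  have "val_unit ?w" using a by (rule val_unit_prod)
  then obtain s where s: "val_unit s" "?w = sign_unit (sq_class ?w) * (s * s)"
    by (rule unit_eq_sign_unit_mult_square)
  define t where "t i = (if i = i0 then s else 1)" for i
  have "diag_lattice I ?b = diag_lattice I (\<lambda>i. unit_diag i0 (sq_class ?w) i * (t i * t i))"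
    using s(2) prod.remove[OF I i0, of a] by (intro diag_lattice_cong) (auto simp: unit_diag_def t_def)
  moreover have "isometric (val_ring v) (diag_lattice I (unit_diag i0 (sq_class ?w)))
      (diag_lattice I (\<lambda>i. unit_diag i0 (sq_class ?w) i * (t i * t i)))"
    using s(1) by (intro isometric_diag_squares) (simp add: t_def)
  ultimately have "isometric (val_ring v) (diag_lattice I ?b) (diag_lattice I (unit_diag i0 (sq_class ?w)))"
    using isometric_sym[OF module_diag_lattice] by metis
  with 1 show ?thesis by (rule isometric_trans)
qed

lemma unit_diag:
  assumes "\<epsilon> \<in> {1, - 1}" "finite I" "i0 \<in> I"
  shows "val_unit (unit_diag i0 \<epsilon> i)" "sq_class (prod (unit_diag i0 \<epsilon>) I) = \<epsilon>"
proof -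
  show "val_unit (unit_diag i0 \<epsilon> i)" by (simp add: unit_diag_def sign_unit)
  have "prod (unit_diag i0 \<epsilon>) I = sign_unit \<epsilon> * prod (unit_diag i0 \<epsilon>) (I - {i0})"
    using assms by (subst prod.remove[of I i0]) (auto simp: unit_diag_def)
  also have "prod (unit_diag i0 \<epsilon>) (I - {i0}) = 1"
    by (rule prod.neutral) (auto simp: unit_diag_def)
  finally show "sq_class (prod (unit_diag i0 \<epsilon>) I) = \<epsilon>" using assms by (simp add: sign_unit)
qed

section \<open>An invariant of lattices\<close>

text \<open>For a Jordan decomposition of the lattice \<open>N\<close>, the rank of the block of value \<open>v s\<close> is the largest
  \<open>k\<close> for which this holds with some \<open>\<epsilon>\<close>, and for this \<open>k\<close> the sign of the block is the only such
  \<open>\<epsilon>\<close>. As no decomposition enters the formula, rank and sign are invariants.\<close>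

definition gram_class where
  "gram_class N s k \<epsilon> \<longleftrightarrow> (\<exists>x. (\<forall>i<k. x i \<in> carrier N \<and> (\<forall>y\<in>carrier N. form N (x i) y / s \<in> ints)) \<and>
    val_unit (det (mat k k (\<lambda>(i, j). form N (x i) (x j) / s))) \<and>
    sq_class (det (mat k k (\<lambda>(i, j). form N (x i) (x j) / s))) = \<epsilon>)"

lemma gram_class_isometric:
  assumes "isometric (val_ring v) M N" "gram_class M s k \<epsilon>"
  shows "gram_class N s k \<epsilon>"
proof -
  obtain f where f: "isometry (val_ring v) M N f" using assms(1) by (auto simp: isometric_iff)
  obtain x where x: "\<forall>i<k. x i \<in> carrier M \<and> (\<forall>y\<in>carrier M. form M (x i) y / s \<in> ints)"
    "val_unit (det (mat k k (\<lambda>(i, j). form M (x i) (x j) / s)))"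
    "sq_class (det (mat k k (\<lambda>(i, j). form M (x i) (x j) / s))) = \<epsilon>"
    using assms(2) unfolding gram_class_def by blast
  have "mat k k (\<lambda>(i, j). form N (f (x i)) (f (x j)) / s) = mat k k (\<lambda>(i, j). form M (x i) (x j) / s)"
    using x(1) by (intro cong_mat) (auto simp: isometryD(5)[OF f])
  moreover have "f (x i) \<in> carrier N \<and> (\<forall>y\<in>carrier N. form N (f (x i)) y / s \<in> ints)" if "i < k" for i
  proof (intro conjI ballI)
    show "f (x i) \<in> carrier N" using x(1) that isometryD(2)[OF f] by blast
    fix y assume "y \<in> carrier N"
    then obtain z where "z \<in> carrier M" "y = f z"
      using bij_betw_imp_surj_on[OF isometryD(1)[OF f]] by blast
    then show "form N (f (x i)) y / s \<in> ints"
      using x(1) that by (simp add: isometryD(5)[OF f])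
  qed
  ultimately show ?thesis
    unfolding gram_class_def using x(2,3) by (intro exI[of _ "\<lambda>i. f (x i)"]) simp
qed

lemma form_unit_vec:
  assumes "finite I" "i \<in> I"
  shows "form (diag_lattice I a) x (unit_vec I i) = a i * x i"
    and "form (diag_lattice I a) (unit_vec I i) x = a i * x i"
proof -
  have "(\<Sum>l\<in>I. a l * (x l * unit_vec I i l)) = (\<Sum>l\<in>I. if l = i then a i * x i else 0)"
    by (intro sum.cong) (auto simp: unit_vec_def)
  then show "form (diag_lattice I a) x (unit_vec I i) = a i * x i"
    using assms by simp
  then show "form (diag_lattice I a) (unit_vec I i) x = a i * x i"
    by (simp add: mult.commute[of "unit_vec _ _ _"])
qed

text \<open>Here \<open>b\<close> is the quotient by \<open>s\<close> of a diagonal entry whose value differs from that of \<open>s\<close>. If \<open>b\<close> has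
  positive value, the claim is clear. If it has negative value, then \<open>b x\<close> can be integral only if \<open>x\<close> has
  positive value.\<close>

lemma off_value_product:
  assumes "b \<noteq> 0" "v b \<noteq> 0" "x \<in> ints" "y \<in> ints" "b * x \<in> ints" "b * y \<in> ints"
  shows "b * (x * y) \<in> max_ideal"
proof (cases "0 < v b")
  case True
  then have "b \<in> max_ideal" by (simp add: max_ideal_iff)
  then show ?thesis using assms by (intro max_ideal_mult') auto
next
  case False
  with assms(1,2) have neg: "v b < 0" by simp
  show ?thesis
  proof (cases "x = 0")
    case x: False
    then have "0 \<le> v b + v x" using assms(1,5) by (auto simp: ints_iff val_mult)
    with neg have "0 < v x"
      by (metis add_less_cancel_right add.left_neutral leD neqE add_neg_neg add_neg_nonpos not_le_imp_less less_eq_real_def)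
    then have "x \<in> max_ideal" by (simp add: max_ideal_iff)
    then have "x * (b * y) \<in> max_ideal" using assms by (intro max_ideal_mult') auto
    then show ?thesis by (simp add: algebra_simps)
  qed simp
qed

text \<open>The orthogonal basis vectors with norms of value \<open>v s\<close> realise the rank and the sign of their block. For
  any other vectors, only the coordinates \<open>X\<close> at the indices in \<open>J\<close> matter modulo the maximal ideal, by
  \<open>off_value_product\<close>. So the Gram determinant is congruent to that of \<open>X E X\<^sup>T\<close>, with \<open>E\<close> the block.\<close>

lemma gram_class_diag:
  assumes I: "finite I" and a: "\<And>i. i \<in> I \<Longrightarrow> a i \<in> ints \<and> a i \<noteq> 0" and s: "s \<noteq> 0"
  defines "J \<equiv> {i \<in> I. v (a i) = v s}"
  shows "gram_class (diag_lattice I a) s (card J) (sq_class (\<Prod>i\<in>J. a i / s))"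
    and "gram_class (diag_lattice I a) s k \<epsilon> \<Longrightarrow> card J \<le> k \<Longrightarrow> k = card J \<and> \<epsilon> = sq_class (\<Prod>i\<in>J. a i / s)"
proof -
  define n where "n = card J"
  have "finite J" using I by (simp add: J_def)
  then obtain h where h: "bij_betw h {0..<n} J"
    using ex_bij_betw_nat_finite n_def by metis
  have hJ: "h t \<in> J" "h t \<in> I" "val_unit (a (h t) / s)" if "t < n" for t
    using bij_betw_apply[OF h, of t] that a s by (auto simp: J_def val_unit_def val_divide)
  have hinj: "h t = h u \<longleftrightarrow> t = u" if "t < n" "u < n" for t u
    using h that by (auto simp: bij_betw_def inj_on_def)
  have prod_h: "(\<Prod>t<n. a (h t) / s) = (\<Prod>i\<in>J. a i / s)"
    using prod.reindex_bij_betw[OF h, of "\<lambda>i. a i / s"] by (simp add: atLeast0LessThan)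
  have sum_h: "(\<Sum>t<n. F (h t)) = (\<Sum>i\<in>J. F i)" for F :: "'a \<Rightarrow> 'k"
    using sum.reindex_bij_betw[OF h, of F] by (simp add: atLeast0LessThan)
  have "mat n n (\<lambda>(i, j). form (diag_lattice I a) (unit_vec I (h i)) (unit_vec I (h j)) / s) =
      mat n n (\<lambda>(i, j). if i = j then a (h i) / s else 0)"
  proof (rule cong_mat)
    fix i j assume ij: "i < n" "j < n"
    then show "(case (i, j) of (i, j) \<Rightarrow> form (diag_lattice I a) (unit_vec I (h i)) (unit_vec I (h j)) / s) =
        (case (i, j) of (i, j) \<Rightarrow> if i = j then a (h i) / s else 0)"
      using form_unit_vec(2)[OF I hJ(2)[OF ij(1)], of a "unit_vec I (h j)"] hJ(2) hinj[OF ij]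
      by (simp add: unit_vec_app del: diag_lattice_sel)
  qed auto
  then have det: "det (mat n n (\<lambda>(i, j). form (diag_lattice I a) (unit_vec I (h i)) (unit_vec I (h j)) / s)) =
      (\<Prod>i\<in>J. a i / s)"
    by (simp only: det_diagonal prod_h)
  have "form (diag_lattice I a) (unit_vec I (h i)) y / s \<in> ints" if "i < n" "y \<in> I \<rightarrow>\<^sub>E ints" for i y
  proof -
    have "form (diag_lattice I a) (unit_vec I (h i)) y / s = (a (h i) / s) * y (h i)"
      by (simp only: form_unit_vec(2)[OF I hJ(2)[OF that(1)]]) simp
    moreover have "y (h i) \<in> ints" using that hJ(2) by auto
    ultimately show ?thesis using hJ(3)[OF that(1)] by (metis ints_mult val_unit_ints)
  qed
  moreover have "val_unit (\<Prod>i\<in>J. a i / s)"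
    using a s by (intro val_unit_prod) (auto simp: J_def val_unit_def val_divide)
  ultimately show "gram_class (diag_lattice I a) s (card J) (sq_class (\<Prod>i\<in>J. a i / s))"
    unfolding gram_class_def n_def[symmetric]
    by (intro exI[of _ "\<lambda>i. unit_vec I (h i)"]) (simp only: det diag_lattice_sel(1) unit_vec_closed, blast)
  assume "gram_class (diag_lattice I a) s k \<epsilon>" and nk: "card J \<le> k"
  then obtain x where x: "\<And>i. i < k \<Longrightarrow> x i \<in> I \<rightarrow>\<^sub>E ints"
    "\<And>i y. i < k \<Longrightarrow> y \<in> I \<rightarrow>\<^sub>E ints \<Longrightarrow> form (diag_lattice I a) (x i) y / s \<in> ints"
    "val_unit (det (mat k k (\<lambda>(i, j). form (diag_lattice I a) (x i) (x j) / s)))"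
    "sq_class (det (mat k k (\<lambda>(i, j). form (diag_lattice I a) (x i) (x j) / s))) = \<epsilon>"
    unfolding gram_class_def diag_lattice_sel(1) by blast
  define G where "G = mat k k (\<lambda>(i, j). form (diag_lattice I a) (x i) (x j) / s)"
  \<comment> \<open>If \<open>k\<close> exceeds the rank \<open>n\<close> of the block, the block is enlarged by zeros to a matrix of size \<open>k\<close>,
    which makes its determinant vanish.\<close>
  define e where "e t = (if t < n then a (h t) / s else 0)" for t
  define X where "X l t = (if t < n then x l (h t) else 0)" for l t
  define A where "A = mat k k (\<lambda>(l, t). X l t)"
  define G' where "G' = mat k k (\<lambda>(l, m). \<Sum>t<k. X l t * e t * X m t)"
  have xi: "x l i \<in> ints" if "l < k" "i \<in> I" for l i
    using x(1)[OF that(1)] that(2) by auto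
  have xa: "a i / s * x l i \<in> ints" if "l < k" "i \<in> I" for l i
    using x(2)[OF that(1) unit_vec_closed[of I i]] form_unit_vec(1)[OF I that(2), of a "x l"] by simp
  have entry: "G' $$ (l, m) = (\<Sum>i\<in>J. a i / s * (x l i * x m i))" if "l < k" "m < k" for l m
  proof -
    have "G' $$ (l, m) = (\<Sum>t<k. X l t * e t * X m t)"
      using that by (simp add: G'_def)
    also have "\<dots> = (\<Sum>t<n. X l t * e t * X m t)"
      using nk by (intro sum.mono_neutral_right) (auto simp: n_def e_def)
    also have "\<dots> = (\<Sum>t<n. a (h t) / s * (x l (h t) * x m (h t)))"
      by (intro sum.cong) (auto simp: X_def e_def)
    also have "\<dots> = (\<Sum>i\<in>J. a i / s * (x l i * x m i))"
      by (rule sum_h)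
    finally show ?thesis .
  qed
  have cong: "G $$ (l, m) - G' $$ (l, m) \<in> max_ideal" if "l < k" "m < k" for l m
  proof -
    have "G $$ (l, m) = (\<Sum>i\<in>I. a i / s * (x l i * x m i))"
      using that by (simp add: G_def sum_divide_distrib)
    also have "\<dots> = (\<Sum>i\<in>J. a i / s * (x l i * x m i)) + (\<Sum>i\<in>I - J. a i / s * (x l i * x m i))"
      using I sum.subset_diff[of J I] by (simp add: J_def add.commute)
    finally have "G $$ (l, m) - G' $$ (l, m) = (\<Sum>i\<in>I - J. a i / s * (x l i * x m i))"
      by (simp add: entry[OF that])
    also have "\<dots> \<in> max_ideal"
    proof (rule max_ideal_sum)
      fix i assume i: "i \<in> I - J"
      show "a i / s * (x l i * x m i) \<in> max_ideal"
      proof (rule off_value_product)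
        show "a i / s \<noteq> 0" "v (a i / s) \<noteq> 0" using a[of i] s i by (auto simp: J_def val_divide)
      qed (use i xi xa that in auto)
    qed
    finally show ?thesis .
  qed
  have Gint: "G $$ (l, m) \<in> ints" if "l < k" "m < k" for l m
    using x(2)[OF that(1) x(1)[OF that(2)]] that by (simp add: G_def)
  have "det G - det G' \<in> max_ideal"
    by (rule det_cong_max_ideal[of _ k]) (use Gint cong in \<open>auto simp: G_def G'_def\<close>)
  then have dG: "det G - (\<Prod>t<k. e t) * (det A * det A) \<in> max_ideal"
    by (simp add: G'_def A_def det_diagonal_congruence)
  have uG: "val_unit (det G)" using x(3) by (simp add: G_def)
  then have u: "val_unit ((\<Prod>t<k. e t) * (det A * det A))"
    using dG by (rule val_unit_cong)
  have kn: "k = n"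
  proof (rule ccontr)
    assume "k \<noteq> n"
    then have "n < k" using nk by (simp add: n_def)
    then have "(\<Prod>t<k. e t) = 0" by (auto simp: e_def)
    then show False using u by (simp add: val_unit_def)
  qed
  have pe: "(\<Prod>t<k. e t) = (\<Prod>i\<in>J. a i / s)"
    unfolding kn using prod_h by (simp add: e_def)
  have "det A \<noteq> 0" using u by (auto simp: val_unit_def)
  then have "\<epsilon> = sq_class (\<Prod>i\<in>J. a i / s)"
    using sq_class_cong[OF uG dG] x(4) pe sq_class_mult_square[of "det A"] by (simp add: G_def)
  with kn show "k = card J \<and> \<epsilon> = sq_class (\<Prod>i\<in>J. a i / s)" by (simp add: n_def)
qed

end

section \<open>Reduction modulo the maximal ideal\<close>

lemma det_of_cong:
  assumes "cring A" and g: "\<And>i j. i < n \<Longrightarrow> j < n \<Longrightarrow> g i j = h i j" "\<And>i j. i < n \<Longrightarrow> j < n \<Longrightarrow> h i j \<in> carrier A"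
  shows "det_of A n g = det_of A n h"
proof -
  interpret cring A by fact
  have mem: "p i < n" if "p permutes {..<n}" "i < n" for p i
    using permutes_in_image[OF that(1)] that(2) by simp
  have closed: "(\<Otimes>\<^bsub>A\<^esub>i\<in>{..<n}. h i (p i)) \<in> carrier A" if "p permutes {..<n}" for p
    using mem[OF that] g(2) by (intro finprod_closed) auto
  have eq: "(\<Otimes>\<^bsub>A\<^esub>i\<in>{..<n}. g i (p i)) = (\<Otimes>\<^bsub>A\<^esub>i\<in>{..<n}. h i (p i))" if "p permutes {..<n}" for p
    using mem[OF that] g by (intro finprod_cong') auto
  show ?thesis
    unfolding det_of_def by (rule finsum_cong') (simp_all add: eq closed Pi_iff)
qed

lemma finsum_hom:
  assumes "abelian_group M" "abelian_group N" "f \<in> S \<rightarrow> carrier M"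
    and h: "\<And>x. x \<in> carrier M \<Longrightarrow> h x \<in> carrier N"
      "\<And>x y. x \<in> carrier M \<Longrightarrow> y \<in> carrier M \<Longrightarrow> h (x \<oplus>\<^bsub>M\<^esub> y) = h x \<oplus>\<^bsub>N\<^esub> h y"
  shows "h (finsum M f S) = finsum N (\<lambda>s. h (f s)) S"
proof -
  interpret M: abelian_group M by fact
  interpret N: abelian_group N by fact
  have "h \<zero>\<^bsub>M\<^esub> \<oplus>\<^bsub>N\<^esub> h \<zero>\<^bsub>M\<^esub> = h \<zero>\<^bsub>M\<^esub>"
    using h(2)[of "\<zero>\<^bsub>M\<^esub>" "\<zero>\<^bsub>M\<^esub>"] by simp
  then have h0: "h \<zero>\<^bsub>M\<^esub> = \<zero>\<^bsub>N\<^esub>"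
    using h(1)[of "\<zero>\<^bsub>M\<^esub>"] by (metis M.zero_closed N.add.l_cancel_one)
  show ?thesis
    using assms(3)
  proof (induction S rule: infinite_finite_induct)
    case (insert s S)
    then have "finsum M f S \<in> carrier M" by auto
    with insert show ?case
      using h by (simp add: M.finsum_insert N.finsum_insert Pi_iff)
  qed (simp_all add: h0 M.finsum_infinite N.finsum_infinite)
qed

lemma card_module_basis:
  assumes M: "module A M" and b: "module_basis A M n b"
  shows "card (carrier M) = card (carrier A) ^ n"
proof -
  interpret module A M by fact
  have bc: "b i \<in> carrier M" if "i < n" for i
    using b that by (auto simp: module_basis_def)
  let ?\<phi> = "\<lambda>c. \<Oplus>\<^bsub>M\<^esub>i\<in>{..<n}. c i \<odot>\<^bsub>M\<^esub> b i"
  have "bij_betw ?\<phi> ({..<n} \<rightarrow>\<^sub>E carrier A) (carrier M)"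
    unfolding bij_betw_def
  proof
    have cl: "?\<phi> c \<in> carrier M" if "c \<in> {..<n} \<rightarrow>\<^sub>E carrier A" for c
      using that bc by (intro M.finsum_closed) (auto simp: PiE_iff)
    have ex1: "\<exists>!c. c \<in> {..<n} \<rightarrow>\<^sub>E carrier A \<and> x = ?\<phi> c" if "x \<in> carrier M" for x
      using b that by (auto simp: module_basis_def)
    show "inj_on ?\<phi> ({..<n} \<rightarrow>\<^sub>E carrier A)"
      by (rule inj_onI) (use ex1 cl in metis)
    show "?\<phi> ` ({..<n} \<rightarrow>\<^sub>E carrier A) = carrier M"
      using ex1 cl by (fastforce simp: image_def)
  qed
  then have "card (carrier M) = card ({..<n} \<rightarrow>\<^sub>E carrier A)"
    by (simp add: bij_betw_same_card)
  then show ?thesis by (simp add: card_PiE)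
qed

text \<open>The map \<open>f\<close> gives the coordinates in an orthogonal basis of an arbitrary unimodular lattice \<open>L\<close>. Since
  \<open>L\<close> is abstract, the results apply both to a diagonal lattice and to the lattices \<open>1\<^sup>\<epsilon>\<^sup>n\<close>,
  about which nothing but their defining property is known.\<close>

locale diagonalized_lattice = odd_henselian v
  for v :: "'k::field \<Rightarrow> 'g::linordered_ab_group_add" +
  fixes L :: "('k, 'b, 'y) form_module_scheme" and m :: nat and a :: "nat \<Rightarrow> 'k" and f :: "'b \<Rightarrow> nat \<Rightarrow> 'k"
  assumes module_L: "module (val_ring v) L"
    and isometry_f: "isometry (val_ring v) L (diag_lattice {..<m} a) f"
    and unit_entries: "i < m \<Longrightarrow> val_unit (a i)"
begin

sublocale L: module "val_ring v" L by (rule module_L)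

lemma f_props:
  assumes "x \<in> carrier L"
  shows "f x \<in> {..<m} \<rightarrow>\<^sub>E ints" and "i < m \<Longrightarrow> f x i \<in> ints"
    and "y \<in> carrier L \<Longrightarrow> i < m \<Longrightarrow> f (x \<oplus>\<^bsub>L\<^esub> y) i = f x i + f y i"
    and "c \<in> ints \<Longrightarrow> i < m \<Longrightarrow> f (c \<odot>\<^bsub>L\<^esub> x) i = c * f x i"
    and "y \<in> carrier L \<Longrightarrow> form L x y = (\<Sum>i<m. a i * (f x i * f y i))"
  using isometryD(2-5)[OF isometry_f, where x = x] assms by (auto simp: PiE_iff)

lemma f_zero: "i < m \<Longrightarrow> f \<zero>\<^bsub>L\<^esub> i = 0"
  using f_props(4)[of "\<zero>\<^bsub>L\<^esub>" 0 i] by simp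

lemma f_minus: "x \<in> carrier L \<Longrightarrow> i < m \<Longrightarrow> f (\<ominus>\<^bsub>L\<^esub> x) i = - f x i"
  using f_props(3)[of "\<ominus>\<^bsub>L\<^esub> x" x i] by (simp add: L.M.l_neg f_zero eq_neg_iff_add_eq_0)

lemma f_eqI: "x \<in> carrier L \<Longrightarrow> y \<in> carrier L \<Longrightarrow> (\<And>i. i < m \<Longrightarrow> f x i = f y i) \<Longrightarrow> x = y"
  using isometryD(1)[OF isometry_f] f_props(1)[of x] f_props(1)[of y] PiE_eqI[of "f x" "{..<m}" ints "f y" ints]
  by (auto simp: bij_betw_def dest: inj_onD)

lemma f_finsum:
  assumes "\<And>s. s \<in> S \<Longrightarrow> y s \<in> carrier L" "\<And>s. s \<in> S \<Longrightarrow> c s \<in> ints" and i: "i < m"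
  shows "f (\<Oplus>\<^bsub>L\<^esub>s\<in>S. c s \<odot>\<^bsub>L\<^esub> y s) i = (\<Sum>s\<in>S. c s * f (y s) i)"
proof -
  have g: "abelian_group (diag_lattice {..<m} a)"
    using module_diag_lattice by (auto simp: module_def)
  have "f (\<Oplus>\<^bsub>L\<^esub>s\<in>S. c s \<odot>\<^bsub>L\<^esub> y s) = (\<Oplus>\<^bsub>diag_lattice {..<m} a\<^esub>s\<in>S. f (c s \<odot>\<^bsub>L\<^esub> y s))"
    using assms isometryD(2,3)[OF isometry_f]
    by (intro finsum_hom[OF L.M.abelian_group_axioms g]) auto
  also have "\<dots> = (\<lambda>i\<in>{..<m}. \<Sum>s\<in>S. f (c s \<odot>\<^bsub>L\<^esub> y s) i)"
    unfolding diag_lattice_def by (intro finsum_free_lattice) (use f_props(1) assms in auto)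
  finally show ?thesis using assms f_props(4) by (simp add: i)
qed

definition bvec :: "nat \<Rightarrow> 'b" where "bvec i = inv_into (carrier L) f (unit_vec {..<m} i)"

lemma bvec: "bvec i \<in> carrier L" "f (bvec i) = unit_vec {..<m} i"
proof -
  have "unit_vec {..<m} i \<in> f ` carrier L"
    using isometryD(1)[OF isometry_f] by (simp add: bij_betw_def)
  then show "bvec i \<in> carrier L" "f (bvec i) = unit_vec {..<m} i"
    unfolding bvec_def by (simp_all add: inv_into_into f_inv_into_f)
qed

lemma f_combination:
  assumes "\<And>i. i < m \<Longrightarrow> c i \<in> ints" "j < m"
  shows "f (\<Oplus>\<^bsub>L\<^esub>i\<in>{..<m}. c i \<odot>\<^bsub>L\<^esub> bvec i) j = c j"
proof -
  have "f (\<Oplus>\<^bsub>L\<^esub>i\<in>{..<m}. c i \<odot>\<^bsub>L\<^esub> bvec i) j = (\<Sum>i<m. c i * f (bvec i) j)"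
    using assms bvec by (intro f_finsum) auto
  also have "\<dots> = (\<Sum>i<m. if j = i then c i else 0)"
    using assms by (intro sum.cong) (auto simp: bvec unit_vec_def)
  finally show ?thesis using assms by simp
qed

lemma combination_closed: "(\<And>i. i < m \<Longrightarrow> c i \<in> ints) \<Longrightarrow> (\<Oplus>\<^bsub>L\<^esub>i\<in>{..<m}. c i \<odot>\<^bsub>L\<^esub> bvec i) \<in> carrier L"
  using bvec by (intro L.M.finsum_closed) auto

lemma expansion: "x \<in> carrier L \<Longrightarrow> (\<Oplus>\<^bsub>L\<^esub>i\<in>{..<m}. f x i \<odot>\<^bsub>L\<^esub> bvec i) = x"
  by (intro f_eqI combination_closed) (auto simp: f_combination f_props)

abbreviation mL where "mL \<equiv> ideal_smult max_ideal L"
abbreviation Lbar where "Lbar \<equiv> reduction (val_ring v) max_ideal L"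

text \<open>Congruence modulo \<open>I L\<close> is congruence of all coordinates modulo \<open>I\<close>. Together with the next facts this
  reduces all computations in the quotient to coordinates.\<close>

lemma mL_eq: "mL = {x \<in> carrier L. \<forall>i<m. f x i \<in> max_ideal}"
proof
  show "mL \<subseteq> {x \<in> carrier L. \<forall>i<m. f x i \<in> max_ideal}"
  proof
    fix z assume "z \<in> mL"
    then obtain n :: nat and c x where z: "z = (\<Oplus>\<^bsub>L\<^esub>i\<in>{..<n}. c i \<odot>\<^bsub>L\<^esub> x i)"
      "c \<in> {..<n} \<rightarrow> max_ideal" "x \<in> {..<n} \<rightarrow> carrier L"
      by (auto simp: ideal_smult_def)
    have "z \<in> carrier L" unfolding z(1) using z(2,3) by (intro L.M.finsum_closed) (auto simp: Pi_iff)
    moreover have "f z i \<in> max_ideal" if "i < m" for i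
    proof -
      have "f z i = (\<Sum>k<n. c k * f (x k) i)"
        unfolding z(1) using z(2,3) that by (intro f_finsum) (auto simp: Pi_iff)
      also have "\<dots> \<in> max_ideal"
        using z(2,3) that f_props(2) by (intro max_ideal_sum max_ideal_mult') (auto simp: Pi_iff)
      finally show ?thesis .
    qed
    ultimately show "z \<in> {x \<in> carrier L. \<forall>i<m. f x i \<in> max_ideal}" by blast
  qed
  show "{x \<in> carrier L. \<forall>i<m. f x i \<in> max_ideal} \<subseteq> mL"
  proof
    fix x assume x: "x \<in> {x \<in> carrier L. \<forall>i<m. f x i \<in> max_ideal}"
    then have "x = (\<Oplus>\<^bsub>L\<^esub>i\<in>{..<m}. f x i \<odot>\<^bsub>L\<^esub> bvec i)" by (simp add: expansion)
    then show "x \<in> mL"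
      unfolding ideal_smult_def using x bvec by blast
  qed
qed

text \<open>The natural map from \<open>L\<close> onto its reduction.\<close>

definition \<pi> :: "'b \<Rightarrow> 'b set" where "\<pi> x = mL +>\<^bsub>L\<^esub> x"

lemma abelian_subgroup_mL: "abelian_subgroup mL L"
proof (rule abelian_subgroupI3)
  show "additive_subgroup mL L"
    unfolding additive_subgroup_def
    by (rule L.M.add.subgroupI)
      (auto simp: mL_eq f_props f_zero f_minus a_inv_def[symmetric] intro!: exI[of _ "\<zero>\<^bsub>L\<^esub>"])
qed (rule L.M.abelian_group_axioms)

lemma \<pi>_altdef: "x \<in> carrier L \<Longrightarrow> \<pi> x = {y \<in> carrier L. \<forall>i<m. f y i - f x i \<in> max_ideal}"
proof -
  assume x: "x \<in> carrier L"
  have "y \<in> \<pi> x" if "y \<in> carrier L" "\<forall>i<m. f y i - f x i \<in> max_ideal" for y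
  proof -
    have "y \<oplus>\<^bsub>L\<^esub> \<ominus>\<^bsub>L\<^esub> x \<in> mL"
      using that x by (simp add: mL_eq f_props f_minus)
    moreover have "y = (y \<oplus>\<^bsub>L\<^esub> \<ominus>\<^bsub>L\<^esub> x) \<oplus>\<^bsub>L\<^esub> x"
      using that x by (simp add: L.M.a_assoc L.M.l_neg)
    ultimately show ?thesis unfolding \<pi>_def a_r_coset_def' by blast
  qed
  moreover have "y \<in> carrier L \<and> (\<forall>i<m. f y i - f x i \<in> max_ideal)" if "y \<in> \<pi> x" for y
    using that x unfolding \<pi>_def a_r_coset_def' by (auto simp: mL_eq f_props)
  ultimately show ?thesis by blast
qed

lemma \<pi>_eq_iff: "x \<in> carrier L \<Longrightarrow> y \<in> carrier L \<Longrightarrow> \<pi> x = \<pi> y \<longleftrightarrow> (\<forall>i<m. f x i - f y i \<in> max_ideal)"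
proof
  assume x: "x \<in> carrier L" "y \<in> carrier L" "\<pi> x = \<pi> y"
  have "x \<in> \<pi> x" using x(1) by (simp add: \<pi>_altdef)
  then show "\<forall>i<m. f x i - f y i \<in> max_ideal" using x by (simp add: \<pi>_altdef)
next
  assume x: "x \<in> carrier L" "y \<in> carrier L" and d: "\<forall>i<m. f x i - f y i \<in> max_ideal"
  have "(z - f x i \<in> max_ideal) = (z - f y i \<in> max_ideal)" if "i < m" for z i
    using max_ideal_add[of "z - f x i" "f x i - f y i"] max_ideal_diff[of "z - f y i" "f x i - f y i"] d that by auto
  then show "\<pi> x = \<pi> y" using x by (simp add: \<pi>_altdef)
qed

lemma form_closed_L: "x \<in> carrier L \<Longrightarrow> y \<in> carrier L \<Longrightarrow> form L x y \<in> ints"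
  using f_props unit_entries by (auto intro!: ints_sum ints_mult)

lemma form_cong:
  assumes "x \<in> carrier L" "y \<in> carrier L" "x' \<in> \<pi> x" "y' \<in> \<pi> y"
  shows "form L x' y' - form L x y \<in> max_ideal"
proof -
  have x': "x' \<in> carrier L" "\<forall>i<m. f x' i - f x i \<in> max_ideal" "y' \<in> carrier L" "\<forall>i<m. f y' i - f y i \<in> max_ideal"
    using assms by (auto simp: \<pi>_altdef)
  show ?thesis
    unfolding f_props(5)[OF x'(1,3)] f_props(5)[OF assms(1,2)]
  proof (rule sum_cong_max_ideal)
    fix i assume i: "i \<in> {..<m}"
    then have "f x' i * f y' i - f x i * f y i \<in> max_ideal"
      using x' f_props(2) assms by (intro mult_cong_max_ideal) auto
    then have "a i * (f x' i * f y' i - f x i * f y i) \<in> max_ideal"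
      using i unit_entries by (intro max_ideal_mult) auto
    then show "a i * (f x' i * f y' i) - a i * (f x i * f y i) \<in> max_ideal"
      by (simp add: algebra_simps)
  qed
qed

lemma Lbar_carrier: "carrier Lbar = \<pi> ` carrier L"
  by (auto simp: reduction_def A_RCOSETS_def RCOSETS_def \<pi>_def a_r_coset_def)

text \<open>The operations on cosets are unions over all representatives, so that computing them means to check that
  they do not depend on the representatives.\<close>

lemma Lbar_sel:
  shows "x \<in> carrier L \<Longrightarrow> \<pi> x \<in> carrier Lbar"
    and "x \<in> carrier L \<Longrightarrow> y \<in> carrier L \<Longrightarrow> \<pi> x \<oplus>\<^bsub>Lbar\<^esub> \<pi> y = \<pi> (x \<oplus>\<^bsub>L\<^esub> y)"
    and "c \<in> ints \<Longrightarrow> x \<in> carrier L \<Longrightarrow> residue c \<odot>\<^bsub>Lbar\<^esub> \<pi> x = \<pi> (c \<odot>\<^bsub>L\<^esub> x)"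
    and "\<zero>\<^bsub>Lbar\<^esub> = \<pi> \<zero>\<^bsub>L\<^esub>"
    and "x \<in> carrier L \<Longrightarrow> y \<in> carrier L \<Longrightarrow> form Lbar (\<pi> x) (\<pi> y) = residue (form L x y)"
proof -
  interpret S: abelian_subgroup mL L by (rule abelian_subgroup_mL)
  show "x \<in> carrier L \<Longrightarrow> \<pi> x \<in> carrier Lbar" by (simp add: Lbar_carrier)
  show "x \<in> carrier L \<Longrightarrow> y \<in> carrier L \<Longrightarrow> \<pi> x \<oplus>\<^bsub>Lbar\<^esub> \<pi> y = \<pi> (x \<oplus>\<^bsub>L\<^esub> y)"
    using S.a_rcos_sum by (simp add: reduction_def \<pi>_def)
  have "(\<forall>i<m. f y i - f \<zero>\<^bsub>L\<^esub> i \<in> max_ideal) = (\<forall>i<m. f y i \<in> max_ideal)" for y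
    using f_zero by simp
  then have "mL = \<pi> \<zero>\<^bsub>L\<^esub>"
    unfolding mL_eq \<pi>_altdef[OF L.M.zero_closed] by simp
  then show "\<zero>\<^bsub>Lbar\<^esub> = \<pi> \<zero>\<^bsub>L\<^esub>" by (simp add: reduction_def)
  show "residue c \<odot>\<^bsub>Lbar\<^esub> \<pi> x = \<pi> (c \<odot>\<^bsub>L\<^esub> x)" if c: "c \<in> ints" and x: "x \<in> carrier L"
  proof -
    have "\<pi> (d \<odot>\<^bsub>L\<^esub> y) = \<pi> (c \<odot>\<^bsub>L\<^esub> x)" if "d \<in> residue c" "y \<in> \<pi> x" for d y
    proof -
      have d: "d - c \<in> max_ideal" "d \<in> ints" using that(1) c cong_ints[of d c] by (auto simp: residue_altdef)
      have y: "y \<in> carrier L" "\<forall>i<m. f y i - f x i \<in> max_ideal" using that(2) x by (auto simp: \<pi>_altdef)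
      show ?thesis
        using d y x c f_props(2) by (subst \<pi>_eq_iff) (auto simp: f_props(4) intro!: mult_cong_max_ideal)
    qed
    moreover have "c \<in> residue c" "x \<in> \<pi> x" using x by (simp_all add: residue_altdef \<pi>_altdef)
    ultimately have "(\<Union>d\<in>residue c. \<Union>y\<in>\<pi> x. \<pi> (d \<odot>\<^bsub>L\<^esub> y)) = \<pi> (c \<odot>\<^bsub>L\<^esub> x)" by blast
    then show ?thesis by (simp add: reduction_def \<pi>_def[symmetric])
  qed
  show "form Lbar (\<pi> x) (\<pi> y) = residue (form L x y)" if x: "x \<in> carrier L" and y: "y \<in> carrier L"
  proof -
    have "residue (form L x' y') = residue (form L x y)" if "x' \<in> \<pi> x" "y' \<in> \<pi> y" for x' y'
      using form_cong[OF x y that] by (simp add: residue_eq_iff)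
    moreover have "x \<in> \<pi> x" "y \<in> \<pi> y" using x y by (simp_all add: \<pi>_altdef)
    ultimately have "(\<Union>x'\<in>\<pi> x. \<Union>y'\<in>\<pi> y. residue (form L x' y')) = residue (form L x y)" by blast
    then show ?thesis by (simp add: reduction_def residue_def[symmetric])
  qed
qed

lemma module_Lbar: "module RF Lbar"
proof (rule moduleI)
  have ex: "\<exists>x\<in>carrier L. X = \<pi> x" if "X \<in> carrier Lbar" for X
    using that by (auto simp: Lbar_carrier)
  have exF: "\<exists>c\<in>ints. C = residue c" if "C \<in> carrier RF" for C
    using that by (auto simp: RF_carrier)
  show "cring RF" by (rule cring_RF)
  show "abelian_group Lbar"
  proof (rule abelian_groupI)
    fix X assume "X \<in> carrier Lbar"
    then obtain x where x: "x \<in> carrier L" "X = \<pi> x" using ex by blast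
    show "\<exists>Y\<in>carrier Lbar. Y \<oplus>\<^bsub>Lbar\<^esub> X = \<zero>\<^bsub>Lbar\<^esub>"
      using x by (intro bexI[of _ "\<pi> (\<ominus>\<^bsub>L\<^esub> x)"]) (simp_all add: Lbar_sel L.M.l_neg)
    show "\<zero>\<^bsub>Lbar\<^esub> \<oplus>\<^bsub>Lbar\<^esub> X = X" using x by (simp add: Lbar_sel)
    fix Y assume "Y \<in> carrier Lbar"
    then obtain y where y: "y \<in> carrier L" "Y = \<pi> y" using ex by blast
    show "X \<oplus>\<^bsub>Lbar\<^esub> Y \<in> carrier Lbar" using x y by (simp add: Lbar_sel)
    show "X \<oplus>\<^bsub>Lbar\<^esub> Y = Y \<oplus>\<^bsub>Lbar\<^esub> X" using x y by (simp add: Lbar_sel L.M.a_comm)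
    fix Z assume "Z \<in> carrier Lbar"
    then obtain z where z: "z \<in> carrier L" "Z = \<pi> z" using ex by blast
    show "X \<oplus>\<^bsub>Lbar\<^esub> Y \<oplus>\<^bsub>Lbar\<^esub> Z = X \<oplus>\<^bsub>Lbar\<^esub> (Y \<oplus>\<^bsub>Lbar\<^esub> Z)"
      using x y z by (simp add: Lbar_sel L.M.a_assoc)
  qed (simp add: Lbar_sel)
  fix X assume "X \<in> carrier Lbar"
  then obtain x where x: "x \<in> carrier L" "X = \<pi> x" using ex by blast
  show "\<one>\<^bsub>RF\<^esub> \<odot>\<^bsub>Lbar\<^esub> X = X" using x L.smult_one[of x] by (simp add: Lbar_sel)
  fix C assume "C \<in> carrier RF"
  then obtain c where c: "c \<in> ints" "C = residue c" using exF by blast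
  show "C \<odot>\<^bsub>Lbar\<^esub> X \<in> carrier Lbar" using x c by (simp add: Lbar_sel)
  {
    fix D assume "D \<in> carrier RF"
    then obtain d where d: "d \<in> ints" "D = residue d" using exF by blast
    show "(C \<oplus>\<^bsub>RF\<^esub> D) \<odot>\<^bsub>Lbar\<^esub> X = C \<odot>\<^bsub>Lbar\<^esub> X \<oplus>\<^bsub>Lbar\<^esub> D \<odot>\<^bsub>Lbar\<^esub> X"
      using x c d L.smult_l_distr[of c d x] by (simp add: Lbar_sel)
    show "(C \<otimes>\<^bsub>RF\<^esub> D) \<odot>\<^bsub>Lbar\<^esub> X = C \<odot>\<^bsub>Lbar\<^esub> (D \<odot>\<^bsub>Lbar\<^esub> X)"
      using x c d L.smult_assoc1[of c d x] by (simp add: Lbar_sel)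
  }
  fix Y assume "Y \<in> carrier Lbar"
  then obtain y where y: "y \<in> carrier L" "Y = \<pi> y" using ex by blast
  show "C \<odot>\<^bsub>Lbar\<^esub> (X \<oplus>\<^bsub>Lbar\<^esub> Y) = C \<odot>\<^bsub>Lbar\<^esub> X \<oplus>\<^bsub>Lbar\<^esub> C \<odot>\<^bsub>Lbar\<^esub> Y"
    using x c y L.smult_r_distr[of c x y] by (simp add: Lbar_sel)
qed

lemma finsum_Lbar:
  assumes "\<And>s. s \<in> S \<Longrightarrow> y s \<in> carrier L" "\<And>s. s \<in> S \<Longrightarrow> c s \<in> ints"
  shows "(\<Oplus>\<^bsub>Lbar\<^esub>s\<in>S. residue (c s) \<odot>\<^bsub>Lbar\<^esub> \<pi> (y s)) = \<pi> (\<Oplus>\<^bsub>L\<^esub>s\<in>S. c s \<odot>\<^bsub>L\<^esub> y s)"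
proof -
  interpret B: module RF Lbar by (rule module_Lbar)
  have "\<pi> (\<Oplus>\<^bsub>L\<^esub>s\<in>S. c s \<odot>\<^bsub>L\<^esub> y s) = (\<Oplus>\<^bsub>Lbar\<^esub>s\<in>S. \<pi> (c s \<odot>\<^bsub>L\<^esub> y s))"
    using assms by (intro finsum_hom[OF L.M.abelian_group_axioms B.M.abelian_group_axioms]) (auto simp: Lbar_sel)
  also have "\<dots> = (\<Oplus>\<^bsub>Lbar\<^esub>s\<in>S. residue (c s) \<odot>\<^bsub>Lbar\<^esub> \<pi> (y s))"
    using assms by (intro B.M.finsum_cong') (auto simp: Lbar_sel)
  finally show ?thesis by simp
qed

lemma module_basis_Lbar: "module_basis RF Lbar m (\<lambda>i. \<pi> (bvec i))"
  unfolding module_basis_def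
proof (intro conjI ballI)
  show "(\<lambda>i. \<pi> (bvec i)) \<in> {..<m} \<rightarrow> carrier Lbar" using bvec by (auto simp: Lbar_sel)
  fix X assume "X \<in> carrier Lbar"
  then obtain x where x: "x \<in> carrier L" "X = \<pi> x" by (auto simp: Lbar_carrier)
  have comb: "(\<Oplus>\<^bsub>Lbar\<^esub>i\<in>{..<m}. C i \<odot>\<^bsub>Lbar\<^esub> \<pi> (bvec i)) = \<pi> (\<Oplus>\<^bsub>L\<^esub>i\<in>{..<m}. c i \<odot>\<^bsub>L\<^esub> bvec i)"
    if "\<And>i. i < m \<Longrightarrow> c i \<in> ints" "\<And>i. i < m \<Longrightarrow> C i = residue (c i)" for C c
  proof -
    interpret B: module RF Lbar by (rule module_Lbar)
    have "(\<Oplus>\<^bsub>Lbar\<^esub>i\<in>{..<m}. C i \<odot>\<^bsub>Lbar\<^esub> \<pi> (bvec i)) = (\<Oplus>\<^bsub>Lbar\<^esub>i\<in>{..<m}. residue (c i) \<odot>\<^bsub>Lbar\<^esub> \<pi> (bvec i))"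
      using that bvec by (intro B.M.finsum_cong') (auto simp: Lbar_sel)
    also have "\<dots> = \<pi> (\<Oplus>\<^bsub>L\<^esub>i\<in>{..<m}. c i \<odot>\<^bsub>L\<^esub> bvec i)"
      using that bvec by (intro finsum_Lbar) auto
    finally show ?thesis .
  qed
  show "\<exists>!C. C \<in> {..<m} \<rightarrow>\<^sub>E carrier RF \<and> X = (\<Oplus>\<^bsub>Lbar\<^esub>i\<in>{..<m}. C i \<odot>\<^bsub>Lbar\<^esub> \<pi> (bvec i))"
  proof (rule ex1I[of _ "\<lambda>i\<in>{..<m}. residue (f x i)"])
    show "(\<lambda>i\<in>{..<m}. residue (f x i)) \<in> {..<m} \<rightarrow>\<^sub>E carrier RF \<and>
        X = (\<Oplus>\<^bsub>Lbar\<^esub>i\<in>{..<m}. (\<lambda>i\<in>{..<m}. residue (f x i)) i \<odot>\<^bsub>Lbar\<^esub> \<pi> (bvec i))"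
      using x f_props(2) comb[of "f x" "\<lambda>i\<in>{..<m}. residue (f x i)"] by (auto simp: expansion)
  next
    fix C assume C: "C \<in> {..<m} \<rightarrow>\<^sub>E carrier RF \<and> X = (\<Oplus>\<^bsub>Lbar\<^esub>i\<in>{..<m}. C i \<odot>\<^bsub>Lbar\<^esub> \<pi> (bvec i))"
    then have "\<forall>i. \<exists>c. i < m \<longrightarrow> c \<in> ints \<and> C i = residue c"
      by (auto simp: PiE_iff RF_carrier image_iff Bex_def)
    then obtain c where c: "\<And>i. i < m \<Longrightarrow> c i \<in> ints" "\<And>i. i < m \<Longrightarrow> C i = residue (c i)"
      by metis
    have "\<pi> x = \<pi> (\<Oplus>\<^bsub>L\<^esub>i\<in>{..<m}. c i \<odot>\<^bsub>L\<^esub> bvec i)"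
      using comb[of c C] c C x by simp
    have "f x i - c i \<in> max_ideal" if "i < m" for i
    proof -
      define S where "S = (\<Oplus>\<^bsub>L\<^esub>i\<in>{..<m}. c i \<odot>\<^bsub>L\<^esub> bvec i)"
      have S: "S \<in> carrier L" "f S i = c i"
        unfolding S_def by (intro combination_closed f_combination c(1) that; assumption)+
      have "\<forall>i<m. f x i - f S i \<in> max_ideal"
        using \<open>\<pi> x = \<pi> (\<Oplus>\<^bsub>L\<^esub>i\<in>{..<m}. c i \<odot>\<^bsub>L\<^esub> bvec i)\<close> \<pi>_eq_iff[OF x(1) S(1)]
        unfolding S_def by (rule iffD1[rotated])
      then show ?thesis using S(2) that by auto
    qed
    then have "residue (f x i) = residue (c i)" if "i < m" for i
      using that by (simp add: residue_eq_iff)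
    then have "C i = (\<lambda>i\<in>{..<m}. residue (f x i)) i" if "i < m" for i
      using c(2) that by simp
    then show "C = (\<lambda>i\<in>{..<m}. residue (f x i))"
      using C by (intro PiE_eqI[of C "{..<m}" "carrier RF" _ UNIV]) auto
  qed
qed

lemma form_bvec: "x \<in> carrier L \<Longrightarrow> i < m \<Longrightarrow> form L x (bvec i) = a i * f x i"
  using form_unit_vec(1)[of "{..<m}" i a "f x"] f_props(5)[of x "bvec i"] by (simp add: bvec)

lemma form_lattice_Lbar: "form_lattice RF Lbar"
proof -
  interpret B: module RF Lbar by (rule module_Lbar)
  have ex: "\<exists>x\<in>carrier L. X = \<pi> x" if "X \<in> carrier Lbar" for X
    using that by (auto simp: Lbar_carrier)
  have exF: "\<exists>c\<in>ints. C = residue c" if "C \<in> carrier RF" for C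
    using that by (auto simp: RF_carrier)
  show ?thesis
  proof unfold_locales
    show "\<exists>n b. module_basis RF Lbar n b" using module_basis_Lbar by blast
  next
    fix X Y assume "X \<in> carrier Lbar" "Y \<in> carrier Lbar"
    then obtain x y where xy: "x \<in> carrier L" "X = \<pi> x" "y \<in> carrier L" "Y = \<pi> y" using ex by metis
    show "form Lbar X Y \<in> carrier RF" using xy by (simp add: Lbar_sel form_closed_L)
    show "form Lbar X Y = form Lbar Y X"
      using xy by (simp add: Lbar_sel f_props(5) mult.commute[of "f x _"])
    {
      fix Z assume "Z \<in> carrier Lbar"
      then obtain z where z: "z \<in> carrier L" "Z = \<pi> z" using ex by metis
      have "form L (x \<oplus>\<^bsub>L\<^esub> y) z = form L x z + form L y z"
        using xy z by (simp add: f_props(3,5) sum.distrib[symmetric] algebra_simps)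
      then show "form Lbar (X \<oplus>\<^bsub>Lbar\<^esub> Y) Z = form Lbar X Z \<oplus>\<^bsub>RF\<^esub> form Lbar Y Z"
        using xy z by (simp add: Lbar_sel form_closed_L)
    }
    fix C assume "C \<in> carrier RF"
    then obtain c where c: "c \<in> ints" "C = residue c" using exF by blast
    have "form L (c \<odot>\<^bsub>L\<^esub> x) y = c * form L x y"
      using xy c by (simp add: f_props(4,5) sum_distrib_left algebra_simps)
    then show "form Lbar (C \<odot>\<^bsub>Lbar\<^esub> X) Y = C \<otimes>\<^bsub>RF\<^esub> form Lbar X Y"
      using xy c by (simp add: Lbar_sel form_closed_L)
  next
    show "inj_on (form_map Lbar) (carrier Lbar)"
    proof (rule inj_onI)
      fix X Y assume XY: "X \<in> carrier Lbar" "Y \<in> carrier Lbar" "form_map Lbar X = form_map Lbar Y"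
      then obtain x y where xy: "x \<in> carrier L" "X = \<pi> x" "y \<in> carrier L" "Y = \<pi> y" using ex by metis
      have "f x i - f y i \<in> max_ideal" if i: "i < m" for i
      proof -
        have "form Lbar X (\<pi> (bvec i)) = form Lbar Y (\<pi> (bvec i))"
          using fun_cong[OF XY(3), of "\<pi> (bvec i)"] Lbar_sel(1)[OF bvec(1)] by (simp add: form_map_def)
        then have "a i * (f x i - f y i) \<in> max_ideal"
          using xy bvec i by (simp add: Lbar_sel form_bvec residue_eq_iff right_diff_distrib)
        then show ?thesis
          using max_ideal_prime[of "a i" "f x i - f y i"] unit_entries[OF i] xy i f_props(2) by (auto simp: val_unit_iff)
      qed
      then show "X = Y" using xy by (simp add: \<pi>_eq_iff)
    qed
  qed
qed

lemma val_unit_disc: "val_unit (prod a {..<m})"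
  by (rule val_unit_prod) (simp add: unit_entries)

text \<open>The orthogonal basis of \<open>L\<close> reduces to a basis whose Gram matrix is the reduced diagonal matrix.\<close>

lemma rank_sign_Lbar: "has_rank_sign RF Lbar m (sq_class (prod a {..<m}))"
  unfolding has_rank_sign_def
proof (intro exI[of _ "\<lambda>i. \<pi> (bvec i)"] conjI module_basis_Lbar)
  have "(\<lambda>i j. form Lbar (\<pi> (bvec i)) (\<pi> (bvec j))) = (\<lambda>i j. residue (form L (bvec i) (bvec j)))"
    by (simp add: Lbar_sel bvec)
  then have "det_of RF m (\<lambda>i j. form Lbar (\<pi> (bvec i)) (\<pi> (bvec j))) = residue (det (mat m m (\<lambda>(i, j). form L (bvec i) (bvec j))))"
    by (simp add: RF_det form_closed_L bvec)
  also have "mat m m (\<lambda>(i, j). form L (bvec i) (bvec j)) = mat m m (\<lambda>(i, j). if i = j then a i else 0)"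
    by (rule cong_mat) (auto simp: form_bvec bvec unit_vec_def)
  also have "det \<dots> = prod a {..<m}" by (rule det_diagonal)
  finally show "square_class RF (det_of RF m (\<lambda>i j. form Lbar (\<pi> (bvec i)) (\<pi> (bvec j)))) = sq_class (prod a {..<m})"
    using val_unit_disc by (simp add: square_class_RF)
qed

text \<open>The rank is determined by the number of elements, as the residue field is finite. A basis of the
  reduction lifts to vectors \<open>x\<close> of \<open>L\<close> whose matrix of coordinates \<open>A\<close> is invertible modulo the maximal
  ideal, so that the Gram determinant changes by the square of the unit \<open>det A\<close>.\<close>

lemma rank_sign_unique:
  assumes "has_rank_sign RF Lbar n \<epsilon>"
  shows "n = m" "\<epsilon> = sq_class (prod a {..<m})"
proof -
  obtain b where b: "module_basis RF Lbar n b"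
    "square_class RF (det_of RF n (\<lambda>i j. form Lbar (b i) (b j))) = \<epsilon>"
    using assms by (auto simp: has_rank_sign_def)
  \<comment> \<open>Two elements are needed to recover an exponent from a power of the size of the residue field.\<close>
  have "card {residue 0, residue 1} \<le> card (carrier RF)"
    by (rule card_mono[OF finite_RF]) auto
  moreover have "residue 0 \<noteq> residue 1" using max_ideal_minus[of "- 1"] by (auto simp: residue_eq_iff)
  ultimately have q: "2 \<le> card (carrier RF)" by simp
  have "card (carrier RF) ^ n = card (carrier RF) ^ m"
    using card_module_basis[OF module_Lbar b(1)] card_module_basis[OF module_Lbar module_basis_Lbar] by simp
  then show nm: "n = m" using q by (simp add: power_inject_exp)
  have bi: "b i \<in> carrier Lbar" if "i < m" for i
    using b(1) that by (auto simp: module_basis_def nm)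
  then have "\<forall>i. \<exists>x. i < m \<longrightarrow> x \<in> carrier L \<and> b i = \<pi> x"
    by (auto simp: Lbar_carrier image_iff Bex_def)
  then obtain x where x: "\<And>i. i < m \<Longrightarrow> x i \<in> carrier L" "\<And>i. i < m \<Longrightarrow> b i = \<pi> (x i)"
    by metis
  define A where "A = mat m m (\<lambda>(i, j). f (x i) j)"
  define G where "G = mat m m (\<lambda>(i, j). form L (x i) (x j))"
  have "G = mat m m (\<lambda>(l, k). \<Sum>t<m. f (x l) t * a t * f (x k) t)"
    unfolding G_def by (rule cong_mat) (auto simp: f_props(5) x mult_ac)
  then have detG: "det G = prod a {..<m} * (det A * det A)"
    by (simp add: det_diagonal_congruence A_def)
  have "\<exists>c. (\<forall>k<m. c k \<in> ints) \<and> (\<forall>i<m. f (bvec j) i - (\<Sum>k<m. c k * f (x k) i) \<in> max_ideal)" for j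
  proof -
    obtain C where C: "C \<in> {..<m} \<rightarrow>\<^sub>E carrier RF" "\<pi> (bvec j) = (\<Oplus>\<^bsub>Lbar\<^esub>k\<in>{..<m}. C k \<odot>\<^bsub>Lbar\<^esub> b k)"
    proof -
      have "\<forall>X \<in> carrier Lbar. \<exists>!C. C \<in> {..<m} \<rightarrow>\<^sub>E carrier RF \<and> X = (\<Oplus>\<^bsub>Lbar\<^esub>k\<in>{..<m}. C k \<odot>\<^bsub>Lbar\<^esub> b k)"
        using b(1) unfolding module_basis_def nm by (rule conjunct2)
      from bspec[OF this Lbar_sel(1)[OF bvec(1)[of j]], THEN ex1_implies_ex] show thesis
        using that by (elim exE conjE)
    qed
    from C(1) have "\<forall>k. \<exists>c. k < m \<longrightarrow> c \<in> ints \<and> C k = residue c"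
      by (auto simp: PiE_iff RF_carrier image_iff Bex_def)
    then obtain c where c: "\<And>k. k < m \<Longrightarrow> c k \<in> ints" "\<And>k. k < m \<Longrightarrow> C k = residue (c k)"
      by metis
    interpret B: module RF Lbar by (rule module_Lbar)
    have "\<pi> (bvec j) = (\<Oplus>\<^bsub>Lbar\<^esub>k\<in>{..<m}. residue (c k) \<odot>\<^bsub>Lbar\<^esub> \<pi> (x k))"
      unfolding C(2) using c x by (intro B.M.finsum_cong') (auto simp: Lbar_sel)
    also have "\<dots> = \<pi> (\<Oplus>\<^bsub>L\<^esub>k\<in>{..<m}. c k \<odot>\<^bsub>L\<^esub> x k)"
      using c x by (intro finsum_Lbar) auto
    finally have eq: "\<pi> (bvec j) = \<pi> (\<Oplus>\<^bsub>L\<^esub>k\<in>{..<m}. c k \<odot>\<^bsub>L\<^esub> x k)" .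
    have cl: "(\<Oplus>\<^bsub>L\<^esub>k\<in>{..<m}. c k \<odot>\<^bsub>L\<^esub> x k) \<in> carrier L"
      using c x by (intro L.M.finsum_closed) auto
    have "f (\<Oplus>\<^bsub>L\<^esub>k\<in>{..<m}. c k \<odot>\<^bsub>L\<^esub> x k) i = (\<Sum>k<m. c k * f (x k) i)" if "i < m" for i
      using c x that by (intro f_finsum) auto
    then show ?thesis using eq c(1) \<pi>_eq_iff[OF bvec(1) cl] by auto
  qed
  then obtain B where B: "\<And>j k. k < m \<Longrightarrow> B j k \<in> ints"
    "\<And>j i. i < m \<Longrightarrow> f (bvec j) i - (\<Sum>k<m. B j k * f (x k) i) \<in> max_ideal"
    by metis
  define B' where "B' = mat m m (\<lambda>(j, k). B j k)"
  have carr: "A \<in> carrier_mat m m" "B' \<in> carrier_mat m m" by (simp_all add: A_def B'_def)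
  have "det (1\<^sub>m m) - det (B' * A) \<in> max_ideal"
  proof (rule det_cong_max_ideal)
    fix j i assume ji: "j < m" "i < m"
    have "(B' * A) $$ (j, i) = (\<Sum>k<m. B j k * f (x k) i)"
      using ji by (simp add: B'_def A_def scalar_prod_def atLeast0LessThan)
    moreover have "(1\<^sub>m m) $$ (j, i) = f (bvec j) i"
      using ji by (auto simp: bvec unit_vec_def)
    ultimately show "(1\<^sub>m m) $$ (j, i) - (B' * A) $$ (j, i) \<in> max_ideal" using B(2)[OF ji(2)] by simp
  qed (use carr in auto)
  then have "1 - det B' * det A \<in> max_ideal"
    using det_mult[OF carr(2,1)] by simp
  then have "val_unit (det B' * det A)" using val_unit_cong val_unit_simps(1) by blast
  moreover have "det A \<in> ints" "det B' \<in> ints"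
    using B(1) f_props(2) x by (auto intro!: det_ints[of _ m] simp: A_def B'_def)
  ultimately have uA: "val_unit (det A)" using val_unit_multD by blast
  have uG: "val_unit (det G)"
    unfolding detG using uA val_unit_disc by simp
  have "det_of RF m (\<lambda>i j. form Lbar (b i) (b j)) = det_of RF m (\<lambda>i j. residue (form L (x i) (x j)))"
    by (rule det_of_cong[OF cring_RF]) (simp_all add: x Lbar_sel form_closed_L)
  also have "\<dots> = residue (det G)"
    unfolding G_def by (rule RF_det) (use x form_closed_L in auto)
  finally have "\<epsilon> = sq_class (det G)"
    using b(2) uG by (simp add: nm square_class_RF)
  also have "\<dots> = sq_class (prod a {..<m})"
    unfolding detG using uA by (intro sq_class_mult_square) (simp add: val_unit_nonzero)
  finally show "\<epsilon> = sq_class (prod a {..<m})" .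
qed

end

context odd_henselian
begin

section \<open>The lattices of given rank and sign\<close>

lemma form_lattice_diag:
  fixes n :: nat
  assumes a: "\<And>i. i < n \<Longrightarrow> a i \<in> ints \<and> a i \<noteq> 0"
  shows "form_lattice (val_ring v) (diag_lattice {..<n} a)"
proof -
  interpret module "val_ring v" "diag_lattice {..<n} a" by (rule module_diag_lattice)
  show ?thesis
  proof unfold_locales
    show "\<exists>k b. module_basis (val_ring v) (diag_lattice {..<n} a) k b"
      unfolding diag_lattice_def by (intro exI) (rule module_basis_free_lattice)
  next
    show "inj_on (form_map (diag_lattice {..<n} a)) (carrier (diag_lattice {..<n} a))"
    proof (rule inj_onI)
      fix x y assume x: "x \<in> carrier (diag_lattice {..<n} a)" and y: "y \<in> carrier (diag_lattice {..<n} a)"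
        and eq: "form_map (diag_lattice {..<n} a) x = form_map (diag_lattice {..<n} a) y"
      have "x i = y i" if "i < n" for i
      proof -
        have "form (diag_lattice {..<n} a) x (unit_vec {..<n} i) = form (diag_lattice {..<n} a) y (unit_vec {..<n} i)"
          using fun_cong[OF eq, of "unit_vec {..<n} i"] by (simp add: form_map_def)
        then have "a i * x i = a i * y i"
          using that by (simp only: form_unit_vec(1) finite_lessThan lessThan_iff)
        then show ?thesis using a that by simp
      qed
      then show "x = y"
        using x y by (intro PiE_eqI[of x "{..<n}" ints y ints]) auto
    qed
  next
    fix x y assume "x \<in> carrier (diag_lattice {..<n} a)" "y \<in> carrier (diag_lattice {..<n} a)"
    then have "x i \<in> ints" "y i \<in> ints" if "i < n" for i using that by auto
    then show "form (diag_lattice {..<n} a) x y \<in> carrier (val_ring v)"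
      using a by (simp only: diag_lattice_sel) (intro ints_sum ints_mult, auto)
  qed (auto simp: algebra_simps sum.distrib[symmetric] sum_distrib_left intro!: sum.cong)
qed

text \<open>A functional \<open>\<phi>\<close> is represented by the vector with coordinates \<open>\<phi> b\<^sub>i / a\<^sub>i\<close>.\<close>

lemma unimodular_diag:
  fixes n :: nat
  assumes a: "\<And>i. i < n \<Longrightarrow> val_unit (a i)"
  shows "unimodular (val_ring v) (diag_lattice {..<n} a)"
proof -
  let ?D = "diag_lattice {..<n} a"
  have L: "form_lattice (val_ring v) ?D"
    using a by (intro form_lattice_diag) (simp add: val_unit_nonzero)
  interpret form_lattice "val_ring v" ?D by (rule L)
  have dual: "form_map ?D z \<in> module_dual (val_ring v) ?D" if z: "z \<in> carrier ?D" for z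
    unfolding module_dual_def form_map_def
  proof (intro CollectI conjI ballI)
    show "(\<lambda>y\<in>carrier ?D. form ?D z y) \<in> carrier ?D \<rightarrow>\<^sub>E carrier (val_ring v)"
      using form_closed[OF z] by (intro restrict_PiE_iff[THEN iffD2]) blast
    fix x y assume x: "x \<in> carrier ?D" and y: "y \<in> carrier ?D"
    have "form ?D z (x \<oplus>\<^bsub>?D\<^esub> y) = form ?D z x + form ?D z y"
      by (simp add: sum.distrib[symmetric] algebra_simps)
    then show "(\<lambda>y\<in>carrier ?D. form ?D z y) (x \<oplus>\<^bsub>?D\<^esub> y) =
        (\<lambda>y\<in>carrier ?D. form ?D z y) x \<oplus>\<^bsub>val_ring v\<^esub> (\<lambda>y\<in>carrier ?D. form ?D z y) y"
      using x y M.a_closed[OF x y] by (simp only: restrict_apply' val_ring_sel)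
  next
    fix c x assume c: "c \<in> ints" and x: "x \<in> carrier ?D"
    show "(\<lambda>y\<in>carrier ?D. form ?D z y) (c \<odot>\<^bsub>?D\<^esub> x) = c \<otimes>\<^bsub>val_ring v\<^esub> (\<lambda>y\<in>carrier ?D. form ?D z y) x"
      using form_smult_right[OF L c z x] x smult_closed[OF c x] by (simp only: restrict_apply' val_ring_sel)
  qed
  have onto: "\<exists>z\<in>carrier ?D. form_map ?D z = \<phi>" if \<phi>: "\<phi> \<in> module_dual (val_ring v) ?D" for \<phi>
  proof -
    have \<phi>c: "\<phi> x \<in> ints" if "x \<in> carrier ?D" for x
      using \<phi> that unfolding module_dual_def by (blast dest: PiE_mem)
    have \<phi>a: "\<phi> (x \<oplus>\<^bsub>?D\<^esub> y) = \<phi> x \<oplus>\<^bsub>val_ring v\<^esub> \<phi> y" if "x \<in> carrier ?D" "y \<in> carrier ?D" for x y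
      using \<phi> that unfolding module_dual_def by blast
    have \<phi>s: "\<phi> (c \<odot>\<^bsub>?D\<^esub> x) = c * \<phi> x" if "c \<in> ints" "x \<in> carrier ?D" for c x
      using \<phi> that unfolding module_dual_def by simp
    have ue: "unit_vec {..<n} i \<in> carrier ?D" for i by simp
    define z where "z = (\<lambda>i\<in>{..<n}. \<phi> (unit_vec {..<n} i) / a i)"
    have zi: "z i \<in> ints" if "i < n" for i
    proof -
      have "\<phi> (unit_vec {..<n} i) * inverse (a i) \<in> ints"
        using \<phi>c[OF ue[of i]] val_unit_ints[OF val_unit_simps(3)[OF a[OF that]]] by (rule ints_mult)
      then show ?thesis using that by (simp add: z_def divide_inverse)
    qed
    then have z: "z \<in> carrier ?D" by (auto simp: z_def)
    have "form ?D z y = \<phi> y" if y: "y \<in> carrier ?D" for y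
    proof -
      have yi: "y i \<in> ints" if "i < n" for i using y that by auto
      have "(\<Oplus>\<^bsub>?D\<^esub>i\<in>{..<n}. y i \<odot>\<^bsub>?D\<^esub> unit_vec {..<n} i) = y"
        using unit_vec_expansion[of "{..<n}" y] y unfolding diag_lattice_def by simp
      then have "\<phi> y = \<phi> (\<Oplus>\<^bsub>?D\<^esub>i\<in>{..<n}. y i \<odot>\<^bsub>?D\<^esub> unit_vec {..<n} i)" by simp
      also have "\<dots> = (\<Oplus>\<^bsub>val_ring v\<^esub>i\<in>{..<n}. \<phi> (y i \<odot>\<^bsub>?D\<^esub> unit_vec {..<n} i))"
      proof (rule finsum_hom[where h = \<phi> and f = "\<lambda>i. y i \<odot>\<^bsub>?D\<^esub> unit_vec {..<n} i"])
        show "abelian_group ?D" by (rule M.abelian_group_axioms)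
        show "abelian_group (val_ring v)" by (rule R.abelian_group_axioms)
        show "(\<lambda>i. y i \<odot>\<^bsub>?D\<^esub> unit_vec {..<n} i) \<in> {..<n} \<rightarrow> carrier ?D"
          using smult_closed[OF yi ue] by (blast intro: Pi_I)
      qed (use \<phi>c \<phi>a in blast)+
      also have "\<dots> = (\<Sum>i<n. \<phi> (y i \<odot>\<^bsub>?D\<^esub> unit_vec {..<n} i))"
        using \<phi>c[OF smult_closed[OF yi ue]] by (intro finsum_val_ring) blast
      also have "\<dots> = (\<Sum>i<n. a i * (z i * y i))"
        using \<phi>s[OF yi ue] a by (intro sum.cong) (simp_all add: z_def val_unit_nonzero)
      finally show ?thesis by simp
    qed
    moreover have "\<phi> \<in> carrier ?D \<rightarrow>\<^sub>E ints"
      using \<phi> unfolding module_dual_def by blast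
    ultimately have eq: "form_map ?D z y = \<phi> y" for y
    proof (cases "y \<in> carrier ?D")
      case True
      then show ?thesis
        using \<open>\<And>y. y \<in> carrier ?D \<Longrightarrow> form ?D z y = \<phi> y\<close>[OF True] by (simp only: form_map_def restrict_apply')
    next
      case False
      then show ?thesis
        using PiE_arb[OF \<open>\<phi> \<in> carrier ?D \<rightarrow>\<^sub>E ints\<close> False] by (simp only: form_map_def restrict_apply if_False)
    qed
    have "form_map ?D z = \<phi>" by (rule ext) (rule eq)
    then show ?thesis using z by blast
  qed
  have "form_map ?D ` carrier ?D = module_dual (val_ring v) ?D"
    using dual onto by (intro equalityI subsetI) (auto simp del: diag_lattice_sel)
  then show ?thesis
    unfolding unimodular_def bij_betw_def using nondegenerate by (intro conjI)
qed

lemma isometry_id: "isometry A M M (\<lambda>x. x)"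
  by (simp add: isometry_def bij_betw_def)

lemma is_unit_lattice_diag:
  assumes "1 \<le> n" "\<epsilon> \<in> {1, - 1}"
  shows "is_unit_lattice v n \<epsilon> (diag_lattice {..<n} (unit_diag 0 \<epsilon>))"
proof -
  have u: "val_unit (unit_diag 0 \<epsilon> i)" for i :: nat
    by (simp add: unit_diag_def sign_unit)
  interpret D: diagonalized_lattice v "diag_lattice {..<n} (unit_diag 0 \<epsilon>)" n "unit_diag 0 \<epsilon>" "\<lambda>x. x"
    by (intro diagonalized_lattice.intro odd_henselian_axioms diagonalized_lattice_axioms.intro
        module_diag_lattice isometry_id u)
  have "sq_class (prod (unit_diag 0 \<epsilon>) {..<n}) = \<epsilon>"
    using assms by (intro unit_diag(2)) auto
  then show ?thesis
    unfolding is_unit_lattice_def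
    using u D.form_lattice_Lbar D.rank_sign_Lbar form_lattice_diag[of n "unit_diag 0 \<epsilon>"]
      unimodular_diag[of n "unit_diag 0 \<epsilon>"]
    by (simp add: val_unit_nonzero)
qed

text \<open>Take an orthogonal basis of \<open>L\<close>. By unimodularity the \<open>i\<close>-th coordinate functional is represented by
  some \<open>z\<close>; applied to the \<open>i\<close>-th basis vector this gives \<open>a\<^sub>i z\<^sub>i = 1\<close>. So all norms are units, and
  rank and sign determine the normal form of the diagonal.\<close>

lemma is_unit_lattice_isometric:
  fixes L :: "('k, 'b, 'y) form_module_scheme"
  assumes L: "is_unit_lattice v n \<epsilon> L" and n: "1 \<le> n"
  shows "isometric (val_ring v) L (diag_lattice {..<n} (unit_diag 0 \<epsilon>))"
proof -
  have lat: "form_lattice (val_ring v) L" and uni: "unimodular (val_ring v) L"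
    and rs: "has_rank_sign RF (reduction (val_ring v) max_ideal L) n \<epsilon>"
    using L by (auto simp: is_unit_lattice_def)
  interpret form_lattice "val_ring v" L by (rule lat)
  obtain m :: nat and a where ma: "isometric (val_ring v) L (diag_lattice {..<m} a)"
    "\<And>i. i < m \<Longrightarrow> a i \<in> ints \<and> a i \<noteq> 0"
    using lattice_isometric_diag[OF lat] by metis
  then obtain f where f: "isometry (val_ring v) L (diag_lattice {..<m} a) f"
    by (auto simp: isometric_iff)
  have a: "val_unit (a i)" if i: "i < m" for i
  proof -
    have fi: "f x \<in> {..<m} \<rightarrow>\<^sub>E ints" "f x i \<in> ints" if "x \<in> carrier L" for x
      using isometryD(2)[OF f that] i by auto
    have "(\<lambda>x\<in>carrier L. f x i) \<in> module_dual (val_ring v) L"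
      unfolding module_dual_def using fi i by (auto simp: isometryD(3,4)[OF f])
    then obtain z where z: "z \<in> carrier L" "form_map L z = (\<lambda>x\<in>carrier L. f x i)"
      using uni unfolding unimodular_def bij_betw_def by (metis imageE)
    obtain x where x: "x \<in> carrier L" "f x = unit_vec {..<m} i"
      using bij_betw_imp_surj_on[OF isometryD(1)[OF f]] unit_vec_closed[of "{..<m}" i]
      by (metis diag_lattice_sel(1) imageE)
    have "form L z x = f x i"
      using fun_cong[OF z(2), of x] x by (simp add: form_map_def)
    also have "f x i = 1" using x i by (simp add: unit_vec_def)
    finally have "form (diag_lattice {..<m} a) (f z) (unit_vec {..<m} i) = 1"
      using isometryD(5)[OF f z(1) x(1)] x by simp
    then have "a i * f z i = 1"
      using i by (simp only: form_unit_vec(1) finite_lessThan lessThan_iff)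
    then show "val_unit (a i)"
      using val_unit_multD[of "a i" "f z i"] ma(2)[OF i] fi(2)[OF z(1)] by simp
  qed
  interpret D: diagonalized_lattice v L m a f
    by (intro diagonalized_lattice.intro odd_henselian_axioms diagonalized_lattice_axioms.intro
        module_axioms f a)
  have nm: "n = m" and e: "\<epsilon> = sq_class (prod a {..<m})"
    using D.rank_sign_unique[OF rs] by auto
  have "isometric (val_ring v) (diag_lattice {..<m} a) (diag_lattice {..<m} (unit_diag 0 (sq_class (prod a {..<m}))))"
    using n nm a by (intro isometric_unit_diag) auto
  with ma(1) show ?thesis unfolding nm e by (rule isometric_trans)
qed

text \<open>By the diagonal model, the class of lattices from which \<open>1\<^sup>\<epsilon>\<^sup>n\<close> is chosen is not empty.\<close>

lemma unit_lattice_isometric: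
  assumes "1 \<le> n" "\<epsilon> \<in> {1, - 1}"
  shows "isometric (val_ring v) (diag_lattice {..<n} (unit_diag 0 \<epsilon>)) (unit_lattice v n \<epsilon>)"
proof -
  have U: "is_unit_lattice v n \<epsilon> (unit_lattice v n \<epsilon>)"
    unfolding unit_lattice_def using is_unit_lattice_diag[OF assms] by (rule someI)
  then have "module (val_ring v) (unit_lattice v n \<epsilon>)"
    by (simp add: is_unit_lattice_def form_lattice_def)
  then show ?thesis
    using is_unit_lattice_isometric[OF U assms(1)] by (rule isometric_sym)
qed

section \<open>Jordan decompositions\<close>

text \<open>The Jordan lattice of a symbol is isometric to a diagonal lattice. Its basis vectors are indexed by pairs
  of a value and a position in the block of this value.\<close>

definition symbol_index :: "('g \<rightharpoonup> nat \<times> int) \<Rightarrow> ('g \<times> nat) set" where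
  "symbol_index s = (SIGMA \<gamma>:dom s. {..<fst (the (s \<gamma>))})"

definition symbol_diag :: "('g \<Rightarrow> 'k) \<Rightarrow> ('g \<rightharpoonup> nat \<times> int) \<Rightarrow> 'g \<times> nat \<Rightarrow> 'k" where
  "symbol_diag \<sigma> s p = \<sigma> (fst p) * unit_diag 0 (snd (the (s (fst p)))) (snd p)"

lemma symbol_diag_props:
  assumes \<sigma>: "\<And>\<gamma>. 0 \<le> \<gamma> \<Longrightarrow> \<sigma> \<gamma> \<noteq> 0 \<and> v (\<sigma> \<gamma>) = \<gamma>" and s: "jordan_symbol s" and p: "fst p \<in> dom s"
  shows "symbol_diag \<sigma> s p \<in> ints" "symbol_diag \<sigma> s p \<noteq> 0" "v (symbol_diag \<sigma> s p) = fst p"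
proof -
  have "0 \<le> fst p" using s p by (auto simp: jordan_symbol_def)
  moreover have "val_unit (unit_diag 0 (snd (the (s (fst p)))) (snd p))"
    by (simp add: unit_diag_def sign_unit)
  ultimately show "symbol_diag \<sigma> s p \<in> ints" "symbol_diag \<sigma> s p \<noteq> 0" "v (symbol_diag \<sigma> s p) = fst p"
    using \<sigma>[of "fst p"] by (auto simp: symbol_diag_def val_unit_def val_mult ints_iff)
qed

lemma jordan_lattice_isometric:
  assumes \<sigma>: "\<And>\<gamma>. 0 \<le> \<gamma> \<Longrightarrow> \<sigma> \<gamma> \<noteq> 0 \<and> v (\<sigma> \<gamma>) = \<gamma>" and s: "jordan_symbol s"
  shows "isometric (val_ring v) (diag_lattice (symbol_index s) (symbol_diag \<sigma> s)) (jordan_lattice v \<sigma> s)"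
proof -
  let ?N = "\<lambda>\<gamma>. {..<fst (the (s \<gamma>))}" and ?L = "\<lambda>\<gamma>. case the (s \<gamma>) of (n, \<epsilon>) \<Rightarrow> scale_form (val_ring v) (\<sigma> \<gamma>) (unit_lattice v n \<epsilon>)"
  have fin: "finite (dom s)" using s by (simp add: jordan_symbol_def)
  have "isometric (val_ring v) (diag_lattice (symbol_index s) (symbol_diag \<sigma> s))
      (orthogonal_sum (val_ring v) (dom s) (\<lambda>\<gamma>. diag_lattice (?N \<gamma>) (\<lambda>i. symbol_diag \<sigma> s (\<gamma>, i))))"
    unfolding symbol_index_def
    by (rule isometric_diag_Sigma) (use fin symbol_diag_props(1)[OF \<sigma> s] in auto)
  moreover have "isometric (val_ring v)
      (orthogonal_sum (val_ring v) (dom s) (\<lambda>\<gamma>. diag_lattice (?N \<gamma>) (\<lambda>i. symbol_diag \<sigma> s (\<gamma>, i))))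
      (orthogonal_sum (val_ring v) (dom s) ?L)"
  proof (rule isometric_orthogonal_sum[OF cring_val_ring])
    fix \<gamma> assume \<gamma>: "\<gamma> \<in> dom s"
    then obtain n \<epsilon> where ne: "s \<gamma> = Some (n, \<epsilon>)" by auto
    have n: "1 \<le> n" "\<epsilon> \<in> {1, - 1}" using s ne unfolding jordan_symbol_def by blast+
    have "diag_lattice (?N \<gamma>) (\<lambda>i. symbol_diag \<sigma> s (\<gamma>, i)) =
        scale_form (val_ring v) (\<sigma> \<gamma>) (diag_lattice {..<n} (unit_diag 0 \<epsilon>))"
      by (simp add: scale_diag_lattice ne symbol_diag_def)
    moreover have "isometric (val_ring v) (scale_form (val_ring v) (\<sigma> \<gamma>) (diag_lattice {..<n} (unit_diag 0 \<epsilon>)))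
        (scale_form (val_ring v) (\<sigma> \<gamma>) (unit_lattice v n \<epsilon>))"
      by (intro isometric_scale_form unit_lattice_isometric n)
    ultimately show "isometric (val_ring v) (diag_lattice (?N \<gamma>) (\<lambda>i. symbol_diag \<sigma> s (\<gamma>, i))) (?L \<gamma>)"
      by (simp add: ne)
    fix x y assume "x \<in> carrier (diag_lattice (?N \<gamma>) (\<lambda>i. symbol_diag \<sigma> s (\<gamma>, i)))"
      "y \<in> carrier (diag_lattice (?N \<gamma>) (\<lambda>i. symbol_diag \<sigma> s (\<gamma>, i)))"
    then have "x i \<in> ints" "y i \<in> ints" if "i \<in> ?N \<gamma>" for i using that by auto
    moreover have "symbol_diag \<sigma> s (\<gamma>, i) \<in> ints" for i
      using symbol_diag_props(1)[OF \<sigma> s, of "(\<gamma>, i)"] \<gamma> by simp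
    ultimately show "form (diag_lattice (?N \<gamma>) (\<lambda>i. symbol_diag \<sigma> s (\<gamma>, i))) x y \<in> carrier (val_ring v)"
      by (simp only: diag_lattice_sel) (intro ints_sum ints_mult, auto)
  qed
  ultimately show ?thesis
    unfolding jordan_lattice_def by (rule isometric_trans)
qed

lemma isometric_diag_blocks:
  assumes S: "finite S" "\<And>\<gamma>. \<gamma> \<in> S \<Longrightarrow> finite (N \<gamma>)" "\<And>\<gamma>. \<gamma> \<in> S \<Longrightarrow> finite (N' \<gamma>)"
    and a: "\<And>\<gamma> i. \<gamma> \<in> S \<Longrightarrow> i \<in> N \<gamma> \<Longrightarrow> a (\<gamma>, i) \<in> ints" "\<And>\<gamma> i. \<gamma> \<in> S \<Longrightarrow> i \<in> N' \<gamma> \<Longrightarrow> a' (\<gamma>, i) \<in> ints"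
    and iso: "\<And>\<gamma>. \<gamma> \<in> S \<Longrightarrow> isometric (val_ring v) (diag_lattice (N \<gamma>) (\<lambda>i. a (\<gamma>, i))) (diag_lattice (N' \<gamma>) (\<lambda>i. a' (\<gamma>, i)))"
  shows "isometric (val_ring v) (diag_lattice (Sigma S N) a) (diag_lattice (Sigma S N') a')"
proof -
  let ?O = "orthogonal_sum (val_ring v) S (\<lambda>\<gamma>. diag_lattice (N \<gamma>) (\<lambda>i. a (\<gamma>, i)))"
    and ?O' = "orthogonal_sum (val_ring v) S (\<lambda>\<gamma>. diag_lattice (N' \<gamma>) (\<lambda>i. a' (\<gamma>, i)))"
  have "isometric (val_ring v) (diag_lattice (Sigma S N) a) ?O"
    by (rule isometric_diag_Sigma) (use S a in auto)
  moreover have "isometric (val_ring v) ?O ?O'"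
  proof (rule isometric_orthogonal_sum[OF cring_val_ring iso])
    fix \<gamma> x y assume \<gamma>: "\<gamma> \<in> S" and "x \<in> carrier (diag_lattice (N \<gamma>) (\<lambda>i. a (\<gamma>, i)))"
      "y \<in> carrier (diag_lattice (N \<gamma>) (\<lambda>i. a (\<gamma>, i)))"
    then have "x i \<in> ints" "y i \<in> ints" if "i \<in> N \<gamma>" for i using that by auto
    then show "form (diag_lattice (N \<gamma>) (\<lambda>i. a (\<gamma>, i))) x y \<in> carrier (val_ring v)"
      using a(1)[OF \<gamma>] by (simp only: diag_lattice_sel) (intro ints_sum ints_mult, auto)
  qed
  moreover have "isometric (val_ring v) ?O' (diag_lattice (Sigma S N') a')"
    by (intro isometric_sym[OF module_diag_lattice] isometric_diag_Sigma) (use S a in auto)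
  ultimately show ?thesis by (blast intro: isometric_trans)
qed

text \<open>Sort an orthogonal basis by the values of the norms and put every block into its normal form.\<close>

lemma jordan_decomposition_exists:
  fixes M :: "('k, 'b, 'y) form_module_scheme"
  assumes \<sigma>: "\<And>\<gamma>. 0 \<le> \<gamma> \<Longrightarrow> \<sigma> \<gamma> \<noteq> 0 \<and> v (\<sigma> \<gamma>) = \<gamma>" and M: "form_lattice (val_ring v) M"
  obtains s where "jordan_symbol s" "isometric (val_ring v) M (jordan_lattice v \<sigma> s)"
proof -
  obtain n :: nat and a where iso: "isometric (val_ring v) M (diag_lattice {..<n} a)"
    and a: "\<And>i. i < n \<Longrightarrow> a i \<in> ints \<and> a i \<noteq> 0"
    using lattice_isometric_diag[OF M] by metis
  define S where "S = (\<lambda>i. v (a i)) ` {..<n}"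
  define N where "N \<gamma> = {i \<in> {..<n}. v (a i) = \<gamma>}" for \<gamma>
  define k where "k \<gamma> = card (N \<gamma>)" for \<gamma>
  define \<epsilon> where "\<epsilon> \<gamma> = sq_class (\<Prod>i\<in>N \<gamma>. a i / \<sigma> \<gamma>)" for \<gamma>
  define s where "s = (\<lambda>\<gamma>. if \<gamma> \<in> S then Some (k \<gamma>, \<epsilon> \<gamma>) else None)"
  have dom: "dom s = S" by (auto simp: s_def dom_def split: if_splits)
  have finN: "finite (N \<gamma>)" for \<gamma> by (simp add: N_def)
  have S: "finite S" "0 \<le> \<gamma>" "1 \<le> k \<gamma>" if \<gamma>: "\<gamma> \<in> S" for \<gamma>
  proof -
    obtain i where i: "i < n" "\<gamma> = v (a i)" using \<gamma> by (auto simp: S_def)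
    then show "0 \<le> \<gamma>" using a[OF i(1)] by (auto simp: ints_iff)
    have "N \<gamma> \<noteq> {}" using i by (auto simp: N_def)
    then show "1 \<le> k \<gamma>" using finN by (simp add: k_def Suc_le_eq card_gt_0_iff)
  qed (simp add: S_def)
  have symb: "jordan_symbol s"
    unfolding jordan_symbol_def dom using S sq_class_range by (auto simp: s_def \<epsilon>_def S_def split: if_splits)
  have "bij_betw snd (Sigma S N) {..<n}"
    by (rule bij_betw_byWitness[of _ "\<lambda>i. (v (a i), i)"]) (auto simp: S_def N_def)
  then have "isometric (val_ring v) (diag_lattice {..<n} a) (diag_lattice (Sigma S N) (\<lambda>p. a (snd p)))"
    by (rule isometric_diag_reindex)
  moreover have "isometric (val_ring v) (diag_lattice (Sigma S N) (\<lambda>p. a (snd p)))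
      (diag_lattice (symbol_index s) (symbol_diag \<sigma> s))"
    unfolding symbol_index_def dom
  proof (rule isometric_diag_blocks)
    fix \<gamma> assume \<gamma>: "\<gamma> \<in> S"
    then have s\<gamma>: "s \<gamma> = Some (k \<gamma>, \<epsilon> \<gamma>)" by (simp add: s_def)
    note \<sigma>\<gamma> = \<sigma>[OF S(2)[OF \<gamma>]]
    obtain h where h: "bij_betw h {..<k \<gamma>} (N \<gamma>)"
      using ex_bij_betw_nat_finite[OF finN[of \<gamma>]] by (auto simp: k_def atLeast0LessThan)
    define b where "b i = a (h i) / \<sigma> \<gamma>" for i
    have "val_unit (b i)" if "i < k \<gamma>" for i
      using bij_betw_apply[OF h, of i] that a \<sigma>\<gamma> by (auto simp: b_def N_def val_unit_def val_divide)
    moreover have "prod b {..<k \<gamma>} = (\<Prod>i\<in>N \<gamma>. a i / \<sigma> \<gamma>)"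
      unfolding b_def by (rule prod.reindex_bij_betw[OF h])
    ultimately have "isometric (val_ring v) (diag_lattice {..<k \<gamma>} b) (diag_lattice {..<k \<gamma>} (unit_diag 0 (\<epsilon> \<gamma>)))"
      using isometric_unit_diag[of "{..<k \<gamma>}" 0 b] S(3)[OF \<gamma>] by (simp add: \<epsilon>_def)
    then have "isometric (val_ring v) (scale_form (val_ring v) (\<sigma> \<gamma>) (diag_lattice {..<k \<gamma>} b))
        (scale_form (val_ring v) (\<sigma> \<gamma>) (diag_lattice {..<k \<gamma>} (unit_diag 0 (\<epsilon> \<gamma>))))"
      by (rule isometric_scale_form)
    then have "isometric (val_ring v) (diag_lattice {..<k \<gamma>} (\<lambda>i. a (h i)))
        (diag_lattice {..<k \<gamma>} (\<lambda>i. \<sigma> \<gamma> * unit_diag 0 (\<epsilon> \<gamma>) i))"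
      using \<sigma>\<gamma> by (simp add: scale_diag_lattice b_def)
    with isometric_diag_reindex[OF h, of a]
    have "isometric (val_ring v) (diag_lattice (N \<gamma>) a) (diag_lattice {..<k \<gamma>} (\<lambda>i. \<sigma> \<gamma> * unit_diag 0 (\<epsilon> \<gamma>) i))"
      by (rule isometric_trans)
    then show "isometric (val_ring v) (diag_lattice (N \<gamma>) (\<lambda>i. a (snd (\<gamma>, i))))
        (diag_lattice {..<fst (the (s \<gamma>))} (\<lambda>i. symbol_diag \<sigma> s (\<gamma>, i)))"
      by (simp add: s\<gamma> symbol_diag_def)
  next
    fix \<gamma> i assume "\<gamma> \<in> S"
    then show "symbol_diag \<sigma> s (\<gamma>, i) \<in> ints"
      using symbol_diag_props(1)[OF \<sigma> symb, of "(\<gamma>, i)"] by (simp add: dom)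
  qed (use a finN in \<open>auto simp: S_def N_def\<close>)
  moreover have "isometric (val_ring v) (diag_lattice (symbol_index s) (symbol_diag \<sigma> s)) (jordan_lattice v \<sigma> s)"
    by (rule jordan_lattice_isometric[OF \<sigma> symb])
  ultimately have "isometric (val_ring v) M (jordan_lattice v \<sigma> s)"
    using iso by (blast intro: isometric_trans)
  with symb that show thesis by blast
qed

text \<open>By invariance under isometries this can be read off the diagonal model of the Jordan lattice.\<close>

lemma gram_class_jordan:
  fixes M :: "('k, 'b, 'y) form_module_scheme"
  assumes \<sigma>: "\<And>\<gamma>. 0 \<le> \<gamma> \<Longrightarrow> \<sigma> \<gamma> \<noteq> 0 \<and> v (\<sigma> \<gamma>) = \<gamma>" and M: "module (val_ring v) M"
    and s: "jordan_symbol s" and iso: "isometric (val_ring v) M (jordan_lattice v \<sigma> s)" and \<gamma>: "0 \<le> \<gamma>"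
  shows "s \<gamma> = Some (n, \<epsilon>) \<Longrightarrow> gram_class M (\<sigma> \<gamma>) n \<epsilon>"
    and "s \<gamma> = Some (n, \<epsilon>) \<Longrightarrow> gram_class M (\<sigma> \<gamma>) k \<delta> \<Longrightarrow> n \<le> k \<Longrightarrow> k = n \<and> \<delta> = \<epsilon>"
    and "s \<gamma> = None \<Longrightarrow> gram_class M (\<sigma> \<gamma>) k \<delta> \<Longrightarrow> k = 0"
proof -
  let ?I = "symbol_index s" and ?a = "symbol_diag \<sigma> s"
  have DJ: "isometric (val_ring v) (diag_lattice ?I ?a) (jordan_lattice v \<sigma> s)"
    by (rule jordan_lattice_isometric[OF \<sigma> s])
  have DM: "isometric (val_ring v) (diag_lattice ?I ?a) M"
    by (rule isometric_trans[OF DJ isometric_sym[OF M iso]])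
  have MD: "isometric (val_ring v) M (diag_lattice ?I ?a)"
    by (rule isometric_trans[OF iso isometric_sym[OF module_diag_lattice DJ]])
  have fin: "finite ?I" using s by (auto simp: symbol_index_def jordan_symbol_def)
  have aI: "?a p \<in> ints \<and> ?a p \<noteq> 0" and va: "v (?a p) = fst p" if "p \<in> ?I" for p
  proof -
    have "fst p \<in> dom s" using that unfolding symbol_index_def by auto
    then show "?a p \<in> ints \<and> ?a p \<noteq> 0" "v (?a p) = fst p"
      using symbol_diag_props[OF \<sigma> s, of p] by blast+
  qed
  note \<sigma>\<gamma> = \<sigma>[OF \<gamma>]
  define J where "J = {p \<in> ?I. v (?a p) = v (\<sigma> \<gamma>)}"
  have J: "J = {p \<in> ?I. fst p = \<gamma>}" using va \<sigma>\<gamma> by (auto simp: J_def)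
  have gc1: "gram_class (diag_lattice ?I ?a) (\<sigma> \<gamma>) (card J) (sq_class (\<Prod>p\<in>J. ?a p / \<sigma> \<gamma>))"
    unfolding J_def using fin aI \<sigma>\<gamma> by (intro gram_class_diag(1)) auto
  have gc2: "k = card J \<and> \<delta> = sq_class (\<Prod>p\<in>J. ?a p / \<sigma> \<gamma>)"
    if "gram_class M (\<sigma> \<gamma>) k \<delta>" "card J \<le> k" for k \<delta>
    unfolding J_def
  proof (rule gram_class_diag(2)[OF fin aI conjunct1[OF \<sigma>\<gamma>]])
    show "gram_class (diag_lattice ?I ?a) (\<sigma> \<gamma>) k \<delta>" by (rule gram_class_isometric[OF MD that(1)])
  qed (use that(2) in \<open>simp_all add: J_def\<close>)
  {
    assume sg: "s \<gamma> = Some (n, \<epsilon>)"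
    then have n: "1 \<le> n" "\<epsilon> \<in> {1, - 1}" using s unfolding jordan_symbol_def by blast+
    have Jeq: "J = Pair \<gamma> ` {..<n}" using sg by (auto simp: J symbol_index_def)
    have card: "card J = n" unfolding Jeq by (simp add: card_image inj_on_def)
    have "(\<Prod>p\<in>J. ?a p / \<sigma> \<gamma>) = (\<Prod>i<n. unit_diag 0 \<epsilon> i)"
      unfolding Jeq using \<sigma>\<gamma> sg by (subst prod.reindex) (auto simp: inj_on_def symbol_diag_def)
    then have sq: "sq_class (\<Prod>p\<in>J. ?a p / \<sigma> \<gamma>) = \<epsilon>"
      using unit_diag(2)[of \<epsilon> "{..<n}" 0] n by simp
    show "gram_class M (\<sigma> \<gamma>) n \<epsilon>"
      using gram_class_isometric[OF DM gc1] unfolding card sq .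
    show "k = n \<and> \<delta> = \<epsilon>" if "gram_class M (\<sigma> \<gamma>) k \<delta>" "n \<le> k"
      using gc2[OF that(1)] that(2) unfolding card sq by blast
  }
  assume "s \<gamma> = None"
  then have "J = {}" by (auto simp: J symbol_index_def)
  then show "k = 0" if "gram_class M (\<sigma> \<gamma>) k \<delta>"
    using gc2[OF that] by simp
qed

text \<open>At a value in both symbols, \<open>gram_class\<close> holds with the larger of the two ranks, and for the symbol with
  the smaller rank this forces equality of the ranks and of the signs. A value that is missing in one of the
  symbols is treated alike, with \<open>0\<close> as its rank.\<close>

lemma jordan_symbol_unique:
  fixes M :: "('k, 'b, 'y) form_module_scheme"
  assumes \<sigma>: "\<And>\<gamma>. 0 \<le> \<gamma> \<Longrightarrow> \<sigma> \<gamma> \<noteq> 0 \<and> v (\<sigma> \<gamma>) = \<gamma>" and M: "module (val_ring v) M"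
    and s: "jordan_symbol s" "isometric (val_ring v) M (jordan_lattice v \<sigma> s)"
    and t: "jordan_symbol t" "isometric (val_ring v) M (jordan_lattice v \<sigma> t)"
  shows "s = t"
proof
  fix \<gamma> :: 'g
  have some: "0 \<le> \<gamma> \<and> 1 \<le> n" if "jordan_symbol u" "u \<gamma> = Some (n, \<epsilon>)" for u n \<epsilon>
    using that unfolding jordan_symbol_def by blast
  have none: "t \<gamma> = None"
    if st: "jordan_symbol s" "isometric (val_ring v) M (jordan_lattice v \<sigma> s)"
      "jordan_symbol t" "isometric (val_ring v) M (jordan_lattice v \<sigma> t)" "s \<gamma> = None" for s t
  proof (cases "t \<gamma>")
    case (Some p)
    then obtain n \<epsilon> where tg: "t \<gamma> = Some (n, \<epsilon>)" by (cases p) auto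
    note pos = some[OF st(3) tg]
    have "gram_class M (\<sigma> \<gamma>) n \<epsilon>"
      using gram_class_jordan(1)[OF \<sigma> M st(3,4) _ tg] pos by blast
    then have "n = 0"
      using gram_class_jordan(3)[OF \<sigma> M st(1,2) _ st(5)] pos by blast
    then show ?thesis using pos by simp
  qed
  show "s \<gamma> = t \<gamma>"
  proof (cases "s \<gamma> = None \<or> t \<gamma> = None")
    case True
    then show ?thesis using none[OF s t] none[OF t s] by auto
  next
    case False
    then obtain n \<epsilon> k \<delta> where st: "s \<gamma> = Some (n, \<epsilon>)" "t \<gamma> = Some (k, \<delta>)"
      by (cases "s \<gamma>"; cases "t \<gamma>") auto
    note pos = some[OF s(1) st(1)]
    have g: "gram_class M (\<sigma> \<gamma>) n \<epsilon>" "gram_class M (\<sigma> \<gamma>) k \<delta>"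
      using gram_class_jordan(1)[OF \<sigma> M s _ st(1)] gram_class_jordan(1)[OF \<sigma> M t _ st(2)] pos by blast+
    show ?thesis
    proof (cases "n \<le> k")
      case True
      then show ?thesis using gram_class_jordan(2)[OF \<sigma> M s _ st(1) g(2)] pos st by simp
    next
      case False
      then show ?thesis using gram_class_jordan(2)[OF \<sigma> M t _ st(2) g(1)] pos st by simp
    qed
  qed
qed

end

theorem proposition2p6:
  fixes v :: "'k::field \<Rightarrow> 'g::linordered_ab_group_add"
    and \<sigma> :: "'g \<Rightarrow> 'k"
    and M :: "('k, 'm) form_module"
  assumes "field_valuation v"
    and "two_henselian v"
    and "finite (carrier (residue_field v))"
    and "odd (ring_char (residue_field v))"
    and "\<And>\<gamma>. 0 \<le> \<gamma> \<Longrightarrow> \<sigma> \<gamma> \<noteq> 0 \<and> v (\<sigma> \<gamma>) = \<gamma>"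
    and "\<sigma> 0 = 1"
    and "form_lattice (val_ring v) M"
  shows "\<exists>!s. jordan_symbol s \<and> isometric (val_ring v) M (jordan_lattice v \<sigma> s)"
proof -
  interpret field_valuation v by (rule assms(1))
  interpret odd_henselian v
    by unfold_locales (use assms in auto)
  have M: "module (val_ring v) M" using assms(7) by (simp add: form_lattice_def)
  obtain s where "jordan_symbol s" "isometric (val_ring v) M (jordan_lattice v \<sigma> s)"
    using jordan_decomposition_exists[OF assms(5,7)] by blast
  then show ?thesis
    using jordan_symbol_unique[OF assms(5) M] by blast
qed

end
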